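(* Let $M$ be a squat, separable manifold and let $\mathcal F$ be a dimension-one foliation on $M\times\mathbb L_+$ having at least one long leaf. Then there is $\alpha\in\mathbb L_+$ such that the restriction of $\mathcal F$ to $M\times(\alpha,\omega_1)$ is the trivial product foliation by long rays, i.e. its leaves are the sets $\{x\}\times(\alpha,\omega_1)$, $x\in M$.
   Context: The closed long ray $\mathbb L_{\ge 0}$ is $\omega_1\times[0,1)$ with the order topology of the lexicographic order; the long ray is $\mathbb L_+=\mathbb L_{\ge0}\setminus\{0\}$, and the long line $\mathbb L$ is the double of $\mathbb L_{\ge 0}$. For $\alpha\in\mathbb L_+$, $(\alpha,\omega_1)=\{x\in\mathbb L_+:x>\alpha\}$. Manifold: a non-empty, connected, Hausdorff space in which every point has a neighbourhood homeomorphic to $\mathbb R^n$, for a fixed $n$ (metrisability is not assumed). Squat: a topological space $X$ is squat if every continuous map $f:\mathbb L_+\to X$ is eventually constant, i.e. there are $\beta\in\mathbb L_+$ and $x\in X$ with $f(\alpha)=x$ for all $\alpha\ge\beta$. Foliation: a foliation $\mathcal F$ of dimension $p$ on an $n$-manifold is a maximal atlas $\{(U_i,\varphi_i)\}_{i\in I}$ such that all coordinate changes have the form $\varphi_j\varphi_i^{-1}(x,y)=(g_{i,j}(x,y),h_{i,j}(y))$ for $(x,y)\in\varphi_i(U_i\cap U_j)\subset\mathbb R^p\times\mathbb R^{n-p}$, where $h_{i,j}$ is an embedding of a relevant open subset of $\mathbb R^{n-p}$ into $\mathbb R^{n-p}$ (only continuity is required). Components of the sets $\varphi_i^{-1}(\mathbb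 R^p\times\{y\})$ are called plaques; they form a basis of the leaf topology, whose path components are the leaves (regarded as $p$-manifolds with the leaf topology). Long leaf: a leaf of a dimension-one foliation is long if, as a one-manifold, it is non-metrisable (equivalently homeomorphic to $\mathbb L_+$ or $\mathbb L$). *)

theory Defs
  imports "HOL-Analysis.Analysis" "HOL-Library.Countable_Set_Type"
begin

section \<open>The first uncountable ordinal\<close>

text \<open>The cardinal successor of \<open>natLeq\<close> is a well-order of type \<open>\<omega>\<^sub>1\<close>, on a set of
  sets of natural numbers. The facts \<open>uncountable_omega1\<close> and \<open>countable_lessThan_omega1\<close>
  below characterise it up to order isomorphism.\<close>

typedef omega1 = "Field (cardSuc natLeq)"
  using Field_cardSuc_not_empty[OF natLeq_Card_order] by blast

lemma Well_order_cardSuc_natLeq: "Well_order (cardSuc natLeq)"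
  using cardSuc_Card_order[OF natLeq_Card_order] by (simp add: card_order_on_def)

instantiation omega1 :: wellorder
begin

definition less_eq_omega1 :: "omega1 \<Rightarrow> omega1 \<Rightarrow> bool"
  where "x \<le> y \<longleftrightarrow> (Rep_omega1 x, Rep_omega1 y) \<in> cardSuc natLeq"

definition less_omega1 :: "omega1 \<Rightarrow> omega1 \<Rightarrow> bool"
  where "(x :: omega1) < y \<longleftrightarrow> x \<le> y \<and> x \<noteq> y"

instance
proof
  have wo: "refl_on (Field (cardSuc natLeq)) (cardSuc natLeq)" "trans (cardSuc natLeq)"
    "antisym (cardSuc natLeq)" "total_on (Field (cardSuc natLeq)) (cardSuc natLeq)"
    using Well_order_cardSuc_natLeq
    by (simp_all add: well_order_on_def linear_order_on_def partial_order_on_def preorder_on_def)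
  fix x y z :: omega1
  show anti: "x = y" if "x \<le> y" "y \<le> x"
    using antisymD[OF wo(3)] that unfolding less_eq_omega1_def
    by (simp flip: Rep_omega1_inject)
  show "x < y \<longleftrightarrow> x \<le> y \<and> \<not> y \<le> x"
    using anti refl_onD[OF wo(1) Rep_omega1] unfolding less_omega1_def less_eq_omega1_def by metis
  show refl: "x \<le> x"
    unfolding less_eq_omega1_def by (rule refl_onD[OF wo(1) Rep_omega1])
  show "x \<le> z" if "x \<le> y" "y \<le> z"
    using transD[OF wo(2)] that unfolding less_eq_omega1_def by simp
  show "x \<le> y \<or> y \<le> x"
  proof (cases "x = y")
    case False
    then have "Rep_omega1 x \<noteq> Rep_omega1 y" by (simp add: Rep_omega1_inject)
    then show ?thesis
      using wo(4) Rep_omega1[of x] Rep_omega1[of y]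
      unfolding less_eq_omega1_def total_on_def by simp
  qed (use refl in simp)
next
  fix P :: "omega1 \<Rightarrow> bool" and a
  assume step: "\<And>x. (\<And>y. y < x \<Longrightarrow> P y) \<Longrightarrow> P x"
  have "wf (inv_image (cardSuc natLeq - Id) Rep_omega1)"
    by (rule wf_inv_image) (use Well_order_cardSuc_natLeq in \<open>simp add: well_order_on_def\<close>)
  then show "P a"
    by (induction a rule: wf_induct_rule)
      (rule step, simp add: less_omega1_def less_eq_omega1_def Rep_omega1_inject)
qed

end

lemma uncountable_omega1: "uncountable (UNIV :: omega1 set)"
proof
  assume "countable (UNIV :: omega1 set)"
  then have "countable (range Rep_omega1)" by (rule countable_image)
  then have "countable (Field (cardSuc natLeq))"
    by (simp only: type_definition.Rep_range[OF type_definition_omega1])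
  then have "(card_of (Field (cardSuc natLeq)), natLeq) \<in> ordLeq"
    by (simp only: countable_card_le_natLeq)
  moreover have "(natLeq, card_of (Field (cardSuc natLeq))) \<in> ordLess"
    by (rule ordLess_ordIso_trans[OF cardSuc_greater[OF natLeq_Card_order]
          ordIso_symmetric[OF card_of_Field_ordIso[OF cardSuc_Card_order[OF natLeq_Card_order]]]])
  ultimately show False
    using not_ordLess_ordLeq by blast
qed

lemma countable_lessThan_omega1: "countable {..< a :: omega1}"
proof -
  have "(card_of (underS (cardSuc natLeq) (Rep_omega1 a)), cardSuc natLeq) \<in> ordLess"
    by (rule card_of_underS[OF cardSuc_Card_order[OF natLeq_Card_order] Rep_omega1])
  then have "countable (underS (cardSuc natLeq) (Rep_omega1 a))"
    by (simp only: cardSuc_ordLeq_ordLess[OF natLeq_Card_order card_of_Card_order]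
        countable_card_le_natLeq)
  moreover have "Rep_omega1 ` {..<a} \<subseteq> underS (cardSuc natLeq) (Rep_omega1 a)"
    by (auto simp: underS_def less_omega1_def less_eq_omega1_def Rep_omega1_inject)
  ultimately have "countable (Rep_omega1 ` {..<a})"
    by (rule countable_subset[rotated])
  then show ?thesis
    by (rule countable_image_inj_on) (simp add: inj_on_def Rep_omega1_inject)
qed


section \<open>The closed long ray and the long ray\<close>

typedef closed_long_ray = "(UNIV :: omega1 set) \<times> {0 ..< 1 :: real}"
  by (rule exI[of _ "(undefined, 0)"]) simp

instantiation closed_long_ray :: linorder
begin

definition less_eq_closed_long_ray :: "closed_long_ray \<Rightarrow> closed_long_ray \<Rightarrow> bool"
  where "x \<le> y \<longleftrightarrow>
    fst (Rep_closed_long_ray x) < fst (Rep_closed_long_ray y) \<or>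
    fst (Rep_closed_long_ray x) = fst (Rep_closed_long_ray y) \<and>
    snd (Rep_closed_long_ray x) \<le> snd (Rep_closed_long_ray y)"

definition less_closed_long_ray :: "closed_long_ray \<Rightarrow> closed_long_ray \<Rightarrow> bool"
  where "(x :: closed_long_ray) < y \<longleftrightarrow> x \<le> y \<and> \<not> y \<le> x"

instance
proof
  fix x y :: closed_long_ray
  show "x = y" if "x \<le> y" "y \<le> x"
    using that unfolding less_eq_closed_long_ray_def
    by (metis Rep_closed_long_ray_inject antisym less_asym prod_eq_iff)
qed (auto simp: less_eq_closed_long_ray_def less_closed_long_ray_def)

end

instantiation closed_long_ray :: order_bot
begin

definition bot_closed_long_ray :: closed_long_ray
  where "bot = Abs_closed_long_ray (LEAST a. True, 0)"

instance
proof
  fix x :: closed_long_ray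
  have "(LEAST a :: omega1. True) \<le> fst (Rep_closed_long_ray x)"
    by (simp add: Least_le)
  moreover have "0 \<le> snd (Rep_closed_long_ray x)"
    using Rep_closed_long_ray[of x] by auto
  ultimately show "bot \<le> x"
    by (auto simp: bot_closed_long_ray_def less_eq_closed_long_ray_def
        Abs_closed_long_ray_inverse)
qed

end

instantiation closed_long_ray :: linorder_topology
begin

definition open_closed_long_ray :: "closed_long_ray set \<Rightarrow> bool"
  where "open_closed_long_ray =
    generate_topology (range (\<lambda>a. {..<a}) \<union> range (\<lambda>a. {a<..}))"

instance
  by standard (rule open_closed_long_ray_def)

end

text \<open>The element \<open>bot\<close> is the endpoint \<open>0\<close> of the closed long ray.\<close>

abbreviation long_ray_set :: "closed_long_ray set"
  where "long_ray_set \<equiv> - {bot}"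

abbreviation long_ray :: "closed_long_ray topology"
  where "long_ray \<equiv> top_of_set long_ray_set"


section \<open>Manifolds and squat spaces\<close>

definition manifold :: "nat \<Rightarrow> 'a topology \<Rightarrow> bool"
  where "manifold n X \<longleftrightarrow>
    topspace X \<noteq> {} \<and> connected_space X \<and> Hausdorff_space X \<and>
    (\<forall>x \<in> topspace X. \<exists>U. openin X U \<and> x \<in> U \<and>
       subtopology X U homeomorphic_space Euclidean_space n)"

definition squat :: "'a topology \<Rightarrow> bool"
  where "squat X \<longleftrightarrow>
    (\<forall>f. continuous_map long_ray X f \<longrightarrow>
       (\<exists>\<beta> \<in> long_ray_set. \<exists>x \<in> topspace X. \<forall>\<alpha> \<in> long_ray_set. \<beta> \<le> \<alpha> \<longrightarrow> f \<alpha> = x))"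


section \<open>Foliations\<close>

text \<open>A chart is a pair of a domain \<open>U\<close> and a map, of which only the values on \<open>U\<close> matter.\<close>

type_synonym 'a chart = "'a set \<times> ('a \<Rightarrow> (nat \<Rightarrow> real) \<times> (nat \<Rightarrow> real))"

definition is_chart :: "nat \<Rightarrow> nat \<Rightarrow> 'a topology \<Rightarrow> 'a chart \<Rightarrow> bool"
  where "is_chart n p X = (\<lambda>(U, \<phi>).
    openin X U \<and>
    (\<exists>V. openin (prod_topology (Euclidean_space p) (Euclidean_space (n - p))) V \<and>
       homeomorphic_map (subtopology X U)
         (subtopology (prod_topology (Euclidean_space p) (Euclidean_space (n - p))) V) \<phi>))"

text \<open>The coordinate change is \<open>\<psi> \<circ> \<phi>\<inverse>\<close> on \<open>\<phi> ` (U \<inter> V)\<close>; its arguments are written as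
  \<open>\<phi> z = (x, y)\<close> with \<open>z \<in> U \<inter> V\<close>.\<close>

definition foliated_change :: "nat \<Rightarrow> nat \<Rightarrow> 'a chart \<Rightarrow> 'a chart \<Rightarrow> bool"
  where "foliated_change n p = (\<lambda>(U, \<phi>) (V, \<psi>).
    \<exists>g h D. openin (Euclidean_space (n - p)) D \<and>
      embedding_map (subtopology (Euclidean_space (n - p)) D) (Euclidean_space (n - p)) h \<and>
      (\<forall>z \<in> U \<inter> V. \<forall>x y. \<phi> z = (x, y) \<longrightarrow> y \<in> D \<and> \<psi> z = (g (x, y), h y)))"

definition foliated_atlas :: "nat \<Rightarrow> nat \<Rightarrow> 'a topology \<Rightarrow> 'a chart set \<Rightarrow> bool"
  where "foliated_atlas n p X \<F> \<longleftrightarrow>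
    (\<forall>c \<in> \<F>. is_chart n p X c) \<and>
    (\<Union>(U, \<phi>) \<in> \<F>. U) = topspace X \<and>
    (\<forall>c \<in> \<F>. \<forall>d \<in> \<F>. foliated_change n p c d)"

definition foliation :: "nat \<Rightarrow> nat \<Rightarrow> 'a topology \<Rightarrow> 'a chart set \<Rightarrow> bool"
  where "foliation n p X \<F> \<longleftrightarrow>
    manifold n X \<and> p \<le> n \<and> foliated_atlas n p X \<F> \<and>
    (\<forall>\<G>. foliated_atlas n p X \<G> \<and> \<F> \<subseteq> \<G> \<longrightarrow> \<G> = \<F>)"

definition plaques :: "'a topology \<Rightarrow> 'a chart set \<Rightarrow> 'a set set"
  where "plaques X \<F> =
    (\<Union>(U, \<phi>) \<in> \<F>. \<Union>y. connected_components_of (subtopology X {z \<in> U. snd (\<phi> z) = y}))"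

text \<open>For a maximal atlas the plaques are a basis, not only a subbasis, of this topology,
  since such an atlas contains the restrictions of its charts to open subsets.\<close>

definition leaf_topology :: "'a topology \<Rightarrow> 'a chart set \<Rightarrow> 'a topology"
  where "leaf_topology X \<F> = topology_generated_by (plaques X \<F>)"

definition leaves :: "'a topology \<Rightarrow> 'a chart set \<Rightarrow> 'a set set"
  where "leaves X \<F> = path_components_of (leaf_topology X \<F>)"

definition long_leaf :: "'a topology \<Rightarrow> 'a chart set \<Rightarrow> 'a set \<Rightarrow> bool"
  where "long_leaf X \<F> L \<longleftrightarrow>
    L \<in> leaves X \<F> \<and> \<not> metrizable_space (subtopology (leaf_topology X \<F>) L)"

definition restrict_foliation :: "'a chart set \<Rightarrow> 'a set \<Rightarrow> 'a chart set"
  where "restrict_foliation \<F> W = (\<lambda>(U, \<phi>). (U \<inter> W, \<phi>)) ` \<F>"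

end

theory Submission
  imports Defs
begin

text \<open>A connected Hausdorff one-manifold is covered by two maximal injective rays, each of which is
  either sigma-compact or an injective continuous image of the whole closed long ray; if both are
  sigma-compact, the manifold is metrizable. In a leaf of \<open>M \<times> L\<^sub>+\<close>, a sigma-compact ray is bounded in
  the long direction, and a long ray is eventually vertical, since \<open>M\<close> is squat. So above some height
  each leaf lies over the set of points \<open>x\<close> whose vertical line is eventually contained in a leaf.
  A long leaf makes this set nonempty.

  The points whose line is vertical above a fixed height \<open>a\<close> form a closed set \<open>V a\<close>. To see that the
  union of all \<open>V a\<close> is open, let \<open>x \<in> V a\<close> and consider the countably many leaves through a countable
  dense subset of a slab just above \<open>a\<close>. The interior of the closure of their union \<open>S\<close> is saturated, so
  it contains \<open>(x, r)\<close> for all \<open>r > a\<close>. Above a common height \<open>g\<close> the set \<open>S\<close> lies over the closed set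
  \<open>V g\<close>, hence \<open>V g\<close> is a neighbourhood of \<open>x\<close>. By separability the union is a single \<open>V a\<close>; being clopen
  it is all of \<open>M\<close>.\<close>

section \<open>The long ray as a linear continuum\<close>

text \<open>The obstacle is length: above height \<open>a\<close>, the line over \<open>x\<close>
  passes through uncountably many charts, and the neighbourhoods of \<open>x\<close> that they
  provide cannot simply be intersected. What does travel up the line is membership in a saturated
  open set: it is locally constant along a vertical line, so connectedness of \<open>{a<..}\<close>
  carries it to every height. The union \<open>S\<close> of countably many leaves is saturated, but
  it need not be open or contain a point over \<open>x\<close>. The interior of its closure is open,
  still saturated, and contains the slab by density; passing to the closure does no harm because
  \<open>vertical g\<close> is closed. Countability links \<open>M\<close> with the ray. Countably
  many heights have a common upper bound, which turns countably many leaf bounds into one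
  \<open>g\<close>, and bounds at the points of a dense set into one \<alpha>. In the same spirit,
  no tail of the long ray maps continuously and injectively into an order with a countable dense
  set; hence a long ray cannot end inside a chart, and the height along it is unbounded. Once every
  line above \<alpha> is vertical, the lines are connected and clopen in the leaf topology, so they
  are its leaves.\<close>

definition ray_point :: "omega1 \<Rightarrow> real \<Rightarrow> closed_long_ray"
  where "ray_point a s = Abs_closed_long_ray (a, s)"

definition ray_block :: "closed_long_ray \<Rightarrow> omega1"
  where "ray_block x = fst (Rep_closed_long_ray x)"

definition ray_coord :: "closed_long_ray \<Rightarrow> real"
  where "ray_coord x = snd (Rep_closed_long_ray x)"

lemma ray_coord_bounds [simp]: "0 \<le> ray_coord x" "ray_coord x < 1"
  using Rep_closed_long_ray[of x] by (auto simp: ray_coord_def)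

lemma not_ray_coord_neg [simp]: "\<not> ray_coord x < 0"
  by (simp add: not_less)

lemma ray_block_point [simp]: "0 \<le> s \<Longrightarrow> s < 1 \<Longrightarrow> ray_block (ray_point a s) = a"
  and ray_coord_point [simp]: "0 \<le> s \<Longrightarrow> s < 1 \<Longrightarrow> ray_coord (ray_point a s) = s"
  by (simp_all add: ray_block_def ray_coord_def ray_point_def Abs_closed_long_ray_inverse)

lemma ray_point_block_coord [simp]: "ray_point (ray_block x) (ray_coord x) = x"
  by (simp add: ray_block_def ray_coord_def ray_point_def Rep_closed_long_ray_inverse)

lemma ray_le_iff:
  "x \<le> y \<longleftrightarrow> ray_block x < ray_block y \<or> ray_block x = ray_block y \<and> ray_coord x \<le> ray_coord y"
  by (simp add: less_eq_closed_long_ray_def ray_block_def ray_coord_def)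

lemma ray_less_iff:
  "x < y \<longleftrightarrow> ray_block x < ray_block y \<or> ray_block x = ray_block y \<and> ray_coord x < ray_coord y"
  by (auto simp: less_le_not_le[of x y] ray_le_iff)

lemma ray_coord_bot [simp]: "ray_coord bot = 0"
  and ray_block_bot_le [simp]: "ray_block bot \<le> a"
  by (auto simp: bot_closed_long_ray_def ray_coord_def ray_block_def Abs_closed_long_ray_inverse
      intro: Least_le)

text \<open>If \<open>A\<close> were cofinal, \<omega>1 would be a countable union of countable
  initial segments. Every choice of a common height below goes back to this.\<close>

lemma omega1_bounded_countable:
  fixes A :: "omega1 set"
  assumes "countable A"
  shows "\<exists>b. \<forall>a\<in>A. a < b"
proof (rule ccontr)
  assume "\<not> ?thesis"
  then have "\<forall>b. \<exists>a\<in>A. b \<le> a" by (meson not_less)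
  then have "UNIV \<subseteq> (\<Union>a\<in>A. insert a {..<a})" by (auto simp: le_less)
  moreover have "countable (\<Union>a\<in>A. insert a {..<a})"
    using assms countable_lessThan_omega1 by blast
  ultimately show False
    using uncountable_omega1 countable_subset by blast
qed

lemma omega1_gt_ex: "\<exists>b. (a::omega1) < b"
  using omega1_bounded_countable[of "{a}"] by auto

lemma ray_bounded_countable:
  fixes A :: "closed_long_ray set"
  assumes "countable A"
  shows "\<exists>b. \<forall>a\<in>A. a < b"
proof -
  obtain c where "\<forall>a\<in>ray_block ` A. a < c"
    using omega1_bounded_countable[of "ray_block ` A"] assms by auto
  then have "\<forall>a\<in>A. a < ray_point c 0" by (auto simp: ray_less_iff)
  then show ?thesis by blast
qed

instance closed_long_ray :: dense_linorder
proof
  fix x y :: closed_long_ray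
  assume "x < y"
  then consider "ray_block x < ray_block y" | "ray_block x = ray_block y" "ray_coord x < ray_coord y"
    by (auto simp: ray_less_iff)
  then show "\<exists>z>x. z < y"
  proof cases
    case 1
    show ?thesis
    proof (intro exI conjI)
      have *: "0 \<le> (ray_coord x + 1) / 2" "(ray_coord x + 1) / 2 < 1" "ray_coord x < (ray_coord x + 1) / 2"
        using ray_coord_bounds[of x] by (simp_all add: add_nonneg_nonneg)
      show "x < ray_point (ray_block x) ((ray_coord x + 1) / 2)"
        using * by (simp add: ray_less_iff)
      show "ray_point (ray_block x) ((ray_coord x + 1) / 2) < y"
        using * 1 by (simp add: ray_less_iff)
    qed
  next
    case 2
    let ?s = "(ray_coord x + ray_coord y) / 2"
    have "ray_coord x + ray_coord y < 1 + 1" by (intro add_strict_mono) simp_all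
    then have *: "0 \<le> ?s" "?s < 1" "ray_coord x < ?s" "?s < ray_coord y"
      using 2 by (simp_all add: field_simps)
    show ?thesis
      by (rule exI[of _ "ray_point (ray_block x) ?s"]) (use * 2 in \<open>simp add: ray_less_iff\<close>)
  qed
qed

instance closed_long_ray :: no_top
proof
  fix x :: closed_long_ray
  show "\<exists>y. x < y" using ray_bounded_countable[of "{x}"] by auto
qed

text \<open>Well-ordering selects the least block containing an upper bound; completeness of the
  reals then selects the coordinate inside that block.\<close>

lemma ray_lub_ex:
  fixes A :: "closed_long_ray set"
  assumes "A \<noteq> {}" and bdd: "\<forall>x\<in>A. x \<le> z"
  shows "\<exists>u. (\<forall>x\<in>A. x \<le> u) \<and> (\<forall>v. (\<forall>x\<in>A. x \<le> v) \<longrightarrow> u \<le> v)"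
proof -
  define P where "P b \<longleftrightarrow> (\<exists>v. (\<forall>x\<in>A. x \<le> v) \<and> ray_block v = b)" for b
  define b where "b = (LEAST b. P b)"
  have "P (ray_block z)" using bdd by (auto simp: P_def)
  then have "P b" unfolding b_def by (rule LeastI)
  then obtain w where w: "\<forall>x\<in>A. x \<le> w" "ray_block w = b" by (auto simp: P_def)
  have least: "b \<le> ray_block v" if "\<forall>x\<in>A. x \<le> v" for v
    unfolding b_def by (rule Least_le) (use that in \<open>auto simp: P_def\<close>)
  \<comment> \<open>The inserted 0 keeps \<open>T\<close> nonempty when no element of
    \<open>A\<close> lies in block \<open>b\<close>; the supremum is then the first point of that
    block.\<close>
  define T where "T = insert 0 (ray_coord ` {x\<in>A. ray_block x = b})"
  have bT: "t \<le> ray_coord v" if "t \<in> T" "\<forall>x\<in>A. x \<le> v" "ray_block v = b" for t v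
    using that by (auto simp: T_def ray_le_iff)
  have bddT: "bdd_above T" using bT w by (auto intro!: bdd_aboveI[of _ "ray_coord w"])
  have s: "0 \<le> Sup T" "Sup T < 1"
  proof -
    show "0 \<le> Sup T" using bddT by (auto intro: cSup_upper simp: T_def)
    have "Sup T \<le> ray_coord w" by (rule cSup_least) (use bT w in \<open>auto simp: T_def\<close>)
    then show "Sup T < 1" using ray_coord_bounds(2)[of w] by linarith
  qed
  let ?u = "ray_point b (Sup T)"
  have "x \<le> ?u" if "x \<in> A" for x
  proof (cases "ray_block x = b")
    case True
    then have "ray_coord x \<le> Sup T" using bddT that by (auto intro!: cSup_upper simp: T_def)
    then show ?thesis using True s by (simp add: ray_le_iff)
  next
    case False
    then have "ray_block x < b" using w that by (auto simp: ray_le_iff)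
    then show ?thesis using s by (simp add: ray_le_iff)
  qed
  moreover have "?u \<le> v" if v: "\<forall>x\<in>A. x \<le> v" for v
  proof (cases "ray_block v = b")
    case True
    have "Sup T \<le> ray_coord v" by (rule cSup_least) (use bT v True in \<open>auto simp: T_def\<close>)
    then show ?thesis using True s by (simp add: ray_le_iff)
  next
    case False
    then show ?thesis using least[OF v] s by (simp add: ray_le_iff)
  qed
  ultimately show ?thesis by blast
qed

instantiation closed_long_ray :: linear_continuum_topology
begin

definition sup_closed_long_ray :: "closed_long_ray \<Rightarrow> closed_long_ray \<Rightarrow> closed_long_ray"
  where "sup_closed_long_ray = max"

definition inf_closed_long_ray :: "closed_long_ray \<Rightarrow> closed_long_ray \<Rightarrow> closed_long_ray"
  where "inf_closed_long_ray = min"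

definition Sup_closed_long_ray :: "closed_long_ray set \<Rightarrow> closed_long_ray"
  where "Sup_closed_long_ray A = (LEAST u. \<forall>x\<in>A. x \<le> u)"

text \<open>The formula is the least upper bound of the set of lower bounds, so every fact about
  \<open>Inf\<close> reduces to one about \<open>Sup\<close>; \<open>bot\<close> guarantees that
  there is a lower bound.\<close>

definition Inf_closed_long_ray :: "closed_long_ray set \<Rightarrow> closed_long_ray"
  where "Inf_closed_long_ray A = (LEAST u. \<forall>v. (\<forall>x\<in>A. v \<le> x) \<longrightarrow> v \<le> u)"

instance
proof
  fix x y z :: closed_long_ray and A :: "closed_long_ray set"
  show "inf x y \<le> x" "inf x y \<le> y" "x \<le> y \<Longrightarrow> x \<le> z \<Longrightarrow> x \<le> inf y z"
    by (auto simp: inf_closed_long_ray_def)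
  show "x \<le> sup x y" "y \<le> sup x y" "x \<le> y \<Longrightarrow> z \<le> y \<Longrightarrow> sup x z \<le> y"
    by (auto simp: sup_closed_long_ray_def)
  have Sup: "(\<forall>x\<in>A. x \<le> Sup A) \<and> (\<forall>v. (\<forall>x\<in>A. x \<le> v) \<longrightarrow> Sup A \<le> v)"
    if A: "A \<noteq> {}" "\<forall>x\<in>A. x \<le> z" for z and A :: "closed_long_ray set"
  proof -
    obtain u where u: "\<forall>x\<in>A. x \<le> u" "\<forall>v. (\<forall>x\<in>A. x \<le> v) \<longrightarrow> u \<le> v"
      using ray_lub_ex[OF A] by blast
    have "Sup A = u" unfolding Sup_closed_long_ray_def by (rule Least_equality) (use u in auto)
    then show ?thesis using u by simp
  qed
  show "x \<in> A \<Longrightarrow> bdd_above A \<Longrightarrow> x \<le> Sup A"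
    by (metis Sup bdd_above.E empty_iff)
  show "A \<noteq> {} \<Longrightarrow> (\<And>x. x \<in> A \<Longrightarrow> x \<le> z) \<Longrightarrow> Sup A \<le> z"
    using Sup by blast
  have Inf: "Inf A = Sup {v. \<forall>x\<in>A. v \<le> x}" for A :: "closed_long_ray set"
    unfolding Inf_closed_long_ray_def Sup_closed_long_ray_def by simp
  have lower: "{v. \<forall>x\<in>A. v \<le> x} \<noteq> {}"
    by (auto intro!: exI[of _ bot])
  show "Inf A \<le> x" if "x \<in> A" "bdd_below A"
    using Sup[OF lower, of x] that(1) unfolding Inf by blast
  show "z \<le> Inf A" if "A \<noteq> {}" "\<And>x. x \<in> A \<Longrightarrow> z \<le> x"
  proof -
    obtain a where "a \<in> A" using \<open>A \<noteq> {}\<close> by blast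
    then show ?thesis using Sup[OF lower, of a] that(2) unfolding Inf by blast
  qed
  show "\<exists>a b :: closed_long_ray. a \<noteq> b"
    using gt_ex[of x] by (blast dest: less_imp_neq)
qed

end

section \<open>Compactness of closed intervals in a linear continuum\<close>

text \<open>The supremum \<open>s\<close> of the points that can be reached from \<open>a\<close>
  with a finite subcover lies in some member of the cover; that member reaches beyond
  \<open>s\<close> unless \<open>s = b\<close>.\<close>

lemma compact_Icc_linear_continuum:
  fixes a b :: "'a :: linear_continuum_topology"
  shows "compact {a..b}"
proof (cases "a \<le> b")
  case True
  show ?thesis
  proof (rule compactI)
    fix C :: "'a set set"
    assume C: "\<forall>t\<in>C. open t" and cover: "{a..b} \<subseteq> \<Union>C"
    define T where "T = {x\<in>{a..b}. \<exists>C'\<subseteq>C. finite C' \<and> {a..x} \<subseteq> \<Union>C'}"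
    obtain U0 where "U0 \<in> C" "a \<in> U0" using cover True by auto
    then have aT: "a \<in> T" using True by (auto simp: T_def intro!: exI[of _ "{U0}"])
    have bdd: "bdd_above T" by (auto simp: T_def intro!: bdd_aboveI[of _ b])
    define s where "s = Sup T"
    have sab: "a \<le> s" "s \<le> b"
    proof -
      show "a \<le> s" unfolding s_def by (rule cSup_upper[OF aT bdd])
      show "s \<le> b" unfolding s_def by (rule cSup_least) (use aT in \<open>blast, auto simp: T_def\<close>)
    qed
    then obtain U where U: "U \<in> C" "s \<in> U" "open U" using cover C by auto
    \<comment> \<open>From \<open>y\<close> on, the single set \<open>U\<close> covers everything up
      to \<open>s\<close>, so adjoining \<open>U\<close> to the finite subcover of
      \<open>{a..y}\<close> crosses \<open>s\<close>.\<close>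
    obtain y C' where y: "y \<le> s" "C' \<subseteq> C" "finite C'" "{a..y} \<subseteq> \<Union>C'" "{y..s} \<subseteq> U"
    proof (cases "s = a")
      case True
      show ?thesis by (rule that[of a "{U0}"]) (use True U \<open>U0 \<in> C\<close> \<open>a \<in> U0\<close> in auto)
    next
      case False
      then have "a < s" using sab by (simp add: le_neq_trans)
      then obtain c where c: "c < s" "{c<..s} \<subseteq> U"
        using open_left[of U s a] U by blast
      then obtain y where "y \<in> T" "c < y" using less_cSupE[of c T] aT by (auto simp: s_def)
      moreover have "y \<le> s" using \<open>y \<in> T\<close> bdd by (auto simp: s_def intro: cSup_upper)
      moreover obtain C' where "C' \<subseteq> C" "finite C'" "{a..y} \<subseteq> \<Union>C'"
        using \<open>y \<in> T\<close> by (auto simp: T_def)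
      moreover have "{y..s} \<subseteq> {c<..s}" using \<open>c < y\<close> by auto
      ultimately show ?thesis using that[of y C'] c(2) by blast
    qed
    have fin: "{a..x} \<subseteq> \<Union>(insert U C')" if "{s..x} \<subseteq> U" for x
    proof
      fix t assume "t \<in> {a..x}"
      then have "t \<in> {a..y} \<or> t \<in> {y..s} \<or> t \<in> {s..x}" by auto
      then show "t \<in> \<Union>(insert U C')" using y that by auto
    qed
    have "s = b"
    proof (rule ccontr)
      assume "s \<noteq> b"
      then have "s < b" using sab by (simp add: le_neq_trans)
      then obtain c where c: "s < c" "{s..<c} \<subseteq> U" using open_right[of U s b] U by blast
      obtain d where d: "s < d" "d < min c b" using dense[of s "min c b"] c \<open>s < b\<close> by auto
      have "{s..d} \<subseteq> {s..<c}" using d by auto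
      then have "{s..d} \<subseteq> U" using c by blast
      then have "d \<in> T"
        using fin[of d] y U d sab unfolding T_def
        by (intro CollectI conjI exI[of _ "insert U C'"]) auto
      then have "d \<le> s" using bdd by (auto simp: s_def intro: cSup_upper)
      then show False using d by simp
    qed
    then show "\<exists>C'\<subseteq>C. finite C' \<and> {a..b} \<subseteq> \<Union>C'"
      using fin[of b] y U by (intro exI[of _ "insert U C'"]) auto
  qed
qed simp

lemma ray_atMost_eq: "{..b} = {bot..b::closed_long_ray}"
  by auto

lemma compact_ray_atMost: "compact {..b::closed_long_ray}"
  unfolding ray_atMost_eq by (rule compact_Icc_linear_continuum)

section \<open>Real coordinates on a block, and countable order-dense sets below a bound\<close>

text \<open>Extending the coordinate of block \<open>a\<close> by the constants 0 and 1 gives a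
  globally continuous monotone function. The plain \<open>ray_coord\<close> jumps back to 0 at the
  start of every later block.\<close>

definition ray_clamp :: "omega1 \<Rightarrow> closed_long_ray \<Rightarrow> real"
  where "ray_clamp a x = (if ray_block x < a then 0 else if ray_block x = a then ray_coord x else 1)"

lemma ray_clamp_bounds: "0 \<le> ray_clamp a x" "ray_clamp a x \<le> 1"
  by (simp_all add: ray_clamp_def less_imp_le)

text \<open>The \<open>LEAST\<close> term is the successor of \<open>a\<close>, so block
  \<open>a\<close> ends exactly where the block of that successor begins.\<close>

lemma ray_block_less_suc: "ray_block x \<le> a \<longleftrightarrow> x < ray_point (LEAST b. a < b) 0"
proof -
  define e where "e = (LEAST b. a < b)"
  have "a < e" unfolding e_def using omega1_gt_ex by (metis LeastI)
  then have "b < e \<longleftrightarrow> b \<le> a" for b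
    unfolding e_def by (meson le_less_trans not_less_Least not_le_imp_less)
  moreover have "x < ray_point e 0 \<longleftrightarrow> ray_block x < e"
    by (simp add: ray_less_iff)
  ultimately show ?thesis by (simp add: e_def)
qed

lemma continuous_on_ray_clamp: "continuous_on S (ray_clamp a)"
proof -
  have gt: "open (ray_clamp a -` {c<..})" for c
  proof -
    consider "c < 0" | "0 \<le> c" "c < 1" | "c \<ge> 1" by linarith
    then show ?thesis
    proof cases
      case 1
      then have "ray_clamp a -` {c<..} = UNIV"
        using less_le_trans[OF 1 ray_clamp_bounds(1)] by auto
      then show ?thesis by simp
    next
      case 2
      then have "ray_clamp a -` {c<..} = {ray_point a c<..}"
        by (auto simp: ray_clamp_def ray_less_iff not_less split: if_splits)
      then show ?thesis by simp
    next
      case 3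
      then have "ray_clamp a -` {c<..} = {}"
        using order.trans[OF ray_clamp_bounds(2) 3] by (simp add: vimage_def leD)
      then show ?thesis by simp
    qed
  qed
  have lt: "open (ray_clamp a -` {..<c})" for c
  proof -
    consider "c \<le> 0" | "0 < c" "c < 1" | "c = 1" | "c > 1" by linarith
    then show ?thesis
    proof cases
      case 1
      then have "ray_clamp a -` {..<c} = {}"
        using order.trans[OF 1 ray_clamp_bounds(1)] by (simp add: vimage_def leD)
      then show ?thesis by simp
    next
      case 2
      then have "ray_clamp a -` {..<c} = {..<ray_point a c}"
        by (auto simp: ray_clamp_def ray_less_iff not_less split: if_splits)
      then show ?thesis by simp
    next
      case 3
      \<comment> \<open>The value 1 is first attained at the start of the next block, which is no
        \<open>ray_point a c\<close>; this threshold therefore needs the successor of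
        \<open>a\<close>.\<close>
      have "ray_clamp a -` {..<c} = {..<ray_point (LEAST b. a < b) 0}"
        unfolding set_eq_iff lessThan_iff ray_block_less_suc[symmetric]
        using 3 by (auto simp: ray_clamp_def)
      then show ?thesis by simp
    next
      case 4
      then have "ray_clamp a -` {..<c} = UNIV"
        using le_less_trans[OF ray_clamp_bounds(2) 4] by auto
      then show ?thesis by simp
    qed
  qed
  have "continuous_on UNIV (ray_clamp a)"
    by (subst continuous_on_generate_topology[OF open_generated_order])
      (use gt lt in \<open>auto simp: Int_commute\<close>)
  then show ?thesis by (rule continuous_on_subset) simp
qed

lemma ray_rational_dense:
  assumes "x < (y::closed_long_ray)"
  obtains z where "x < z" "z < y" "ray_coord z \<in> \<rat>"
proof (cases "ray_block x < ray_block y")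
  case True
  obtain r where "r \<in> \<rat>" "ray_coord x < r" "r < 1" using Rats_dense_in_real[of "ray_coord x" 1] by auto
  moreover have "0 \<le> r" using order.strict_trans1[OF ray_coord_bounds(1)[of x], of r] calculation by simp
  ultimately show ?thesis
    using that[of "ray_point (ray_block x) r"] True by (simp add: ray_less_iff)
next
  case False
  then have *: "ray_block x = ray_block y" "ray_coord x < ray_coord y"
    using assms by (auto simp: ray_less_iff)
  then obtain r where "r \<in> \<rat>" "ray_coord x < r" "r < ray_coord y"
    using Rats_dense_in_real by auto
  moreover have "0 \<le> r" "r < 1"
    using order.strict_trans1[OF ray_coord_bounds(1)[of x], of r]
      less_trans[OF _ ray_coord_bounds(2)[of y], of r] calculation by simp_all
  ultimately show ?thesis
    using that[of "ray_point (ray_block x) r"] * by (simp add: ray_less_iff)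
qed

text \<open>Only countably many blocks meet \<open>{..b}\<close>. With
  \<open>ray_rational_dense\<close> this makes every bounded part of the ray separable, so that
  \<open>no_continuous_inj_from_ray\<close> applies to maps with bounded range in the ray.\<close>

lemma countable_ray_rational_below: "countable {z::closed_long_ray. ray_coord z \<in> \<rat> \<and> z \<le> b}"
proof -
  have "{z. ray_coord z \<in> \<rat> \<and> z \<le> b} \<subseteq>
    (\<lambda>(a, s). ray_point a s) ` (({..<ray_block b} \<union> {ray_block b}) \<times> \<rat>)"
  proof
    fix z assume "z \<in> {z. ray_coord z \<in> \<rat> \<and> z \<le> b}"
    then show "z \<in> (\<lambda>(a, s). ray_point a s) ` (({..<ray_block b} \<union> {ray_block b}) \<times> \<rat>)"
      by (intro image_eqI[where x="(ray_block z, ray_coord z)"]) (auto simp: ray_le_iff)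
  qed
  moreover have "countable (({..<ray_block b} \<union> {ray_block b}) \<times> (\<rat>::real set))"
    using countable_lessThan_omega1 countable_rat by (auto intro!: countable_SIGMA)
  ultimately show ?thesis using countable_image countable_subset by blast
qed

text \<open>The images of the uncountably many blocks above \<open>s\<close> are disjoint nondegenerate
  intervals.\<close>

lemma no_continuous_inj_from_ray:
  fixes h :: "closed_long_ray \<Rightarrow> 'b :: linorder_topology"
  assumes cont: "continuous_on {s<..} h" and inj: "inj_on h {s<..}"
    and D: "countable D" "\<And>x y. x \<in> h ` {s<..} \<Longrightarrow> y \<in> h ` {s<..} \<Longrightarrow> x < y \<Longrightarrow> \<exists>d\<in>D. x < d \<and> d < y"
  shows False
proof -
  define p where "p a = ray_point a 0" for a
  \<comment> \<open>Stopping at coordinate 1/2 keeps \<open>{p a..q a}\<close> inside block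
    \<open>a\<close>, so the intervals for different \<open>a\<close> are disjoint.\<close>
  define q where "q a = ray_point a (1/2)" for a
  define A where "A = {a. ray_block s < a}"
  have pq: "p a < q a" "s < p a" "s < q a" if "a \<in> A" for a
    using that by (auto simp: p_def q_def A_def ray_less_iff)
  have "\<exists>d\<in>D. d \<in> h ` {p a..q a}" if "a \<in> A" for a
  proof -
    have c: "connected (h ` {p a..q a})"
      by (intro connected_continuous_image continuous_on_subset[OF cont])
        (use pq[OF that] in \<open>auto intro: less_le_trans\<close>)
    have ne: "h (p a) \<noteq> h (q a)" using inj pq[OF that] by (auto dest: inj_onD)
    have in1: "h (p a) \<in> h ` {s<..}" "h (q a) \<in> h ` {s<..}" using pq[OF that] by auto
    have in2: "h (p a) \<in> h ` {p a..q a}" "h (q a) \<in> h ` {p a..q a}" using pq[OF that] by auto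
    show ?thesis
    proof (cases "h (p a) < h (q a)")
      case True
      then obtain d where "d \<in> D" "h (p a) < d" "d < h (q a)" using D(2)[OF in1] by auto
      then show ?thesis using connected_contains_Ioo[OF c in2] by (meson greaterThanLessThan_iff subsetD)
    next
      case False
      then obtain d where "d \<in> D" "h (q a) < d" "d < h (p a)" using D(2)[OF in1(2,1)] ne by force
      then show ?thesis using connected_contains_Ioo[OF c in2(2,1)] by (meson greaterThanLessThan_iff subsetD)
    qed
  qed
  then obtain d where d: "\<And>a. a \<in> A \<Longrightarrow> d a \<in> D \<and> d a \<in> h ` {p a..q a}" by metis
  have "inj_on d A"
  proof
    fix a b assume ab: "a \<in> A" "b \<in> A" "d a = d b"
    then obtain x y where x: "x \<in> {p a..q a}" "d a = h x" and y: "y \<in> {p b..q b}" "d b = h y"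
      using d by blast
    then have "x \<in> {s<..}" "y \<in> {s<..}" using pq ab by (auto intro: less_le_trans)
    then have "x = y" using inj x y ab by (auto dest: inj_onD)
    moreover have "ray_block x = a" "ray_block y = b"
      using x(1) y(1) by (auto simp: p_def q_def ray_le_iff)
    ultimately show "a = b" by simp
  qed
  then have "countable A"
    by (rule countable_image_inj_on[rotated]) (use D(1) d in \<open>auto intro: countable_subset\<close>)
  moreover have "UNIV = A \<union> ({..<ray_block s} \<union> {ray_block s})" by (auto simp: A_def)
  ultimately have "countable (UNIV::omega1 set)"
    using countable_lessThan_omega1[of "ray_block s"]
    by (metis countable_Un countable_finite finite.emptyI finite_insert)
  then show False using uncountable_omega1 by simp
qed

section \<open>Maximal rays in one-manifolds\<close>

text \<open>The start of the block after that of \<open>b\<close>. On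
  \<open>{b..<ray_block_end b}\<close> the function \<open>ray_clamp (ray_block b)\<close> is
  injective with values below 1, so this interval serves as a standard half-open piece to append to
  a ray ending at \<open>b\<close>.\<close>

definition ray_block_end :: "closed_long_ray \<Rightarrow> closed_long_ray"
  where "ray_block_end b = ray_point (LEAST c. ray_block b < c) 0"

lemma less_ray_block_end: "x < ray_block_end b \<longleftrightarrow> ray_block x \<le> ray_block b"
  by (simp add: ray_block_end_def ray_block_less_suc)

lemma ray_block_eqI: "b \<le> x \<Longrightarrow> x < ray_block_end b \<Longrightarrow> ray_block x = ray_block b"
  by (auto simp: less_ray_block_end ray_le_iff)

lemma ray_clamp_mono: "x \<le> y \<Longrightarrow> ray_clamp a x \<le> ray_clamp a y"
  by (auto simp: ray_clamp_def ray_le_iff less_imp_le)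

lemma ray_clamp_inj:
  assumes "b \<le> x" "x < ray_block_end b" "b \<le> y" "y < ray_block_end b"
    "ray_clamp (ray_block b) x = ray_clamp (ray_block b) y"
  shows "x = y"
proof -
  have "ray_block x = ray_block b" "ray_block y = ray_block b"
    using assms ray_block_eqI by auto
  then show ?thesis
    using assms(5) by (metis less_irrefl ray_clamp_def ray_point_block_coord)
qed

lemma ray_clamp_less_one: "x < ray_block_end b \<Longrightarrow> ray_clamp (ray_block b) x < 1"
  by (auto simp: less_ray_block_end ray_clamp_def)

section \<open>Charts of a one-manifold onto open real intervals\<close>

definition interval_chart ::
    "'b topology \<Rightarrow> 'b set \<Rightarrow> ('b \<Rightarrow> real) \<Rightarrow> (real \<Rightarrow> 'b) \<Rightarrow> real set \<Rightarrow> bool"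
  where "interval_chart L I \<phi> \<psi> J \<longleftrightarrow> openin L I \<and> open J \<and> connected J \<and>
    homeomorphic_maps (subtopology L I) (top_of_set J) \<phi> \<psi>"

lemma interval_chartD:
  assumes "interval_chart L I \<phi> \<psi> J"
  shows "openin L I" "open J" "connected J" "I \<subseteq> topspace L"
    "continuous_map (subtopology L I) euclideanreal \<phi>" "continuous_map (top_of_set J) L \<psi>"
    "z \<in> I \<Longrightarrow> \<phi> z \<in> J" "s \<in> J \<Longrightarrow> \<psi> s \<in> I" "z \<in> I \<Longrightarrow> \<psi> (\<phi> z) = z" "s \<in> J \<Longrightarrow> \<phi> (\<psi> s) = s"
proof -
  show o: "openin L I" "open J" "connected J" using assms by (auto simp: interval_chart_def)
  show sub: "I \<subseteq> topspace L" using o openin_subset by auto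
  have h: "homeomorphic_maps (subtopology L I) (top_of_set J) \<phi> \<psi>"
    using assms by (auto simp: interval_chart_def)
  have ts: "topspace (subtopology L I) = I" "topspace (top_of_set J) = J" using sub by auto
  show "continuous_map (subtopology L I) euclideanreal \<phi>" "continuous_map (top_of_set J) L \<psi>"
    "z \<in> I \<Longrightarrow> \<phi> z \<in> J" "s \<in> J \<Longrightarrow> \<psi> s \<in> I" "z \<in> I \<Longrightarrow> \<psi> (\<phi> z) = z" "s \<in> J \<Longrightarrow> \<phi> (\<psi> s) = s"
    using h sub unfolding homeomorphic_maps_def continuous_map_in_subtopology ts by auto
qed

lemma interval_chart_vimage_open:
  assumes "interval_chart L I \<phi> \<psi> J" "open U"
  shows "openin L {z \<in> I. \<phi> z \<in> U}"
proof -
  have "openin (subtopology L I) {z \<in> topspace (subtopology L I). \<phi> z \<in> U}"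
    by (rule openin_continuous_map_preimage[OF interval_chartD(5)[OF assms(1)]]) (use assms(2) in simp)
  moreover have "topspace (subtopology L I) = I"
    using interval_chartD(4)[OF assms(1)] by auto
  ultimately show ?thesis
    using interval_chartD(1)[OF assms(1)] openin_open_subtopology by metis
qed

lemma interval_chart_uminus:
  assumes "interval_chart L I \<phi> \<psi> J"
  shows "interval_chart L I (\<lambda>z. - \<phi> z) (\<lambda>s. \<psi> (- s)) (uminus ` J)"
proof -
  note c = interval_chartD[OF assms]
  have ts: "topspace (subtopology L I) = I" using c(4) by auto
  have "continuous_map (top_of_set (uminus ` J)) (top_of_set J) uminus"
    by (auto intro!: continuous_intros)
  then have "continuous_map (top_of_set (uminus ` J)) L (\<psi> \<circ> uminus)"
    using c(6) continuous_map_compose by blast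
  moreover have "open (uminus ` J)" using c(2) by (simp add: open_negations)
  moreover have "connected (uminus ` J)"
    using c(3) by (auto intro!: connected_continuous_image continuous_intros)
  ultimately show ?thesis
    using c unfolding interval_chart_def homeomorphic_maps_def continuous_map_in_subtopology ts
    by (auto simp: o_def)
qed

lemma interval_chart_shrink:
  assumes "interval_chart L I \<phi> \<psi> J" "open U" "connected U" "U \<subseteq> J"
  shows "interval_chart L {z \<in> I. \<phi> z \<in> U} \<phi> \<psi> U"
proof -
  note c = interval_chartD[OF assms(1)]
  let ?K = "{z \<in> I. \<phi> z \<in> U}"
  have ts: "topspace (subtopology L ?K) = ?K" using c(4) by auto
  have "continuous_map (subtopology L ?K) euclideanreal \<phi>"
    using continuous_map_from_subtopology_mono[OF c(5)] by auto
  moreover have "continuous_map (top_of_set U) L \<psi>"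
    using continuous_map_from_subtopology_mono[OF c(6)] assms(4) by auto
  ultimately show ?thesis
    using c assms(2,3,4) interval_chart_vimage_open[OF assms(1,2)]
    unfolding interval_chart_def homeomorphic_maps_def continuous_map_in_subtopology ts
    by (auto simp: subset_iff)
qed

lemma interval_chart_within:
  assumes "interval_chart L I \<phi> \<psi> J" "q \<in> I" "openin L W" "q \<in> W"
  obtains e where "e > 0" "ball (\<phi> q) e \<subseteq> J" "\<psi> ` ball (\<phi> q) e \<subseteq> W"
    "interval_chart L {z \<in> I. \<phi> z \<in> ball (\<phi> q) e} \<phi> \<psi> (ball (\<phi> q) e)"
proof -
  note c = interval_chartD[OF assms(1)]
  have "openin (top_of_set J) {s \<in> topspace (top_of_set J). \<psi> s \<in> W}"
    by (rule openin_continuous_map_preimage[OF c(6) assms(3)])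
  then have "open {s \<in> J. \<psi> s \<in> W}" using c(2) by (simp add: openin_open_eq)
  moreover have "\<phi> q \<in> {s \<in> J. \<psi> s \<in> W}" using c assms by auto
  ultimately obtain e where e: "e > 0" "ball (\<phi> q) e \<subseteq> {s \<in> J. \<psi> s \<in> W}"
    using open_contains_ball by blast
  then have "ball (\<phi> q) e \<subseteq> J" "\<psi> ` ball (\<phi> q) e \<subseteq> W" by blast+
  then show ?thesis
    using that[OF e(1)] interval_chart_shrink[OF assms(1) open_ball connected_ball] by metis
qed

section \<open>Rays, maximal extension, and closedness of maximal rays\<close>

text \<open>Domains are initial segments of the closed long ray without a last point, so that short
  rays \<open>{..<b}\<close> and the long ray \<open>UNIV\<close> are treated by one extension
  argument.\<close>

definition is_ray :: "'b topology \<Rightarrow> closed_long_ray set \<Rightarrow> (closed_long_ray \<Rightarrow> 'b) \<Rightarrow> bool"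
  where "is_ray L D F \<longleftrightarrow> open D \<and> bot \<in> D \<and> (\<forall>x\<in>D. \<forall>y\<le>x. y \<in> D) \<and>
    continuous_map (top_of_set D) L F \<and> inj_on F D"

lemma is_ray_domain:
  assumes "is_ray L D F"
  shows "D = UNIV \<or> (\<exists>b. D = {..<b})"
proof (cases "D = UNIV")
  case False
  have D: "open D" "bot \<in> D" "\<And>x y. x \<in> D \<Longrightarrow> y \<le> x \<Longrightarrow> y \<in> D" using assms by (auto simp: is_ray_def)
  obtain z where z: "z \<notin> D" using False by auto
  have lt: "\<forall>a\<in>D. a < z" using D(3) z by (meson not_le_imp_less)
  then have bdd: "bdd_above D" by (auto intro!: bdd_aboveI[of _ z] less_imp_le)
  have nin: "Sup D \<notin> D" by (rule Sup_notin_open[OF D(1) lt])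
  have "D = {..<Sup D}"
  proof (intro equalityI subsetI)
    fix x assume "x \<in> D"
    then have "x \<le> Sup D" by (rule cSup_upper[OF _ bdd])
    then show "x \<in> {..<Sup D}" using nin \<open>x \<in> D\<close> by (auto simp: le_less)
  next
    fix x assume "x \<in> {..<Sup D}"
    then obtain y where "y \<in> D" "x < y" using less_cSupE[of x D] D(2) by auto
    then show "x \<in> D" using D(3)[of y x] by auto
  qed
  then show ?thesis by blast
qed simp

lemma is_ray_vimage_open:
  assumes "is_ray L D F" "openin L W"
  shows "open {t \<in> D. F t \<in> W}"
proof -
  have "openin (top_of_set D) {t \<in> topspace (top_of_set D). F t \<in> W}"
    by (rule openin_continuous_map_preimage[OF _ assms(2)]) (use assms(1) in \<open>simp add: is_ray_def\<close>)
  then show ?thesis using assms(1) by (simp add: is_ray_def openin_open_eq)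
qed

lemma is_ray_chart_continuous:
  assumes "is_ray L D F" "interval_chart L I \<phi> \<psi> J" "T \<subseteq> D" "F ` T \<subseteq> I"
  shows "continuous_on T (\<phi> \<circ> F)"
proof -
  have "continuous_map (top_of_set T) L F"
    using assms(1,3) continuous_map_from_subtopology_mono unfolding is_ray_def by blast
  then have "continuous_map (top_of_set T) (subtopology L I) F"
    using assms(4) by (auto simp: continuous_map_in_subtopology)
  then have "continuous_map (top_of_set T) euclideanreal (\<phi> \<circ> F)"
    using interval_chartD(5)[OF assms(2)] continuous_map_compose by blast
  then show ?thesis by simp
qed

lemma is_ray_chart_inj:
  assumes "is_ray L D F" "interval_chart L I \<phi> \<psi> J" "T \<subseteq> D" "F ` T \<subseteq> I"
  shows "inj_on (\<phi> \<circ> F) T"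
proof -
  have "inj_on \<phi> I" using interval_chartD(9)[OF assms(2)] by (metis inj_onI)
  then show ?thesis
    using assms by (meson comp_inj_on inj_on_subset is_ray_def)
qed

text \<open>Zorn's lemma for inclusion of graphs. Graphs are used because functions are total and
  their values outside \<open>D\<close> must not count. The domains in a chain are open, which gives
  continuity of the union by pasting; any two points lie in one domain of the chain, which gives
  injectivity.\<close>

lemma maximal_ray_ex:
  assumes "is_ray L D0 F0"
  obtains D F where "is_ray L D F" "D0 \<subseteq> D" "\<And>t. t \<in> D0 \<Longrightarrow> F t = F0 t"
    "\<And>D' F'. is_ray L D' F' \<Longrightarrow> D \<subseteq> D' \<Longrightarrow> (\<And>t. t \<in> D \<Longrightarrow> F' t = F t) \<Longrightarrow> D' = D"
proof -
  define gr :: "closed_long_ray set \<Rightarrow> (closed_long_ray \<Rightarrow> 'a) \<Rightarrow> (closed_long_ray \<times> 'a) set"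
    where "gr D F = (\<lambda>t. (t, F t)) ` D" for D F
  have gr_sub: "gr D F \<subseteq> gr D' F' \<longleftrightarrow> D \<subseteq> D' \<and> (\<forall>t\<in>D. F' t = F t)" for D F D' F'
    by (auto simp: gr_def image_iff subset_iff)
  define A where "A = {gr D F | D F. is_ray L D F \<and> gr D0 F0 \<subseteq> gr D F}"
  have "\<exists>M\<in>A. \<forall>X\<in>A. M \<subseteq> X \<longrightarrow> X = M"
  proof (rule subset_Zorn_nonempty)
    show "A \<noteq> {}" using assms by (auto simp: A_def)
    fix C assume C: "C \<noteq> {}" "subset.chain A C"
    then have CA: "C \<subseteq> A" and tot: "\<And>X Y. X \<in> C \<Longrightarrow> Y \<in> C \<Longrightarrow> X \<subseteq> Y \<or> Y \<subseteq> X"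
      by (auto simp: subset_chain_def)
    have "\<exists>D F. X = gr D F \<and> is_ray L D F \<and> gr D0 F0 \<subseteq> X" if "X \<in> C" for X
      using subsetD[OF CA that] unfolding A_def by blast
    then obtain d f where df: "\<And>X. X \<in> C \<Longrightarrow> X = gr (d X) (f X) \<and> is_ray L (d X) (f X) \<and> gr D0 F0 \<subseteq> X"
      by metis
    have dray: "is_ray L (d X) (f X)" if "X \<in> C" for X using df[OF that] by blast
    have agree: "f X t = f Y t" if "X \<in> C" "Y \<in> C" "t \<in> d X" "t \<in> d Y" for X Y t
      using tot[OF that(1,2)] df[OF that(1)] df[OF that(2)] that(3,4) gr_sub by metis
    define D where "D = (\<Union>X\<in>C. d X)"
    \<comment> \<open>The choice of \<open>X\<close> is immaterial, since members of the chain agree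
      where both are defined.\<close>
    define F where "F t = f (SOME X. X \<in> C \<and> t \<in> d X) t" for t
    have F: "F t = f X t" if "X \<in> C" "t \<in> d X" for X t
    proof -
      have "(SOME X. X \<in> C \<and> t \<in> d X) \<in> C \<and> t \<in> d (SOME X. X \<in> C \<and> t \<in> d X)"
        by (rule someI[of _ X]) (use that in simp)
      then show ?thesis unfolding F_def using agree that by blast
    qed
    have un: "\<Union>C = gr D F"
    proof -
      have "X = gr (d X) F" if "X \<in> C" for X
      proof -
        have "gr (d X) F = gr (d X) (f X)" using F that by (auto simp: gr_def)
        then show ?thesis using df[OF that] by simp
      qed
      then have "\<Union>C = (\<Union>X\<in>C. gr (d X) F)" by auto
      then show ?thesis by (auto simp: gr_def D_def)
    qed
    have "is_ray L D F"
      unfolding is_ray_def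
    proof (intro conjI ballI allI impI)
      show "open D" unfolding D_def using dray by (auto simp: is_ray_def)
      show "bot \<in> D" using C(1) dray by (auto simp: D_def is_ray_def)
      show "y \<in> D" if "x \<in> D" "y \<le> x" for x y
        using that dray unfolding D_def is_ray_def by blast
      show "inj_on F D"
      proof
        fix x y assume xy: "x \<in> D" "y \<in> D" "F x = F y"
        then obtain X Y where X: "X \<in> C" "x \<in> d X" and Y: "Y \<in> C" "y \<in> d Y" by (auto simp: D_def)
        have "\<exists>Z\<in>C. x \<in> d Z \<and> y \<in> d Z"
          using tot[OF X(1) Y(1)] df[OF X(1)] df[OF Y(1)] X Y gr_sub by (metis subsetD)
        then obtain Z where Z: "Z \<in> C" "x \<in> d Z" "y \<in> d Z" by blast
        then have "f Z x = f Z y" using F xy(3) by metis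
        then show "x = y" using dray[OF Z(1)] Z by (auto simp: is_ray_def dest: inj_onD)
      qed
      show "continuous_map (top_of_set D) L F"
      proof (rule pasting_lemma[where I=C and T=d and f=f])
        fix X assume X: "X \<in> C"
        have sub: "d X \<subseteq> D" using X by (auto simp: D_def)
        show "openin (top_of_set D) (d X)"
          using dray[OF X] sub by (auto simp: is_ray_def intro: open_subset)
        show "continuous_map (subtopology (top_of_set D) (d X)) L (f X)"
          using dray[OF X] sub by (simp add: is_ray_def subtopology_subtopology Int_absorb1)
      next
        fix X Y t assume "X \<in> C" "Y \<in> C" "t \<in> topspace (top_of_set D) \<inter> d X \<inter> d Y"
        then show "f X t = f Y t" using agree by blast
      next
        fix t assume "t \<in> topspace (top_of_set D)"
        then obtain X where "X \<in> C" "t \<in> d X" by (auto simp: D_def)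
        then show "\<exists>X. X \<in> C \<and> t \<in> d X \<and> F t = f X t" using F by blast
      qed
    qed
    moreover have "gr D0 F0 \<subseteq> \<Union>C" using C(1) df by blast
    ultimately show "\<Union>C \<in> A" using un by (auto simp: A_def)
  qed
  then obtain D F where DF: "is_ray L D F" "gr D0 F0 \<subseteq> gr D F"
    and max: "\<forall>X\<in>A. gr D F \<subseteq> X \<longrightarrow> X = gr D F"
    by (auto simp: A_def)
  show ?thesis
  proof (rule that[OF DF(1)])
    show "D0 \<subseteq> D" "\<And>t. t \<in> D0 \<Longrightarrow> F t = F0 t" using DF(2) gr_sub by auto
    fix D' F' assume *: "is_ray L D' F'" "D \<subseteq> D'" "\<And>t. t \<in> D \<Longrightarrow> F' t = F t"
    then have sub: "gr D F \<subseteq> gr D' F'" using gr_sub by auto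
    then have "gr D' F' \<in> A" using *(1) DF(2) by (auto simp: A_def)
    then have "gr D' F' = gr D F" using max sub by auto
    then show "D' = D" using gr_sub by (metis order_refl subset_antisym)
  qed
qed

text \<open>Invariance of domain in dimension one: read in a chart, \<open>F\<close> is continuous
  and injective on an interval around \<open>t\<close>, hence strictly monotone, and its image
  contains an open interval around the value at \<open>t\<close>.\<close>

lemma is_ray_open_image:
  assumes charts: "\<And>q. q \<in> topspace L \<Longrightarrow> \<exists>I \<phi> \<psi> J. interval_chart L I \<phi> \<psi> J \<and> q \<in> I"
    and ray: "is_ray L D F" and U: "open U" "U \<subseteq> D" "bot \<notin> U"
  shows "openin L (F ` U)"
proof (subst openin_subopen, intro ballI)
  fix q assume "q \<in> F ` U"
  then obtain t where t: "t \<in> U" "q = F t" by auto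
  have "q \<in> topspace L"
    using ray t U(2) by (auto simp: is_ray_def continuous_map_def)
  then obtain I \<phi> \<psi> J where c: "interval_chart L I \<phi> \<psi> J" "q \<in> I" using charts by blast
  let ?V = "U \<inter> {t \<in> D. F t \<in> I}"
  have "open ?V" using is_ray_vimage_open[OF ray interval_chartD(1)[OF c(1)]] U(1) by auto
  moreover have "t \<in> ?V" using t c U by auto
  \<comment> \<open>A point to the left of \<open>t\<close> is required. At \<open>bot\<close> the
    image would only be a half-open arc, which is why \<open>U\<close> omits
    \<open>bot\<close>.\<close>
  moreover have "bot < t" using t U(3) by (metis bot.not_eq_extremum)
  moreover obtain t' where "t < t'" using gt_ex by blast
  ultimately obtain a0 b0 where ab0: "a0 < t" "{a0<..t} \<subseteq> ?V" "t < b0" "{t..<b0} \<subseteq> ?V"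
    using open_left[of ?V t bot] open_right[of ?V t t'] by blast
  obtain a b where ab: "a0 < a" "a < t" "t < b" "b < b0" using dense ab0 by metis
  have sub: "{a..b} \<subseteq> ?V"
  proof
    fix x assume "x \<in> {a..b}"
    then have "x \<in> {a0<..t} \<or> x \<in> {t..<b0}" using ab by auto
    then show "x \<in> ?V" using ab0 by blast
  qed
  let ?h = "\<phi> \<circ> F"
  have sub2: "{a..b} \<subseteq> D" "F ` {a..b} \<subseteq> I" using sub by auto
  have cont: "continuous_on {a..b} ?h" and inj: "inj_on ?h {a..b}"
    using is_ray_chart_continuous[OF ray c(1) sub2] is_ray_chart_inj[OF ray c(1) sub2] by auto
  have conn: "connected (?h ` {a..b})" by (intro connected_continuous_image cont) simp
  define l u where "l = min (?h a) (?h b)" and "u = max (?h a) (?h b)"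
  have mid: "l < ?h t" "?h t < u"
    using continuous_inj_imp_mono[OF ab(2,3) cont inj] by (auto simp: l_def u_def)
  have "l \<in> ?h ` {a..b}" "u \<in> ?h ` {a..b}" using ab by (auto simp: l_def u_def min_def max_def)
  then have lu: "{l<..<u} \<subseteq> ?h ` {a..b}" using connected_contains_Ioo[OF conn] by blast
  have "{z \<in> I. \<phi> z \<in> {l<..<u}} \<subseteq> F ` U"
  proof
    fix z assume z: "z \<in> {z \<in> I. \<phi> z \<in> {l<..<u}}"
    then obtain x where x: "x \<in> {a..b}" "\<phi> z = \<phi> (F x)" using lu by auto
    then have "F x \<in> I" "x \<in> U" using sub by auto
    then show "z \<in> F ` U" using interval_chartD(9)[OF c(1)] x z by (metis (lifting) imageI mem_Collect_eq)
  qed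
  moreover have "q \<in> {z \<in> I. \<phi> z \<in> {l<..<u}}" using mid c(2) t by auto
  ultimately show "\<exists>T. openin L T \<and> q \<in> T \<and> T \<subseteq> F ` U"
    using interval_chart_vimage_open[OF c(1), of "{l<..<u}"] by auto
qed

text \<open>Otherwise \<open>F\<close> leaves \<open>I\<close> on both sides of \<open>t\<close>, and the image of the excursion between
  the two exits is clopen in \<open>I\<close>, hence contains \<open>q\<close>.\<close>

lemma is_ray_stays_in_chart:
  assumes haus: "Hausdorff_space L"
    and charts: "\<And>q. q \<in> topspace L \<Longrightarrow> \<exists>I \<phi> \<psi> J. interval_chart L I \<phi> \<psi> J \<and> q \<in> I"
    and ray: "is_ray L D F" and c: "interval_chart L I \<phi> \<psi> J"
    and q: "q \<in> I" "q \<notin> F ` D" and p: "F bot \<notin> I"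
    and t: "t \<in> D" "F t \<in> I" and t': "t' \<in> D" "t \<le> t'"
  shows "F t' \<in> I"
proof (rule ccontr)
  assume out: "F t' \<notin> I"
  have D: "open D" "\<And>x y. x \<in> D \<Longrightarrow> y \<le> x \<Longrightarrow> y \<in> D" "continuous_map (top_of_set D) L F"
    using ray by (auto simp: is_ray_def)
  let ?E = "{t \<in> D. F t \<in> I}"
  have opE: "open ?E" by (rule is_ray_vimage_open[OF ray interval_chartD(1)[OF c]])
  \<comment> \<open>The maximum \<open>s\<close> of \<open>A\<close> is the last time before
    \<open>t\<close> outside \<open>I\<close>, the minimum \<open>s'\<close> of \<open>B\<close> the
    first such time after \<open>t\<close>; both are attained by compactness.\<close>
  define A where "A = {bot..t} \<inter> - ?E"
  define B where "B = {t..t'} \<inter> - ?E"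
  have "compact A" "compact B"
    unfolding A_def B_def using opE
    by (auto intro!: compact_Int_closed compact_Icc_linear_continuum)
  moreover have "bot \<in> A" "t' \<in> B" using p out t' by (auto simp: A_def B_def)
  ultimately obtain s s' where sA: "s \<in> A" "\<And>u. u \<in> A \<Longrightarrow> u \<le> s" and sB: "s' \<in> B" "\<And>u. u \<in> B \<Longrightarrow> s' \<le> u"
    using compact_attains_sup[of A] compact_attains_inf[of B] by blast
  have s't: "s' \<le> t'" using sB(1) by (simp add: B_def)
  have tE: "t \<in> ?E" using t by simp
  have st: "s < t" "t < s'" using sA(1) sB(1) tE by (auto simp: A_def B_def le_less)
  have D1: "x \<in> D" if "x \<le> s'" for x using D(2)[OF t'(1)] that s't by auto
  have mid: "x \<in> ?E" if "s < x" "x < s'" for x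
  proof (rule ccontr)
    assume "x \<notin> ?E"
    then have "x \<in> A \<or> x \<in> B" using that(2) s't by (auto simp: A_def B_def)
    then show False using sA(2) sB(2) that by fastforce
  qed
  have "s \<in> D" "s' \<in> D" using D1 less_trans[OF st] less_imp_le by auto
  then have ends: "F s \<notin> I" "F s' \<notin> I" using sA(1) sB(1) by (auto simp: A_def B_def)
  let ?G = "F ` {s<..<s'}"
  have sub: "?G \<subseteq> I" using mid by auto
  have "openin L ?G"
    by (rule is_ray_open_image[OF charts ray]) (use D1 in auto)
  then have op: "openin (subtopology L I) ?G"
    using sub interval_chartD(1)[OF c] by (simp add: openin_open_subtopology)
  \<comment> \<open>Closedness of the excursion in \<open>I\<close>: the image of the closed
    interval is compact, hence closed in \<open>L\<close>, and intersecting with \<open>I\<close>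
    removes precisely its two end points.\<close>
  have "compactin (top_of_set D) {s..s'}"
    using compact_Icc_linear_continuum[of s s'] D1 by (auto simp: compactin_subtopology)
  then have "compactin L (F ` {s..s'})" using D(3) image_compactin by blast
  then have "closedin L (F ` {s..s'})" using haus compactin_imp_closedin by blast
  moreover have "F ` {s..s'} \<inter> I = ?G"
  proof -
    have "{s..s'} = insert s (insert s' {s<..<s'})" using st by auto
    then show ?thesis using ends sub by auto
  qed
  ultimately have cl: "closedin (subtopology L I) ?G"
    by (metis closedin_subtopology)
  have "connected_space (subtopology L I)"
  proof -
    have "homeomorphic_maps (subtopology L I) (top_of_set J) \<phi> \<psi>"
      using c by (auto simp: interval_chart_def)
    then have "subtopology L I homeomorphic_space top_of_set J"
      by (auto simp: homeomorphic_space_def)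
    then show ?thesis
      using interval_chartD(3)[OF c]
      by (metis connected_space_subtopology connectedin_iff_connected homeomorphic_connected_space)
  qed
  moreover have "?G \<noteq> {}" using st by auto
  ultimately have "?G = topspace (subtopology L I)"
    using op cl by (auto simp: connected_space_clopen_in)
  then have "q \<in> ?G" using q(1) interval_chartD(4)[OF c] by auto
  then show False using q(2) D1 by auto
qed

text \<open>By the previous lemma the ray finally stays in every small chart around \<open>q\<close>, so it
  converges to \<open>q\<close> from one side, and the other side of the chart is free to continue it.\<close>

lemma is_ray_extend_through_limit:
  assumes haus: "Hausdorff_space L"
    and charts: "\<And>q. q \<in> topspace L \<Longrightarrow> \<exists>I \<phi> \<psi> J. interval_chart L I \<phi> \<psi> J \<and> q \<in> I"
    and ray: "is_ray L {..<b} F" and c: "interval_chart L I \<phi> \<psi> J"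
    and q: "q \<in> I" "q \<notin> F ` {..<b}" "q \<in> L closure_of (F ` {..<b})" and p: "F bot \<notin> I"
    and t: "t < b" "F t \<in> I" "\<phi> (F t) < \<phi> q"
  shows "\<exists>D' F'. is_ray L D' F' \<and> {..<b} \<subset> D' \<and> (\<forall>t<b. F' t = F t)"
proof -
  define s where "s = \<phi> q"
  have sJ: "s \<in> J" using interval_chartD(7)[OF c q(1)] by (simp add: s_def)
  have stays: "F u \<in> I" if "t' < b" "F t' \<in> I" "t' \<le> u" "u < b" for t' u
  proof -
    have "t' \<in> {..<b}" "u \<in> {..<b}" using that by auto
    then show ?thesis using is_ray_stays_in_chart[OF haus charts ray c q(1,2) p _ that(2) _ that(3)] by blast
  qed
  \<comment> \<open>From the earlier of \<open>u\<close> and \<open>t\<close> on, the ray stays in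
    \<open>I\<close> and avoids \<open>q\<close>, so its coordinate cannot cross \<open>s\<close>.
    Times before \<open>t\<close> are included because injectivity of the extension compares all old
    points with the new ones, whose coordinates are at least \<open>s\<close>.\<close>
  have below: "\<phi> (F u) < s" if "u < b" "F u \<in> I" for u
  proof -
    have conn: "connected {min u t..<b}" by simp
    have in_I: "F ` {min u t..<b} \<subseteq> I"
      using stays[OF t(1,2)] stays[OF that] by (auto simp: min_def)
    have "continuous_on {min u t..<b} (\<phi> \<circ> F)"
      by (rule is_ray_chart_continuous[OF ray c _ in_I]) auto
    then have conn: "connected ((\<phi> \<circ> F) ` {min u t..<b})" by (rule connected_continuous_image) simp
    have "s \<notin> (\<phi> \<circ> F) ` {min u t..<b}"
    proof
      assume "s \<in> (\<phi> \<circ> F) ` {min u t..<b}"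
      then obtain x where x: "x \<in> {min u t..<b}" "\<phi> (F x) = \<phi> q" by (auto simp: s_def)
      then have "x < b" "F x \<in> I" using in_I by auto

      then have "F x = q" using interval_chartD(9)[OF c] q(1) x(2) by metis
      then show False using \<open>x < b\<close> q(2) by auto
    qed
    moreover have "\<phi> (F t) \<in> (\<phi> \<circ> F) ` {min u t..<b}" "\<phi> (F u) \<in> (\<phi> \<circ> F) ` {min u t..<b}"
      using t(1) that by auto
    moreover have "\<phi> (F t) < s" using t(3) by (simp add: s_def)
    ultimately show ?thesis
      using connected_contains_Icc[OF conn, of "\<phi> (F t)" "\<phi> (F u)"]
      by (meson atLeastAtMost_iff less_imp_le linorder_not_le subsetD)
  qed
  \<comment> \<open>The part of the chart above level \<open>l\<close> is again a chart around
    \<open>q\<close>. The ray enters it because \<open>q\<close> is a limit point, and then never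
    leaves it.\<close>
  have limit: "\<exists>u0<b. t < u0 \<and> (\<forall>u. u0 \<le> u \<and> u < b \<longrightarrow> l < \<phi> (F u))" if "l < s" for l
  proof -
    let ?I = "{z \<in> I. \<phi> z \<in> {l<..} \<inter> J}"
    have "connected ({l<..} \<inter> J)"
      using interval_chartD(3)[OF c] by (auto simp: connected_iff_interval)
    then have c': "interval_chart L ?I \<phi> \<psi> ({l<..} \<inter> J)"
      using interval_chartD(2)[OF c] by (intro interval_chart_shrink[OF c]) auto
    have qI: "q \<in> ?I" using q(1) that interval_chartD(7)[OF c] by (auto simp: s_def)
    have "\<exists>y\<in>F ` {..<b}. y \<in> ?I"
      using q(3) qI interval_chartD(1)[OF c'] unfolding in_closure_of by meson
    then obtain v where v: "v < b" "F v \<in> ?I" by blast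
    obtain u0 where u0: "max t v < u0" "u0 < b" using dense[of "max t v" b] t(1) v(1) by auto
    have "l < \<phi> (F u)" if "u0 \<le> u" "u < b" for u
    proof -
      have "F u \<in> ?I"
        by (rule is_ray_stays_in_chart[OF haus charts ray c' qI q(2) _ _ v(2)]) (use p v that u0 in auto)
      then show ?thesis by auto
    qed
    then show ?thesis using u0 by auto
  qed
  obtain e where e: "e > 0" "ball s e \<subseteq> J"
    using sJ interval_chartD(2)[OF c] open_contains_ball by blast
  \<comment> \<open>The continuation uses the rest of the block of \<open>b\<close>:
    \<open>g\<close> starts with value \<open>s\<close> at \<open>b\<close> and grows by less than
    \<open>e\<close>, since \<open>ray_clamp\<close> varies by less than 1 there. Its values
    therefore stay in \<open>ball s e\<close>, inside \<open>J\<close>.\<close>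
  define b' where "b' = ray_block_end b"
  define g where "g u = s + e * (ray_clamp (ray_block b) u - ray_clamp (ray_block b) b)" for u
  have bb': "b < b'" by (simp add: b'_def less_ray_block_end)
  have g_ge: "s \<le> g u" if "b \<le> u" for u
    using ray_clamp_mono[OF that] e by (simp add: g_def)
  have g_le: "g u \<le> s" if "u \<le> b" for u
    using ray_clamp_mono[OF that] e by (simp add: g_def mult_nonneg_nonpos)
  have g_lt: "g u < s + e" if "u < b'" for u
  proof -
    have "ray_clamp (ray_block b) u - ray_clamp (ray_block b) b < 1"
      using ray_clamp_less_one[OF that[unfolded b'_def]] ray_clamp_bounds(1)[of "ray_block b" b] by linarith
    then show ?thesis using e by (simp add: g_def)
  qed
  have g_inj: "u = v" if "b \<le> u" "u < b'" "b \<le> v" "v < b'" "g u = g v" for u v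
    using ray_clamp_inj[of b u v] that e by (auto simp: g_def b'_def)
  have g_cont: "continuous_on S g" for S
    unfolding g_def by (intro continuous_intros continuous_on_ray_clamp)
  define k where "k u = (if u < b then \<phi> (F u) else g u)" for u
  have kJ: "k u \<in> J" if "t < u" "u < b'" for u
  proof (cases "u < b")
    case True
    then show ?thesis using stays[OF t(1,2), of u] that interval_chartD(7)[OF c] by (simp add: k_def)
  next
    case False
    then have "g u \<in> ball s e" using g_ge[of u] g_lt[OF that(2)] by (simp add: dist_real_def)
    then show ?thesis using False e by (auto simp: k_def)
  qed
  have hcont: "continuous_on {t<..<b} (\<phi> \<circ> F)"
    by (rule is_ray_chart_continuous[OF ray c]) (use stays[OF t(1,2)] in auto)
  have hop: "open {u \<in> {t<..<b}. \<phi> (F u) \<in> U}" if "open U" for U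
    using continuous_open_preimage[OF hcont open_greaterThanLessThan that]
    by (simp add: vimage_def Int_def)
  have gop: "open {u. g u \<in> U}" if "open U" for U
    using open_vimage[OF that g_cont] by (simp add: vimage_def)
  \<comment> \<open>Continuity is tested on half-lines. The limit statement enters for lower bounds
    \<open>l < s\<close>; for \<open>l \<ge> s\<close>, and for upper bounds above \<open>s\<close>,
    the two functions \<open>k\<close> and \<open>g\<close> satisfy the same condition below
    \<open>b\<close>, so \<open>k\<close> may be replaced by \<open>g\<close>.\<close>
  have kcont: "continuous_on {t<..<b'} k"
  proof -
    have gt: "open {u \<in> {t<..<b'}. k u \<in> {l<..}}" for l
    proof (cases "l < s")
      case True
      obtain u0 where u0: "u0 < b" "t < u0" "\<And>u. u0 \<le> u \<Longrightarrow> u < b \<Longrightarrow> l < \<phi> (F u)"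
        using limit[OF True] by blast
      have "{u \<in> {t<..<b'}. k u \<in> {l<..}} = {u \<in> {t<..<b}. \<phi> (F u) \<in> {l<..}} \<union> {u0<..<b'}"
      proof (intro equalityI subsetI)
        fix u assume "u \<in> {u \<in> {t<..<b'}. k u \<in> {l<..}}"
        then show "u \<in> {u \<in> {t<..<b}. \<phi> (F u) \<in> {l<..}} \<union> {u0<..<b'}"
          using u0(1) by (cases "u < b") (auto simp: k_def)
      next
        fix u assume "u \<in> {u \<in> {t<..<b}. \<phi> (F u) \<in> {l<..}} \<union> {u0<..<b'}"
        then show "u \<in> {u \<in> {t<..<b'}. k u \<in> {l<..}}"
          using u0 g_ge[of u] True bb' by (cases "u < b") (auto simp: k_def not_less)
      qed
      then show ?thesis using open_Un[OF hop[of "{l<..}"] open_greaterThanLessThan] by simp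
    next
      case False
      have "u \<in> {u \<in> {t<..<b'}. k u \<in> {l<..}} \<longleftrightarrow> u \<in> {t<..<b'} \<inter> {u. g u \<in> {l<..}}" for u
        using below[of u] stays[OF t(1,2), of u] g_le[OF less_imp_le, of u] False
        by (cases "u < b") (auto simp: k_def not_less)
      then have "{u \<in> {t<..<b'}. k u \<in> {l<..}} = {t<..<b'} \<inter> {u. g u \<in> {l<..}}" by blast
      then show ?thesis using open_Int[OF open_greaterThanLessThan gop[of "{l<..}"]] by simp
    qed
    have lt: "open {u \<in> {t<..<b'}. k u \<in> {..<l}}" for l
    proof (cases "s < l")
      case True
      have "{u \<in> {t<..<b'}. k u \<in> {..<l}} = {t<..<b'} \<inter> {u. g u \<in> {..<l}}"
      proof (intro equalityI subsetI)
        fix u assume "u \<in> {u \<in> {t<..<b'}. k u \<in> {..<l}}"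
        then show "u \<in> {t<..<b'} \<inter> {u. g u \<in> {..<l}}"
          using True le_less_trans[OF g_le[of u] True] by (cases "u < b") (auto simp: k_def)
      next
        fix u assume "u \<in> {t<..<b'} \<inter> {u. g u \<in> {..<l}}"
        then show "u \<in> {u \<in> {t<..<b'}. k u \<in> {..<l}}"
          using True below[of u] stays[OF t(1,2), of u] by (cases "u < b") (auto simp: k_def)
      qed
      then show ?thesis using open_Int[OF open_greaterThanLessThan gop[of "{..<l}"]] by simp
    next
      case False
      have "{u \<in> {t<..<b'}. k u \<in> {..<l}} = {u \<in> {t<..<b}. \<phi> (F u) \<in> {..<l}}"
      proof (intro equalityI subsetI)
        fix u assume "u \<in> {u \<in> {t<..<b'}. k u \<in> {..<l}}"
        then show "u \<in> {u \<in> {t<..<b}. \<phi> (F u) \<in> {..<l}}"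
          using False g_ge[of u] by (cases "u < b") (auto simp: k_def not_less)
      next
        fix u assume "u \<in> {u \<in> {t<..<b}. \<phi> (F u) \<in> {..<l}}"
        then show "u \<in> {u \<in> {t<..<b'}. k u \<in> {..<l}}" using bb' by (auto simp: k_def)
      qed
      then show ?thesis using hop[of "{..<l}"] by auto
    qed
    have "continuous_map (top_of_set {t<..<b'}) euclideanreal k"
      unfolding continuous_map_upper_lower_semicontinuous_lt
      using gt lt by (auto simp: openin_open_eq)
    then show ?thesis by simp
  qed
  define F' where "F' u = (if u < b then F u else \<psi> (g u))" for u
  have gJ: "g u \<in> J" if "b \<le> u" "u < b'" for u
    using kJ[of u] that less_le_trans[OF t(1)] by (simp add: k_def leD)
  have "is_ray L {..<b'} F'"
    unfolding is_ray_def
  proof (intro conjI ballI allI impI)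
    show "bot \<in> {..<b'}" using bb' by (auto intro: le_less_trans[OF bot_least])
    show "inj_on F' {..<b'}"
    proof -
      have inj: "inj_on F {..<b}" using ray by (simp add: is_ray_def)
      have mixed: "F u \<noteq> \<psi> (g v)" if "u < b" "b \<le> v" "v < b'" for u v
      proof
        assume eq: "F u = \<psi> (g v)"
        then have "F u \<in> I" using interval_chartD(8)[OF c gJ[OF that(2,3)]] by simp
        moreover have "\<phi> (F u) = g v" using eq interval_chartD(10)[OF c gJ[OF that(2,3)]] by simp
        ultimately show False using below[OF that(1)] g_ge[OF that(2)] by simp
      qed
      have upper: "u = v" if "b \<le> u" "u < b'" "b \<le> v" "v < b'" "\<psi> (g u) = \<psi> (g v)" for u v
        using g_inj[OF that(1-4)] interval_chartD(10)[OF c gJ] that by metis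
      show ?thesis
      proof (rule inj_onI)
        fix u v assume uv: "u \<in> {..<b'}" "v \<in> {..<b'}" "F' u = F' v"
        consider "u < b" "v < b" | "u < b" "b \<le> v" | "b \<le> u" "v < b" | "b \<le> u" "b \<le> v"
          by (meson not_le_imp_less)
        then show "u = v"
        proof cases
          case 1 then show ?thesis using uv inj by (auto simp: F'_def dest: inj_onD)
        next
          case 2 then show ?thesis using uv mixed[of u v] by (auto simp: F'_def leD)
        next
          case 3 then show ?thesis using uv mixed[of v u] by (auto simp: F'_def leD)
        next
          case 4 then show ?thesis using uv upper[of u v] by (auto simp: F'_def leD)
        qed
      qed
    qed
    show "continuous_map (top_of_set {..<b'}) L F'"
    proof (rule pasting_lemma[where I="UNIV :: bool set" and T="\<lambda>i. if i then {..<b} else {t<..<b'}"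
            and f="\<lambda>i. if i then F else \<psi> \<circ> k"])
      have 1: "continuous_map (top_of_set {..<b}) L F" using ray by (simp add: is_ray_def)
      have "continuous_map (top_of_set {t<..<b'}) (top_of_set J) k"
        using kcont kJ by auto
      then have 2: "continuous_map (top_of_set {t<..<b'}) L (\<psi> \<circ> k)"
        using interval_chartD(6)[OF c] continuous_map_compose by blast
      fix i :: bool
      have sub: "{..<b} \<subseteq> {..<b'}" "{t<..<b'} \<subseteq> {..<b'}" using bb' by auto
      show "continuous_map (subtopology (top_of_set {..<b'}) (if i then {..<b} else {t<..<b'})) L
        (if i then F else \<psi> \<circ> k)"
        using 1 2 sub by (simp add: subtopology_subtopology Int_absorb1)
      show "openin (top_of_set {..<b'}) (if i then {..<b} else {t<..<b'})"
        using sub by (simp add: openin_open_eq)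
    next
      have kF: "\<psi> (k x) = F x" if "t < x" "x < b" for x
        using that stays[OF t(1,2), of x] interval_chartD(9)[OF c] by (simp add: k_def)
      fix i j x
      assume "x \<in> topspace (top_of_set {..<b'}) \<inter> (if i then {..<b} else {t<..<b'}) \<inter>
        (if j then {..<b} else {t<..<b'})"
      then show "(if i then F else \<psi> \<circ> k) x = (if j then F else \<psi> \<circ> k) x"
        using kF by (cases i; cases j) auto
    next
      fix x assume x: "x \<in> topspace (top_of_set {..<b'})"
      show "\<exists>j. j \<in> UNIV \<and> x \<in> (if j then {..<b} else {t<..<b'}) \<and>
        F' x = (if j then F else \<psi> \<circ> k) x"
        by (rule exI[of _ "x < b"]) (use x t(1) in \<open>auto simp: F'_def k_def not_less\<close>)
    qed
  qed auto
  moreover have "{..<b} \<subset> {..<b'}" using bb' by auto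
  ultimately show ?thesis by (intro exI[of _ "{..<b'}"] exI[of _ F']) (auto simp: F'_def)
qed

text \<open>Near a limit point \<open>q\<close> off the ray, the ray ends up inside a chart around
  \<open>q\<close>. If its domain is \<open>UNIV\<close>, a tail of the long ray would embed
  continuously and injectively in the reals; if it is \<open>{..<b}\<close>, the ray extends through
  \<open>q\<close>, against maximality.\<close>

lemma maximal_ray_closed:
  assumes haus: "Hausdorff_space L"
    and charts: "\<And>q. q \<in> topspace L \<Longrightarrow> \<exists>I \<phi> \<psi> J. interval_chart L I \<phi> \<psi> J \<and> q \<in> I"
    and ray: "is_ray L D F"
    and max: "\<And>D' F'. is_ray L D' F' \<Longrightarrow> D \<subseteq> D' \<Longrightarrow> (\<And>t. t \<in> D \<Longrightarrow> F' t = F t) \<Longrightarrow> D' = D"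
  shows "closedin L (F ` D)"
proof -
  have D: "bot \<in> D" "continuous_map (top_of_set D) L F"
    using ray by (auto simp: is_ray_def)
  have sub: "F ` D \<subseteq> topspace L" using D(2) by (auto simp: continuous_map_def)
  have "q \<in> F ` D" if q: "q \<in> L closure_of (F ` D)" for q
  proof (rule ccontr)
    assume qn: "q \<notin> F ` D"
    have qL: "q \<in> topspace L" using q by (simp add: in_closure_of)
    then obtain I0 \<phi> \<psi> J0 where c0: "interval_chart L I0 \<phi> \<psi> J0" "q \<in> I0" using charts by blast
    have "F bot \<in> topspace L" "q \<noteq> F bot" using D(1) sub qn by auto
    then have W: "openin L (topspace L - {F bot})" "q \<in> topspace L - {F bot}"
      using haus qL by (auto simp: Hausdorff_imp_t1_space closedin_t1_singleton openin_diff)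
    \<comment> \<open>The chart is shrunk to exclude the starting point \<open>F bot\<close>, so
      that an excursion into it has an earlier time outside.\<close>
    obtain e where e: "e > 0" "ball (\<phi> q) e \<subseteq> J0" "\<psi> ` ball (\<phi> q) e \<subseteq> topspace L - {F bot}"
      and c: "interval_chart L {z \<in> I0. \<phi> z \<in> ball (\<phi> q) e} \<phi> \<psi> (ball (\<phi> q) e)"
      by (rule interval_chart_within[OF c0 W])
    define I where "I = {z \<in> I0. \<phi> z \<in> ball (\<phi> q) e}"
    note c = c[folded I_def]
    have qI: "q \<in> I" using c0(2) e(1) by (simp add: I_def)
    have p: "F bot \<notin> I"
    proof
      assume "F bot \<in> I"
      then have "\<psi> (\<phi> (F bot)) = F bot" "\<phi> (F bot) \<in> ball (\<phi> q) e"
        using interval_chartD(7,9)[OF c] by auto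
      then show False using e(3) by (metis DiffE imageI singletonI subsetD)
    qed
    have "\<exists>y\<in>F ` D. y \<in> I" using q qI interval_chartD(1)[OF c] unfolding in_closure_of by meson
    then obtain t where t: "t \<in> D" "F t \<in> I" by blast
    have stays: "F u \<in> I" if "u \<in> D" "t \<le> u" for u
      by (rule is_ray_stays_in_chart[OF haus charts ray c qI qn p t that])
    consider "D = UNIV" | b where "D = {..<b}" using is_ray_domain[OF ray] by blast
    then show False
    proof cases
      case 1
      have sub: "{t<..} \<subseteq> D" "F ` {t<..} \<subseteq> I" using 1 stays by (auto simp: less_imp_le)
      show False
      proof (rule no_continuous_inj_from_ray[OF is_ray_chart_continuous[OF ray c sub]
            is_ray_chart_inj[OF ray c sub] countable_rat])
        fix x y :: real assume "x < y"
        then show "\<exists>d\<in>\<rat>. x < d \<and> d < y" using Rats_dense_in_real by blast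
      qed
    next
      case (2 b)
      have tb: "t < b" using t(1) 2 by simp
      have "\<phi> (F t) \<noteq> \<phi> q" using t qn interval_chartD(9)[OF c] qI by (metis imageI)
      then have "\<exists>D' F'. is_ray L D' F' \<and> {..<b} \<subset> D' \<and> (\<forall>t<b. F' t = F t)"
      proof (cases "\<phi> (F t) < \<phi> q")
        case True
        show ?thesis
          by (rule is_ray_extend_through_limit[OF haus charts ray[unfolded 2] c qI qn[unfolded 2]
                q[unfolded 2] p tb t(2) True])
      next
        case False
        \<comment> \<open>Approach from the upper side becomes approach from the lower side after
          reflecting the chart.\<close>
        then have "- \<phi> (F t) < - \<phi> q" using \<open>\<phi> (F t) \<noteq> \<phi> q\<close> by simp
        then show ?thesis
          using is_ray_extend_through_limit[OF haus charts ray[unfolded 2] interval_chart_uminus[OF c]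
              qI qn[unfolded 2] q[unfolded 2] p tb t(2)] by simp
      qed
      then obtain D' F' where D': "is_ray L D' F'" "{..<b} \<subset> D'" "\<forall>t<b. F' t = F t" by blast
      then have "D' = D" using max[of D' F'] 2 by auto
      then show False using D' 2 by simp
    qed
  qed
  then have "L closure_of (F ` D) \<subseteq> F ` D" by blast
  then show ?thesis using sub closure_of_subset_eq by blast
qed

section \<open>Covering a connected one-manifold by two maximal rays\<close>

text \<open>One side of a chart at \<open>p\<close>, parametrised by the first block; the sign of
  \<open>e\<close> selects the side. The proof computes with \<open>ray_clamp\<close>, which agrees
  with \<open>ray_coord\<close> on this block and is continuous.\<close>

lemma half_chart_is_ray:
  assumes c: "interval_chart L I \<phi> \<psi> J" and p: "p \<in> I" and e: "ball (\<phi> p) \<bar>e\<bar> \<subseteq> J" "e \<noteq> 0"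
  shows "is_ray L {..<ray_block_end bot} (\<lambda>u. \<psi> (\<phi> p + e * ray_coord u))"
proof -
  let ?b = "ray_block_end bot"
  define g where "g u = \<phi> p + e * ray_clamp (ray_block bot) u" for u
  have coord: "ray_clamp (ray_block bot) u = ray_coord u" if "u < ?b" for u
    using ray_block_eqI[OF bot_least that] by (simp add: ray_clamp_def)
  have gJ: "g u \<in> J" if "u < ?b" for u
  proof -
    have "\<bar>e * ray_coord u\<bar> < \<bar>e\<bar>"
      using e(2) by (simp add: abs_mult)
    then have "g u \<in> ball (\<phi> p) \<bar>e\<bar>" using coord[OF that] by (simp add: g_def dist_real_def)
    then show ?thesis using e by blast
  qed
  have "continuous_on {..<?b} g"
    unfolding g_def by (intro continuous_intros continuous_on_ray_clamp)
  then have "continuous_map (top_of_set {..<?b}) (top_of_set J) g" using gJ by auto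
  then have "continuous_map (top_of_set {..<?b}) L (\<psi> \<circ> g)"
    using interval_chartD(6)[OF c] continuous_map_compose by blast
  moreover have "inj_on (\<psi> \<circ> g) {..<?b}"
  proof
    fix u v assume uv: "u \<in> {..<?b}" "v \<in> {..<?b}" "(\<psi> \<circ> g) u = (\<psi> \<circ> g) v"
    then have "g u = g v" using interval_chartD(10)[OF c gJ] by (metis comp_apply lessThan_iff)
    then have "ray_clamp (ray_block bot) u = ray_clamp (ray_block bot) v" using e by (simp add: g_def)
    then show "u = v" using ray_clamp_inj[of bot u v] uv by simp
  qed
  moreover have "bot < ?b" by (simp add: less_ray_block_end)
  ultimately have "is_ray L {..<?b} (\<psi> \<circ> g)" by (auto simp: is_ray_def)
  moreover have eq: "(\<psi> \<circ> g) u = \<psi> (\<phi> p + e * ray_coord u)" if "u \<in> {..<?b}" for u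
    using coord[of u] that by (simp add: g_def)
  moreover have "inj_on (\<lambda>u. \<psi> (\<phi> p + e * ray_coord u)) {..<?b}"
    using calculation(1) inj_on_cong[OF eq, of "{..<?b}" "\<lambda>u. u"] by (simp add: is_ray_def o_def)
  moreover have "continuous_map (top_of_set {..<?b}) L (\<lambda>u. \<psi> (\<phi> p + e * ray_coord u))"
    by (rule continuous_map_eq[of _ _ "\<psi> \<circ> g"]) (use calculation(1) eq in \<open>auto simp: is_ray_def\<close>)
  ultimately show ?thesis
    unfolding is_ray_def by blast
qed

text \<open>The two sides of a chart at \<open>p\<close> extend to maximal rays. Their union is
  closed because maximal rays are, and open because each ray is open away from its start and a
  neighbourhood of \<open>p\<close> is covered; connectedness does the rest. The rays may overlap,
  as on a circle.\<close>

proposition one_manifold_two_rays: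
  assumes haus: "Hausdorff_space L" and conn: "connected_space L" and ne: "topspace L \<noteq> {}"
    and charts: "\<And>q. q \<in> topspace L \<Longrightarrow> \<exists>I \<phi> \<psi> J. interval_chart L I \<phi> \<psi> J \<and> q \<in> I"
  obtains D1 F1 D2 F2 where "is_ray L D1 F1" "is_ray L D2 F2" "topspace L = F1 ` D1 \<union> F2 ` D2"
proof -
  obtain p where "p \<in> topspace L" using ne by blast
  then obtain I \<phi> \<psi> J where c: "interval_chart L I \<phi> \<psi> J" "p \<in> I" using charts by blast
  obtain e where e: "e > 0" "ball (\<phi> p) e \<subseteq> J"
    using interval_chartD(2,7)[OF c(1)] c(2) open_contains_ball by blast
  let ?D = "{..<ray_block_end bot}"
  have r: "is_ray L ?D (\<lambda>u. \<psi> (\<phi> p + d * ray_coord u))" if "d = e \<or> d = - e" for d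
    by (rule half_chart_is_ray[OF c]) (use that e in auto)
  have "\<exists>D F. is_ray L D F \<and> closedin L (F ` D) \<and> F bot = p \<and>
      (\<forall>u<ray_block_end bot. \<psi> (\<phi> p + d * ray_coord u) \<in> F ` D)"
    if d: "d = e \<or> d = - e" for d
  proof -
    obtain D F where DF: "is_ray L D F" "?D \<subseteq> D" "\<And>t. t \<in> ?D \<Longrightarrow> F t = \<psi> (\<phi> p + d * ray_coord t)"
      and max: "\<And>D' F'. is_ray L D' F' \<Longrightarrow> D \<subseteq> D' \<Longrightarrow> (\<And>t. t \<in> D \<Longrightarrow> F' t = F t) \<Longrightarrow> D' = D"
      using maximal_ray_ex[OF r[OF d]] by metis
    have "closedin L (F ` D)"
    proof (rule maximal_ray_closed[OF haus _ DF(1)])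
      show "D' = D" if "is_ray L D' F'" "D \<subseteq> D'" "\<And>t. t \<in> D \<Longrightarrow> F' t = F t" for D' F'
        using max that by blast
    qed (rule charts)
    moreover have "\<psi> (\<phi> p + d * ray_coord u) \<in> F ` D" if "u < ray_block_end bot" for u
      using DF(2) DF(3)[of u] that by (metis imageI lessThan_iff subsetD)
    moreover have "F bot = p"
      using DF(3)[of bot] interval_chartD(9)[OF c] by (simp add: less_ray_block_end)
    ultimately show ?thesis using DF(1) by blast
  qed
  from this[of e] this[of "- e"] obtain D1 F1 D2 F2
    where r1: "is_ray L D1 F1" "closedin L (F1 ` D1)" "F1 bot = p"
        "\<And>u. u < ray_block_end bot \<Longrightarrow> \<psi> (\<phi> p + e * ray_coord u) \<in> F1 ` D1"
      and r2: "is_ray L D2 F2" "closedin L (F2 ` D2)" "F2 bot = p"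
        "\<And>u. u < ray_block_end bot \<Longrightarrow> \<psi> (\<phi> p + (- e) * ray_coord u) \<in> F2 ` D2"
    by metis
  let ?R = "F1 ` D1 \<union> F2 ` D2"
  let ?N = "{z \<in> I. \<phi> z \<in> ball (\<phi> p) e}"
  have N: "openin L ?N" "p \<in> ?N" using interval_chart_vimage_open[OF c(1) open_ball] c(2) e(1) by simp_all
  have "?N \<subseteq> ?R"
  proof
    fix z assume z: "z \<in> ?N"
    \<comment> \<open>The parameter at which the half-chart on the side of \<open>z\<close> passes
      through \<open>z\<close>.\<close>
    define w where "w = \<bar>\<phi> z - \<phi> p\<bar> / e"
    have w: "0 \<le> w" "w < 1" using z e(1) by (auto simp: w_def dist_real_def abs_minus_commute)
    define u where "u = ray_point (ray_block bot) w"
    have u: "u < ray_block_end bot" "ray_coord u = w" using w by (auto simp: u_def less_ray_block_end)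
    have "\<phi> p + e * w = \<phi> z \<or> \<phi> p + (- e) * w = \<phi> z" using e(1) by (auto simp: w_def abs_if)
    moreover have "\<psi> (\<phi> z) = z" using interval_chartD(9)[OF c(1)] z by simp
    ultimately show "z \<in> ?R" using r1(4)[OF u(1)] r2(4)[OF u(1)] u(2) by (metis UnI1 UnI2)
  qed
  have op: "openin L (F ` (D - {bot}))" if "is_ray L D F" for D F
    by (rule is_ray_open_image[OF charts that]) (use that in \<open>auto simp: is_ray_def open_delete\<close>)
  \<comment> \<open>This rewriting exhibits three open sets: \<open>p\<close> is the common starting
    point of both rays and is absorbed by the chart neighbourhood.\<close>
  have R: "?R = F1 ` (D1 - {bot}) \<union> F2 ` (D2 - {bot}) \<union> ?N"
    using \<open>?N \<subseteq> ?R\<close> r1(3) r2(3) N(2) by auto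
  have "openin L ?R"
    unfolding R by (intro openin_Un op r1(1) r2(1) N(1))
  moreover have "closedin L ?R" using r1(2) r2(2) by (simp add: closedin_Un)
  moreover have "?R \<noteq> {}" using N(2) \<open>?N \<subseteq> ?R\<close> by blast
  ultimately have "topspace L = ?R" using conn by (auto simp: connected_space_clopen_in)
  then show ?thesis using that r1(1) r2(1) by blast
qed

section \<open>Metrizability of sigma-compact one-manifolds\<close>

text \<open>Urysohn functions for the countably many pairs of basic sets, one containing the closure
  of the other, embed the space in a countable product of real lines.\<close>

theorem Urysohn_metrization:
  assumes reg: "regular_space X" and haus: "Hausdorff_space X" and sc: "second_countable X"
  shows "metrizable_space X"
proof -
  obtain B where B: "countable B" "\<And>V. V \<in> B \<Longrightarrow> openin X V"
    and base: "\<And>U x. openin X U \<Longrightarrow> x \<in> U \<Longrightarrow> \<exists>V\<in>B. x \<in> V \<and> V \<subseteq> U"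
    using sc unfolding second_countable_def by metis
  have normal: "normal_space X"
    using reg sc regular_Lindelof_imp_normal_space second_countable_imp_Lindelof_space by blast
  \<comment> \<open>For an index \<open>(U, V)\<close> the function below is 0 on \<open>U\<close>
    and 1 off \<open>V\<close>, so a value less than 1 certifies membership in
    \<open>V\<close>.\<close>
  define I where "I = {(U, V) \<in> B \<times> B. X closure_of U \<subseteq> V}"
  have "countable I" by (rule countable_subset[of _ "B \<times> B"]) (use B(1) in \<open>auto simp: I_def\<close>)
  have "\<exists>f. continuous_map X euclideanreal f \<and> (\<forall>x\<in>fst i. f x = 0) \<and> (\<forall>x\<in>topspace X - snd i. f x = 1)"
    if i: "i \<in> I" for i
  proof -
    obtain U V where UV: "i = (U, V)" "U \<in> B" "V \<in> B" "X closure_of U \<subseteq> V"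
      using i by (auto simp: I_def)
    have cl: "closedin X (topspace X - V)" using B(2)[OF UV(3)] by auto
    have dj: "disjnt (X closure_of U) (topspace X - V)" using UV(4) by (auto simp: disjnt_def)
    obtain f where "continuous_map X (top_of_set {0..1::real}) f"
      "f ` (X closure_of U) \<subseteq> {0}" "f ` (topspace X - V) \<subseteq> {1}"
      using Urysohn_lemma[OF normal closedin_closure_of cl dj zero_le_one] by metis
    moreover have "U \<subseteq> X closure_of U" using B(2)[OF UV(2)] by (simp add: closure_of_subset openin_subset)
    ultimately show ?thesis
      unfolding UV(1) continuous_map_in_subtopology
      by (intro exI[of _ f] conjI ballI) (blast, force, auto)
  qed
  then obtain f where f: "\<And>i. i \<in> I \<Longrightarrow> continuous_map X euclideanreal (f i)"
    "\<And>i x. i \<in> I \<Longrightarrow> x \<in> fst i \<Longrightarrow> f i x = 0"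
    "\<And>i x. i \<in> I \<Longrightarrow> x \<in> topspace X - snd i \<Longrightarrow> f i x = 1"
    by metis
  let ?P = "product_topology (\<lambda>_. euclideanreal) I"
  define e where "e x = (\<lambda>i\<in>I. f i x)" for x
  \<comment> \<open>Regularity provides an index whose function is 0 at \<open>x\<close> and 1
    outside \<open>W\<close>. Applied to the complement of a point it gives injectivity of
    \<open>e\<close>, applied to an open \<open>W\<close> it gives openness onto the image.\<close>
  have sep: "\<exists>i\<in>I. x \<in> fst i \<and> snd i \<subseteq> W" if W: "openin X W" "x \<in> W" for W x
  proof -
    obtain V where V: "V \<in> B" "x \<in> V" "V \<subseteq> W" using base[OF W] by blast
    obtain O' C where O': "openin X O'" "closedin X C" "x \<in> O'" "O' \<subseteq> C" "C \<subseteq> V"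
      using reg B(2)[OF V(1)] V(2) unfolding neighbourhood_base_of_closedin[symmetric] neighbourhood_base_of by metis
    obtain U where U: "U \<in> B" "x \<in> U" "U \<subseteq> O'" using base[OF O'(1,3)] by blast
    have "X closure_of U \<subseteq> C" using U(3) O'(2,4) by (simp add: closure_of_minimal)
    then have "(U, V) \<in> I" using U V O' by (auto simp: I_def)
    then show ?thesis using U V by (intro bexI[of _ "(U, V)"]) auto
  qed
  have lt: "y \<in> W" if "i \<in> I" "snd i \<subseteq> W" "y \<in> topspace X" "f i y < 1" for i W y
    using f(3)[OF that(1), of y] that by (cases "y \<in> snd i") auto
  have cont: "continuous_map X ?P e"
    unfolding continuous_map_componentwise e_def using f(1) by auto
  have inj: "inj_on e (topspace X)"
  proof (rule inj_onI, rule ccontr)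
    fix x y assume xy: "x \<in> topspace X" "y \<in> topspace X" "e x = e y" "x \<noteq> y"
    have W: "openin X (topspace X - {y})" "x \<in> topspace X - {y}"
      using haus xy by (auto simp: Hausdorff_imp_t1_space closedin_t1_singleton openin_diff)
    then obtain i where i: "i \<in> I" "x \<in> fst i" "snd i \<subseteq> topspace X - {y}" using sep by blast
    then have "f i x = 0" "f i y = 1" using f(2,3)[OF i(1)] xy by auto
    then show False using fun_cong[OF xy(3), of i] i(1) by (simp add: e_def)
  qed
  have "open_map X (subtopology ?P (e ` topspace X)) e"
    unfolding open_map_def
  proof (intro allI impI)
    fix W assume W: "openin X W"
    show "openin (subtopology ?P (e ` topspace X)) (e ` W)"
    proof (subst openin_subopen, intro ballI)
      fix z assume "z \<in> e ` W"
      then obtain x where x: "x \<in> W" "z = e x" by blast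
      obtain i where i: "i \<in> I" "x \<in> fst i" "snd i \<subseteq> W" using sep[OF W x(1)] by blast
      let ?T = "{y \<in> topspace ?P. y i \<in> {..<1}}"
      have "openin ?P ?T"
        by (rule openin_continuous_map_preimage[OF continuous_map_product_projection[OF i(1)]]) simp
      then have "openin (subtopology ?P (e ` topspace X)) (?T \<inter> e ` topspace X)"
        by (auto simp: openin_subtopology)
      moreover have "z \<in> ?T \<inter> e ` topspace X"
      proof -
        have "x \<in> topspace X" using W x openin_subset by blast
        then show ?thesis using x f(2)[OF i(1,2)] i(1) by (auto simp: e_def)
      qed
      moreover have "?T \<inter> e ` topspace X \<subseteq> e ` W"
        using lt[OF i(1,3)] i(1) by (auto simp: e_def)
      ultimately show "\<exists>T. openin (subtopology ?P (e ` topspace X)) T \<and> z \<in> T \<and> T \<subseteq> e ` W" by blast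
    qed
  qed
  moreover have "continuous_map X (subtopology ?P (e ` topspace X)) e"
    using cont by (auto simp: continuous_map_in_subtopology)
  moreover have "e ` topspace X = topspace (subtopology ?P (e ` topspace X))"
    using cont by (auto simp: continuous_map_def)
  ultimately have "homeomorphic_map X (subtopology ?P (e ` topspace X)) e"
    using inj bijective_open_imp_homeomorphic_map by metis
  then have hom: "X homeomorphic_space subtopology ?P (e ` topspace X)"
    by (rule homeomorphic_map_imp_homeomorphic_space)
  have "metrizable_space ?P"
    using \<open>countable I\<close> by (simp add: metrizable_space_product_topology metrizable_space_euclidean)
  then show ?thesis
    using homeomorphic_metrizable_space[OF hom] metrizable_space_subtopology by blast
qed

text \<open>Each compact piece needs finitely many charts, so countably many cover \<open>L\<close>,
  and the rational subintervals of these form a countable base. Regularity comes from local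
  compactness together with the Hausdorff property.\<close>

lemma one_manifold_metrizable:
  assumes haus: "Hausdorff_space L"
    and charts: "\<And>q. q \<in> topspace L \<Longrightarrow> \<exists>I \<phi> \<psi> J. interval_chart L I \<phi> \<psi> J \<and> q \<in> I"
    and K: "countable \<K>" "\<And>K. K \<in> \<K> \<Longrightarrow> compactin L K" "topspace L \<subseteq> \<Union>\<K>"
  shows "metrizable_space L"
proof (rule Urysohn_metrization)
  show "Hausdorff_space L" by (rule haus)
  define Ch where "Ch = {I. \<exists>\<phi> \<psi> J. interval_chart L I \<phi> \<psi> J}"
  have "\<exists>\<F>. finite \<F> \<and> \<F> \<subseteq> Ch \<and> K \<subseteq> \<Union>\<F>" if "K \<in> \<K>" for K
  proof -
    have "\<forall>U\<in>Ch. openin L U" by (auto simp: Ch_def interval_chartD(1))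
    moreover have "K \<subseteq> \<Union>Ch"
    proof
      fix x assume "x \<in> K"
      then have "x \<in> topspace L" using compactin_subset_topspace[OF K(2)[OF that]] by blast
      then show "x \<in> \<Union>Ch" using charts[of x] by (auto simp: Ch_def)
    qed
    ultimately show ?thesis using K(2)[OF that] unfolding compactin_def by meson
  qed
  then obtain Fin where Fin: "\<And>K. K \<in> \<K> \<Longrightarrow> finite (Fin K) \<and> Fin K \<subseteq> Ch \<and> K \<subseteq> \<Union>(Fin K)" by metis
  define A where "A = (\<Union>K\<in>\<K>. Fin K)"
  have "countable A" unfolding A_def using K(1) Fin by (auto intro: countable_UN countable_finite)
  have cover: "topspace L \<subseteq> \<Union>A" using K(3) Fin unfolding A_def by blast
  have "\<exists>\<phi> \<psi> J. interval_chart L I \<phi> \<psi> J" if "I \<in> A" for I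
    using that Fin unfolding A_def Ch_def by blast
  then obtain \<phi> \<psi> J where c: "\<And>I. I \<in> A \<Longrightarrow> interval_chart L I (\<phi> I) (\<psi> I) (J I)" by metis
  define B where "B = (\<lambda>(I, a, b). {z \<in> I. \<phi> I z \<in> {a<..<b}}) ` (A \<times> \<rat> \<times> \<rat>)"
  show "second_countable L"
    unfolding second_countable_def
  proof (intro exI[of _ B] conjI ballI allI impI)
    show "countable B" unfolding B_def using \<open>countable A\<close> countable_rat by auto
    show "openin L V" if "V \<in> B" for V
      using that interval_chart_vimage_open[OF c open_greaterThanLessThan] unfolding B_def
      by (clarsimp simp del: greaterThanLessThan_iff)
    fix W q assume W: "openin L W \<and> q \<in> W"
    then have "q \<in> topspace L" using openin_subset by blast
    then obtain I where I: "I \<in> A" "q \<in> I" using cover by blast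
    have W': "openin L W" "q \<in> W" using W by auto
    obtain e where e: "e > 0" "\<psi> I ` ball (\<phi> I q) e \<subseteq> W"
      using interval_chart_within[OF c[OF I(1)] I(2) W'] by metis
    obtain a where a: "a \<in> \<rat>" "\<phi> I q - e < a" "a < \<phi> I q"
      using Rats_dense_in_real[of "\<phi> I q - e" "\<phi> I q"] e(1) by auto
    obtain b where b: "b \<in> \<rat>" "\<phi> I q < b" "b < \<phi> I q + e"
      using Rats_dense_in_real[of "\<phi> I q" "\<phi> I q + e"] e(1) by auto
    let ?V = "{z \<in> I. \<phi> I z \<in> {a<..<b}}"
    have "?V \<in> B" unfolding B_def using I a b by (intro image_eqI[where x="(I, a, b)"]) auto
    moreover have "q \<in> ?V" using I a b by auto
    moreover have "?V \<subseteq> W"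
    proof
      fix z assume z: "z \<in> ?V"
      then have "\<phi> I z \<in> ball (\<phi> I q) e" using a b by (auto simp: dist_real_def)
      moreover have "\<psi> I (\<phi> I z) = z" using interval_chartD(9)[OF c[OF I(1)]] z by blast
      ultimately show "z \<in> W" using e(2) by (metis imageI subsetD)
    qed
    ultimately show "\<exists>V\<in>B. q \<in> V \<and> V \<subseteq> W" by (intro bexI[of _ ?V] conjI)
  qed
  have "locally_compact_space L"
    unfolding locally_compact_space_def
  proof (intro ballI)
    fix q assume "q \<in> topspace L"
    then obtain I where I: "I \<in> A" "q \<in> I" using cover by blast
    note c = c[OF I(1)]
    obtain e where e: "e > 0" "cball (\<phi> I q) e \<subseteq> J I"
      using interval_chartD(2,7)[OF c] I(2) open_contains_cball by blast
    let ?U = "{z \<in> I. \<phi> I z \<in> ball (\<phi> I q) e}" and ?K = "\<psi> I ` cball (\<phi> I q) e"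
    have "compactin (top_of_set (J I)) (cball (\<phi> I q) e)"
      using e(2) by (auto simp: compactin_subtopology)
    then have "compactin L ?K" using interval_chartD(6)[OF c] image_compactin by blast
    moreover have "?U \<subseteq> ?K"
    proof
      fix z assume z: "z \<in> ?U"
      then have "\<phi> I z \<in> cball (\<phi> I q) e" by auto
      moreover have "\<psi> I (\<phi> I z) = z" using interval_chartD(9)[OF c] z by blast
      ultimately show "z \<in> ?K" by (metis imageI)
    qed
    moreover have "openin L ?U" by (rule interval_chart_vimage_open[OF c open_ball])
    moreover have "q \<in> ?U" using I e by auto
    ultimately show "\<exists>U K. openin L U \<and> compactin L K \<and> q \<in> U \<and> U \<subseteq> K" by blast
  qed
  then show "regular_space L"
    using haus locally_compact_Hausdorff_imp_regular_space by blast
qed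

text \<open>The segments \<open>{..d}\<close> with \<open>d < b\<close> of rational coordinate are
  compact, countable in number because they are bounded by \<open>b\<close>, and exhaust
  \<open>{..<b}\<close> by density.\<close>

lemma is_ray_sigma_compact:
  assumes "is_ray L {..<b} F"
  shows "\<exists>\<K>. countable \<K> \<and> (\<forall>K\<in>\<K>. compactin L K) \<and> F ` {..<b} \<subseteq> \<Union>\<K>"
proof (intro exI conjI ballI)
  let ?Q = "{z. ray_coord z \<in> \<rat> \<and> z \<le> b} - {b}"
  let ?K = "(\<lambda>d. F ` {..d}) ` ?Q"
  show "countable ?K" using countable_ray_rational_below[of b] by auto
  show "compactin L K" if K: "K \<in> ?K" for K
  proof -
    obtain d where d: "d < b" "K = F ` {..d}" using K by (auto simp: less_le)
    have "{..d} \<subseteq> {..<b}" using d(1) by auto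
    then have "compactin (top_of_set {..<b}) {..d}"
      using compact_ray_atMost by (auto simp: compactin_subtopology)
    then show ?thesis using assms d(2) image_compactin unfolding is_ray_def by blast
  qed
  show "F ` {..<b} \<subseteq> \<Union>?K"
  proof
    fix y assume "y \<in> F ` {..<b}"
    then obtain x where x: "x < b" "y = F x" by auto
    obtain d where d: "x < d" "d < b" "ray_coord d \<in> \<rat>" using ray_rational_dense[OF x(1)] by blast
    then have "d \<in> ?Q" "y \<in> F ` {..d}" using x by auto
    then show "y \<in> \<Union>?K" by blast
  qed
qed

proposition nonmetrizable_one_manifold_long_ray:
  assumes haus: "Hausdorff_space L" and conn: "connected_space L" and nm: "\<not> metrizable_space L"
    and charts: "\<And>q. q \<in> topspace L \<Longrightarrow> \<exists>I \<phi> \<psi> J. interval_chart L I \<phi> \<psi> J \<and> q \<in> I"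
  obtains F where "is_ray L UNIV F"
proof -
  have ne: "topspace L \<noteq> {}"
  proof
    assume "topspace L = {}"
    then have "L = trivial_topology" by simp
    then show False using nm empty_metrizable_space by metis
  qed
  obtain D1 F1 D2 F2 where r: "is_ray L D1 F1" "is_ray L D2 F2" "topspace L = F1 ` D1 \<union> F2 ` D2"
    using one_manifold_two_rays[OF haus conn ne charts] by metis
  show ?thesis
  proof (cases "D1 = UNIV \<or> D2 = UNIV")
    case True
    then show ?thesis using r that by blast
  next
    case False
    then obtain b1 b2 where "D1 = {..<b1}" "D2 = {..<b2}" using is_ray_domain r(1,2) by metis
    then obtain K1 K2 where K: "countable K1" "\<forall>K\<in>K1. compactin L K" "F1 ` D1 \<subseteq> \<Union>K1"
      "countable K2" "\<forall>K\<in>K2. compactin L K" "F2 ` D2 \<subseteq> \<Union>K2"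
      using is_ray_sigma_compact r(1,2) by metis
    have "metrizable_space L"
      by (rule one_manifold_metrizable[OF haus charts, of "K1 \<union> K2"]) (use K r(3) in auto)
    then show ?thesis using nm by blast
  qed
qed

section \<open>The leaf topology of a one-dimensional foliation\<close>

lemma interval_charts_path_connectedin:
  assumes "interval_chart L I \<phi> \<psi> J"
  shows "path_connectedin L I"
proof -
  have "path_connectedin (top_of_set J) J"
    using interval_chartD(3)[OF assms] by (simp add: path_connectedin_subtopology is_interval_path_connected_1[symmetric] is_interval_connected_1)
  then have "path_connectedin L (\<psi> ` J)"
    using interval_chartD(6)[OF assms] path_connectedin_continuous_map_image by blast
  moreover have "\<psi> ` J = I" using interval_chartD(7-10)[OF assms] by force
  ultimately show ?thesis by simp
qed

text \<open>This is what makes leaves, defined as path components, open in the leaf topology, and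
  lets them be computed as connected components.\<close>

lemma interval_charts_locally_path_connected:
  assumes charts: "\<And>q. q \<in> topspace L \<Longrightarrow> \<exists>I \<phi> \<psi> J. interval_chart L I \<phi> \<psi> J \<and> q \<in> I"
  shows "locally_path_connected_space L"
  unfolding locally_path_connected_space_def neighbourhood_base_of
proof (intro allI impI)
  fix W q assume W: "openin L W \<and> q \<in> W"
  then have "q \<in> topspace L" using openin_subset by blast
  then obtain I \<phi> \<psi> J where c: "interval_chart L I \<phi> \<psi> J" "q \<in> I" using charts by blast
  obtain e where e: "e > 0" "ball (\<phi> q) e \<subseteq> J" "\<psi> ` ball (\<phi> q) e \<subseteq> W"
    and c': "interval_chart L {z \<in> I. \<phi> z \<in> ball (\<phi> q) e} \<phi> \<psi> (ball (\<phi> q) e)"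
    by (rule interval_chart_within[OF c conjunct1[OF W] conjunct2[OF W]])
  let ?I = "{z \<in> I. \<phi> z \<in> ball (\<phi> q) e}"
  have "?I \<subseteq> W"
  proof
    fix z assume "z \<in> ?I"
    then have "\<psi> (\<phi> z) = z" "\<phi> z \<in> ball (\<phi> q) e" using interval_chartD(7,9)[OF c'] by auto
    then show "z \<in> W" using e(3) by (metis imageI subsetD)
  qed
  moreover have "q \<in> ?I" using c(2) e(1) by simp
  ultimately show "\<exists>U V. openin L U \<and> path_connectedin L V \<and> q \<in> U \<and> U \<subseteq> V \<and> V \<subseteq> W"
    using interval_charts_path_connectedin[OF c'] interval_chartD(1)[OF c'] by blast
qed

lemma interval_charts_open_subset:
  assumes charts: "\<And>q. q \<in> topspace L \<Longrightarrow> \<exists>I \<phi> \<psi> J. interval_chart L I \<phi> \<psi> J \<and> q \<in> I"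
    and S: "openin L S" and q: "q \<in> topspace (subtopology L S)"
  shows "\<exists>I \<phi> \<psi> J. interval_chart (subtopology L S) I \<phi> \<psi> J \<and> q \<in> I"
proof -
  have "q \<in> topspace L" "q \<in> S" using q by auto
  then obtain I \<phi> \<psi> J where c: "interval_chart L I \<phi> \<psi> J" "q \<in> I" using charts by blast
  obtain e where e: "e > 0" "ball (\<phi> q) e \<subseteq> J" "\<psi> ` ball (\<phi> q) e \<subseteq> S"
    and c': "interval_chart L {z \<in> I. \<phi> z \<in> ball (\<phi> q) e} \<phi> \<psi> (ball (\<phi> q) e)"
    by (rule interval_chart_within[OF c S \<open>q \<in> S\<close>])
  let ?I = "{z \<in> I. \<phi> z \<in> ball (\<phi> q) e}"
  have "?I \<subseteq> S"
  proof
    fix z assume "z \<in> ?I"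
    then have "\<psi> (\<phi> z) = z" "\<phi> z \<in> ball (\<phi> q) e" using interval_chartD(7,9)[OF c'] by auto
    then show "z \<in> S" using e(3) by (metis imageI subsetD)
  qed
  then have "subtopology (subtopology L S) ?I = subtopology L ?I" "openin (subtopology L S) ?I"
    using interval_chartD(1)[OF c'] S
    by (simp_all add: subtopology_subtopology Int_absorb1 openin_open_subtopology)
  then have "interval_chart (subtopology L S) ?I \<phi> \<psi> (ball (\<phi> q) e)"
    using c' by (simp add: interval_chart_def)
  moreover have "q \<in> ?I" using c(2) e(1) by simp
  ultimately show ?thesis by blast
qed

lemma homeomorphic_map_Euclidean_space_1:
  "homeomorphic_map (Euclidean_space 1) euclideanreal (\<lambda>x. x 0)"
proof -
  have "homeomorphic_maps (Euclidean_space 1) euclideanreal (\<lambda>x. x 0) (\<lambda>t i. if i < 1 then t else 0)"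
    unfolding homeomorphic_maps_def
  proof (intro conjI)
    show "continuous_map (Euclidean_space 1) euclideanreal (\<lambda>x. x 0)"
      unfolding Euclidean_space_def
      by (intro continuous_map_from_subtopology continuous_map_product_projection) simp
    show "continuous_map euclideanreal (Euclidean_space 1) (\<lambda>t i. if i < 1 then t else 0)"
      by (subst continuous_map_componentwise_Euclidean_space) simp
  qed (auto simp: topspace_Euclidean_space fun_eq_iff)
  then show ?thesis using homeomorphic_maps_map by blast
qed

lemma foliated_change_mono:
  assumes "foliated_change n p (U, \<phi>) (V, \<psi>)" "U' \<subseteq> U" "V' \<subseteq> V"
  shows "foliated_change n p (U', \<phi>) (V', \<psi>)"
  using assms unfolding foliated_change_def by blast

lemma is_chart_restrict:
  assumes "is_chart n p X (U, \<phi>)" "openin X W"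
  shows "is_chart n p X (U \<inter> W, \<phi>)"
proof -
  let ?E = "prod_topology (Euclidean_space p) (Euclidean_space (n - p))"
  obtain V where U: "openin X U" and V: "openin ?E V"
    and h: "homeomorphic_map (subtopology X U) (subtopology ?E V) \<phi>"
    using assms(1) by (auto simp: is_chart_def)
  have ts: "topspace (subtopology X U) = U" "topspace (subtopology ?E V) = V"
    using U V openin_subset by (auto simp del: topspace_prod_topology)
  have op: "openin (subtopology X U) (U \<inter> W)" using assms(2) by (simp add: openin_subtopology_Int2)
  then have "openin (subtopology ?E V) (\<phi> ` (U \<inter> W))"
    using homeomorphic_imp_open_map[OF h] by (simp add: open_map_def)
  then have V': "openin ?E (\<phi> ` (U \<inter> W))" "\<phi> ` (U \<inter> W) \<subseteq> V"
    using V by (simp_all add: openin_open_subtopology)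
  have "homeomorphic_map (subtopology (subtopology X U) (U \<inter> W))
      (subtopology (subtopology ?E V) (\<phi> ` (U \<inter> W))) \<phi>"
    by (rule homeomorphic_map_subtopologies[OF h]) (use V'(2) in \<open>auto simp only: ts\<close>)
  then have "homeomorphic_map (subtopology X (U \<inter> W)) (subtopology ?E (\<phi> ` (U \<inter> W))) \<phi>"
    using V'(2) by (simp add: subtopology_subtopology Int_absorb1 Int_assoc[symmetric])
  then show ?thesis
    using V'(1) openin_Int[OF U assms(2)] unfolding is_chart_def by auto
qed

section \<open>Foliated atlases closed under restriction, and product boxes\<close>

text \<open>Maximality of the atlas is replaced by its consequence \<open>restr\<close>. In this
  form the assumptions pass to open subspaces with the restricted atlas, so the same theory applies
  to the foliation above a given height.\<close>

locale one_dim_foliation =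
  fixes X :: "'b topology" and k :: nat and \<F> :: "'b chart set"
  assumes haus: "Hausdorff_space X"
    and atlas: "foliated_atlas (k + 1) 1 X \<F>"
    and restr: "(U, \<phi>) \<in> \<F> \<Longrightarrow> openin X W \<Longrightarrow> (U \<inter> W, \<phi>) \<in> \<F>"

text \<open>All restrictions of charts to open sets together form a foliated atlas containing \<F>,
  so by maximality they already belong to \<F>.\<close>

lemma foliation_imp_one_dim_foliation:
  assumes "foliation (k + 1) 1 X \<F>"
  shows "one_dim_foliation X k \<F>"
proof -
  have haus: "Hausdorff_space X" and at: "foliated_atlas (k + 1) 1 X \<F>"
    and max: "\<And>\<G>. foliated_atlas (k + 1) 1 X \<G> \<Longrightarrow> \<F> \<subseteq> \<G> \<Longrightarrow> \<G> = \<F>"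
    using assms by (auto simp: foliation_def manifold_def)
  define \<G> where "\<G> = {(U \<inter> W, \<phi>) | U W \<phi>. (U, \<phi>) \<in> \<F> \<and> openin X W}"
  have sub: "U \<subseteq> topspace X" if "(U, \<phi>) \<in> \<F>" for U \<phi>
    using at that unfolding foliated_atlas_def by blast
  have FG: "\<F> \<subseteq> \<G>"
  proof
    fix c assume c: "c \<in> \<F>"
    obtain U \<phi> where [simp]: "c = (U, \<phi>)" by (cases c)
    have "U = U \<inter> topspace X" using sub c by auto
    then show "c \<in> \<G>" using c openin_topspace[of X] unfolding \<G>_def by auto
  qed
  have "foliated_atlas (k + 1) 1 X \<G>"
    unfolding foliated_atlas_def
  proof (intro conjI ballI)
    fix c assume "c \<in> \<G>"
    then obtain U W \<phi> where c: "c = (U \<inter> W, \<phi>)" "(U, \<phi>) \<in> \<F>" "openin X W" by (auto simp: \<G>_def)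
    show "is_chart (k + 1) 1 X c"
      unfolding c(1) by (rule is_chart_restrict) (use at c in \<open>auto simp: foliated_atlas_def\<close>)
    fix d assume "d \<in> \<G>"
    then obtain U' W' \<phi>' where d: "d = (U' \<inter> W', \<phi>')" "(U', \<phi>') \<in> \<F>" "openin X W'" by (auto simp: \<G>_def)
    have "foliated_change (k + 1) 1 (U, \<phi>) (U', \<phi>')"
      using at c(2) d(2) unfolding foliated_atlas_def by blast
    then show "foliated_change (k + 1) 1 c d"
      unfolding c(1) d(1) by (rule foliated_change_mono) auto
  next
    have "(\<Union>(U, \<phi>)\<in>\<F>. U) = topspace X" using at by (simp add: foliated_atlas_def)
    moreover have "(\<Union>(U, \<phi>)\<in>\<F>. U) \<subseteq> (\<Union>(U, \<phi>)\<in>\<G>. U)" using FG by blast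
    moreover have "(\<Union>(U, \<phi>)\<in>\<G>. U) \<subseteq> topspace X" using sub unfolding \<G>_def by blast
    ultimately show "(\<Union>(U, \<phi>)\<in>\<G>. U) = topspace X" by blast
  qed
  then have "\<G> = \<F>" using max FG by blast
  then have "(U \<inter> W, \<phi>) \<in> \<F>" if "(U, \<phi>) \<in> \<F>" "openin X W" for U \<phi> W
    using that unfolding \<G>_def by blast
  then show ?thesis using haus at by unfold_locales
qed

lemma (in one_dim_foliation) restrict_one_dim_foliation:
  assumes W: "openin X W"
  shows "one_dim_foliation (subtopology X W) k (restrict_foliation \<F> W)"
proof
  show "Hausdorff_space (subtopology X W)" using haus by (rule Hausdorff_space_subtopology)
  have sub: "restrict_foliation \<F> W \<subseteq> \<F>" using restr[OF _ W] by (auto simp: restrict_foliation_def)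
  show "foliated_atlas (k + 1) 1 (subtopology X W) (restrict_foliation \<F> W)"
    unfolding foliated_atlas_def
  proof (intro conjI ballI)
    fix c assume c: "c \<in> restrict_foliation \<F> W"
    then obtain U \<phi> where U: "c = (U \<inter> W, \<phi>)" by (auto simp: restrict_foliation_def)
    have "is_chart (k + 1) 1 X (U \<inter> W, \<phi>)" using c sub atlas U unfolding foliated_atlas_def by blast
    moreover have "subtopology (subtopology X W) (U \<inter> W) = subtopology X (U \<inter> W)"
      by (simp add: subtopology_subtopology Int_absorb1)
    ultimately show "is_chart (k + 1) 1 (subtopology X W) c"
      using W unfolding U is_chart_def by (auto simp: openin_open_subtopology)
    fix d assume "d \<in> restrict_foliation \<F> W"
    then show "foliated_change (k + 1) 1 c d" using c sub atlas unfolding foliated_atlas_def by blast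
  next
    have "(\<Union>(U, \<phi>)\<in>restrict_foliation \<F> W. U) = (\<Union>(U, \<phi>)\<in>\<F>. U) \<inter> W"
      unfolding restrict_foliation_def by auto
    then show "(\<Union>(U, \<phi>)\<in>restrict_foliation \<F> W. U) = topspace (subtopology X W)"
      using atlas by (simp add: foliated_atlas_def)
  qed
  fix U \<phi> W' assume U: "(U, \<phi>) \<in> restrict_foliation \<F> W" and W': "openin (subtopology X W) W'"
  then obtain U0 where U0: "U = U0 \<inter> W" "(U0, \<phi>) \<in> \<F>" by (auto simp: restrict_foliation_def)
  have "(U0 \<inter> W', \<phi>) \<in> \<F>" using restr U0(2) W' W by (simp add: openin_open_subtopology)
  moreover have "U \<inter> W' = (U0 \<inter> W') \<inter> W" using U0 by auto
  ultimately show "(U \<inter> W', \<phi>) \<in> restrict_foliation \<F> W" unfolding restrict_foliation_def by force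
qed

context one_dim_foliation
begin

abbreviation "Eucl \<equiv> Euclidean_space k"

abbreviation "\<Lambda> \<equiv> leaf_topology X \<F>"

lemma chart_ex: "z \<in> topspace X \<Longrightarrow> \<exists>U \<phi>. (U, \<phi>) \<in> \<F> \<and> z \<in> U"
  using atlas unfolding foliated_atlas_def by blast

lemma chart_open: "(U, \<phi>) \<in> \<F> \<Longrightarrow> openin X U"
  using atlas unfolding foliated_atlas_def is_chart_def by fast

lemma chart_subset: "(U, \<phi>) \<in> \<F> \<Longrightarrow> U \<subseteq> topspace X"
  using chart_open openin_subset by blast

lemma chart_real_homeo:
  assumes "(U, \<phi>) \<in> \<F>"
  obtains V where "openin (prod_topology euclideanreal Eucl) V"
    "homeomorphic_map (subtopology X U) (subtopology (prod_topology euclideanreal Eucl) V)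
      (\<lambda>z. (fst (\<phi> z) 0, snd (\<phi> z)))"
proof -
  let ?E = "prod_topology (Euclidean_space 1) Eucl" and ?R = "prod_topology euclideanreal Eucl"
  let ?\<chi> = "\<lambda>(x, y). (x 0, y)" let ?\<phi> = "\<lambda>z. (fst (\<phi> z) 0, snd (\<phi> z))"
  obtain V where V: "openin ?E V" and h: "homeomorphic_map (subtopology X U) (subtopology ?E V) \<phi>"
    using assms atlas unfolding foliated_atlas_def is_chart_def by force
  obtain \<iota> where "homeomorphic_maps (Euclidean_space 1) euclideanreal (\<lambda>x. x 0) \<iota>"
    using homeomorphic_map_Euclidean_space_1 homeomorphic_map_maps by blast
  moreover have "homeomorphic_maps Eucl Eucl (\<lambda>x. x) (\<lambda>x. x)"
    by (simp add: homeomorphic_maps_def)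
  ultimately have "homeomorphic_maps ?E ?R (\<lambda>(x, y). (x 0, y)) (\<lambda>(x, y). (\<iota> x, y))"
    by (simp add: homeomorphic_maps_prod)
  then have \<chi>: "homeomorphic_map ?E ?R ?\<chi>" using homeomorphic_maps_map by blast
  have V': "openin ?R (?\<chi> ` V)" using homeomorphic_imp_open_map[OF \<chi>] V unfolding open_map_def by blast
  have VE: "V \<subseteq> topspace ?E" using V openin_subset by blast
  have "homeomorphic_map (subtopology ?E V) (subtopology ?R (?\<chi> ` V)) ?\<chi>"
  proof (rule homeomorphic_map_subtopologies[OF \<chi>])
    have "?\<chi> ` V \<subseteq> topspace ?R" using V' openin_subset by blast
    then show "?\<chi> ` (topspace ?E \<inter> V) = topspace ?R \<inter> ?\<chi> ` V" using VE by (simp only: Int_absorb1)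
  qed
  then have "homeomorphic_map (subtopology X U) (subtopology ?R (?\<chi> ` V)) (?\<chi> \<circ> \<phi>)"
    using h homeomorphic_map_compose by blast
  moreover have "?\<chi> \<circ> \<phi> = ?\<phi>" by (auto simp: fun_eq_iff case_prod_unfold)
  ultimately show ?thesis using that V' by simp
qed

text \<open>Charts take values in \<open>Euclidean_space 1 \<times> Euclidean_space k\<close>; the real number
  \<open>fst (\<phi> z) 0\<close> is the coordinate along the leaf.\<close>

definition box :: "'b set \<Rightarrow> ('b \<Rightarrow> (nat \<Rightarrow> real) \<times> (nat \<Rightarrow> real)) \<Rightarrow> real set \<Rightarrow> (nat \<Rightarrow> real) set \<Rightarrow> bool"
  where "box U \<phi> J B \<longleftrightarrow> (U, \<phi>) \<in> \<F> \<and> open J \<and> connected J \<and> openin Eucl B \<and>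
    homeomorphic_map (subtopology X U) (prod_topology (top_of_set J) (subtopology Eucl B))
      (\<lambda>z. (fst (\<phi> z) 0, snd (\<phi> z)))"

text \<open>The fibre of a general chart over a transverse value may be disconnected. In a product
  box it is a single interval, so it is one plaque and carries one leaf chart.\<close>

lemma box_ex:
  assumes c: "(U, \<phi>) \<in> \<F>" and z: "z \<in> U" and W: "openin X W" "z \<in> W"
  obtains U' J B where "box U' \<phi> J B" "z \<in> U'" "U' \<subseteq> U" "U' \<subseteq> W"
proof -
  let ?R = "prod_topology euclideanreal Eucl" let ?\<phi> = "\<lambda>z. (fst (\<phi> z) 0, snd (\<phi> z))"
  have cW: "(U \<inter> W, \<phi>) \<in> \<F>" by (rule restr[OF c W(1)])
  obtain V where V: "openin ?R V" and h: "homeomorphic_map (subtopology X (U \<inter> W)) (subtopology ?R V) ?\<phi>"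
    using chart_real_homeo[OF cW] by blast
  have tsX: "topspace (subtopology X (U \<inter> W)) = U \<inter> W" using chart_subset[OF cW] by auto
  have VR: "V \<subseteq> topspace ?R" using V openin_subset by blast
  have tsV: "topspace (subtopology ?R V) = V" using VR by (metis inf.absorb_iff2 topspace_subtopology)
  have im: "?\<phi> ` (U \<inter> W) = V" using homeomorphic_imp_surjective_map[OF h] by (simp only: tsX tsV)
  have "?\<phi> z \<in> V" using im z W(2) by blast
  then obtain J0 B where JB: "open J0" "openin Eucl B" "fst (\<phi> z) 0 \<in> J0" "snd (\<phi> z) \<in> B" "J0 \<times> B \<subseteq> V"
    using V unfolding openin_prod_topology_alt open_openin[symmetric] by metis
  obtain e where e: "e > 0" "ball (fst (\<phi> z) 0) e \<subseteq> J0" using JB(1,3) open_contains_ball by blast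
  let ?J = "ball (fst (\<phi> z) 0) e"
  have JBV: "?J \<times> B \<subseteq> V" using JB(5) e(2) by blast
  define U' where "U' = {w \<in> U \<inter> W. ?\<phi> w \<in> ?J \<times> B}"
  have h': "homeomorphic_map (subtopology (subtopology X (U \<inter> W)) U')
      (subtopology (subtopology ?R V) (?J \<times> B)) ?\<phi>"
    by (rule homeomorphic_map_subtopologies_alt[OF h]) (use tsX in \<open>auto simp: U'_def\<close>)
  have op: "openin X U'"
  proof -
    have "openin ?R (?J \<times> B)" using JB(2) by (simp add: openin_prod_Times_iff)
    then have "openin (subtopology ?R V) (?J \<times> B)" using V JBV by (simp add: openin_open_subtopology)
    then have "openin (subtopology X (U \<inter> W)) {w \<in> topspace (subtopology X (U \<inter> W)). ?\<phi> w \<in> ?J \<times> B}"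
      using homeomorphic_imp_continuous_map[OF h] openin_continuous_map_preimage by blast
    then show ?thesis
      unfolding tsX U'_def using chart_open[OF cW] by (meson openin_open_subtopology)
  qed
  have "(U \<inter> U', \<phi>) \<in> \<F>" by (rule restr[OF c op])
  moreover have sub: "U' \<subseteq> U" "U' \<subseteq> W" by (auto simp: U'_def)
  moreover have "U \<inter> U' = U'" using sub by blast
  moreover have "homeomorphic_map (subtopology X U') (prod_topology (top_of_set ?J) (subtopology Eucl B)) ?\<phi>"
  proof -
    have "subtopology (subtopology X (U \<inter> W)) U' = subtopology X U'"
      using sub by (simp add: subtopology_subtopology Int_absorb1)
    moreover have "subtopology (subtopology ?R V) (?J \<times> B) = subtopology ?R (?J \<times> B)"
      using JBV by (simp only: subtopology_subtopology Int_absorb1)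
    ultimately show ?thesis using h' by (simp only: subtopology_Times)
  qed
  ultimately have "box U' \<phi> ?J B" using JB(2) by (simp add: box_def)
  moreover have "z \<in> U'" using z W JB(4) e(1) by (simp add: U'_def)
  ultimately show ?thesis using that sub by blast
qed

lemma chart_proj_continuous:
  assumes "(U, \<phi>) \<in> \<F>"
  shows "continuous_map (subtopology X U) Eucl (\<lambda>z. snd (\<phi> z))"
proof -
  obtain V where "homeomorphic_map (subtopology X U) (subtopology (prod_topology euclideanreal Eucl) V)
      (\<lambda>z. (fst (\<phi> z) 0, snd (\<phi> z)))"
    using chart_real_homeo[OF assms] by blast
  then have "continuous_map (subtopology X U) (prod_topology euclideanreal Eucl)
      (\<lambda>z. (fst (\<phi> z) 0, snd (\<phi> z)))"
    using homeomorphic_imp_continuous_map continuous_map_in_subtopology by blast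
  then show ?thesis using continuous_map_compose[OF _ continuous_map_snd] by (fastforce simp: o_def)
qed

lemma chart_proj_open:
  assumes c: "(U, \<phi>) \<in> \<F>" and G: "openin X G" "G \<subseteq> U"
  shows "openin Eucl ((\<lambda>z. snd (\<phi> z)) ` G)"
proof -
  let ?R = "prod_topology euclideanreal Eucl" let ?\<phi> = "\<lambda>z. (fst (\<phi> z) 0, snd (\<phi> z))"
  obtain V where V: "openin ?R V" and h: "homeomorphic_map (subtopology X U) (subtopology ?R V) ?\<phi>"
    using chart_real_homeo[OF c] by blast
  have "openin (subtopology X U) G" using G chart_open[OF c] by (simp add: openin_open_subtopology)
  then have "openin (subtopology ?R V) (?\<phi> ` G)"
    using homeomorphic_imp_open_map[OF h] by (simp add: open_map_def)
  then have "openin ?R (?\<phi> ` G)" using V by (simp add: openin_open_subtopology)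
  then have "openin Eucl (snd ` ?\<phi> ` G)" using open_map_snd unfolding open_map_def by blast
  then show ?thesis by (simp add: image_image)
qed

text \<open>The transverse part \<open>h\<close> of a coordinate change depends on the transverse
  coordinate alone; hence fibres of different charts match on overlaps.\<close>

lemma change_proj_constant:
  assumes "(U, \<phi>) \<in> \<F>" "(V, \<psi>) \<in> \<F>" "z \<in> U \<inter> V" "w \<in> U \<inter> V" "snd (\<phi> z) = snd (\<phi> w)"
  shows "snd (\<psi> z) = snd (\<psi> w)"
proof -
  have "foliated_change (k + 1) 1 (U, \<phi>) (V, \<psi>)" using atlas assms(1,2) unfolding foliated_atlas_def by blast
  then obtain g h where "\<forall>z\<in>U \<inter> V. \<forall>x y. \<phi> z = (x, y) \<longrightarrow> \<psi> z = (g (x, y), h y)"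
    unfolding foliated_change_def by blast
  then have "snd (\<psi> u) = h (snd (\<phi> u))" if "u \<in> U \<inter> V" for u
    using that by (metis prod.collapse snd_conv)
  then show ?thesis using assms by metis
qed

end

context one_dim_foliation
begin

section \<open>The leaf topology, and leaves as one-manifolds\<close>

lemma topspace_fiber:
  assumes "(U, \<phi>) \<in> \<F>"
  shows "topspace (subtopology X {w \<in> U. snd (\<phi> w) = y}) = {w \<in> U. snd (\<phi> w) = y}"
  using chart_subset[OF assms] by auto

lemma topspace_leaf_topology: "topspace \<Lambda> = topspace X"
proof -
  have "\<Union>(plaques X \<F>) = topspace X"
  proof (intro equalityI subsetI)
    fix z assume "z \<in> \<Union>(plaques X \<F>)"
    then obtain U \<phi> y C where "(U, \<phi>) \<in> \<F>" "z \<in> C"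
      "C \<in> connected_components_of (subtopology X {z \<in> U. snd (\<phi> z) = y})"
      by (auto simp: plaques_def)
    then have "z \<in> topspace (subtopology X {z \<in> U. snd (\<phi> z) = y})"
      using connected_components_of_subset by blast
    then show "z \<in> topspace X" by simp
  next
    fix z assume "z \<in> topspace X"
    then obtain U \<phi> where U: "(U, \<phi>) \<in> \<F>" "z \<in> U" using chart_ex by blast
    let ?S = "{w \<in> U. snd (\<phi> w) = snd (\<phi> z)}"
    have "z \<in> \<Union>(connected_components_of (subtopology X ?S))"
      unfolding Union_connected_components_of topspace_fiber[OF U(1)] using U by simp
    then show "z \<in> \<Union>(plaques X \<F>)" using U(1) unfolding plaques_def by blast
  qed
  then show ?thesis by (simp add: leaf_topology_def)
qed

text \<open>A fibre is the union of its connected components, and these are plaques.\<close>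

lemma fiber_leaf_open:
  assumes "(U, \<phi>) \<in> \<F>"
  shows "openin \<Lambda> {w \<in> U. snd (\<phi> w) = y}"
proof -
  let ?S = "{w \<in> U. snd (\<phi> w) = y}"
  have "openin \<Lambda> C" if "C \<in> connected_components_of (subtopology X ?S)" for C
    unfolding leaf_topology_def
    by (rule topology_generated_by_Basis) (use that assms in \<open>unfold plaques_def, blast\<close>)
  then have "openin \<Lambda> (\<Union>(connected_components_of (subtopology X ?S)))" by blast
  then show ?thesis by (simp only: Union_connected_components_of topspace_fiber[OF assms])
qed

lemma box_fiber_homeo:
  assumes b: "box U \<phi> J B" and z: "z \<in> U"
  shows "\<exists>\<psi>. homeomorphic_maps (subtopology X {w \<in> U. snd (\<phi> w) = snd (\<phi> z)}) (top_of_set J)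
    (\<lambda>w. fst (\<phi> w) 0) \<psi>"
proof -
  let ?P = "{w \<in> U. snd (\<phi> w) = snd (\<phi> z)}" and ?T = "prod_topology (top_of_set J) (subtopology Eucl B)"
  let ?\<phi> = "\<lambda>z. (fst (\<phi> z) 0, snd (\<phi> z))" let ?y = "snd (\<phi> z)"
  have c: "(U, \<phi>) \<in> \<F>" and h: "homeomorphic_map (subtopology X U) ?T ?\<phi>" and BE: "openin Eucl B"
    using b by (auto simp: box_def)
  obtain \<theta> where \<theta>: "homeomorphic_maps (subtopology X U) ?T ?\<phi> \<theta>" using h homeomorphic_map_maps by blast
  have tsU: "topspace (subtopology X U) = U" using chart_subset[OF c] by auto
  have tsB: "topspace (subtopology Eucl B) = B" using BE openin_subset by (metis inf.absorb_iff2 topspace_subtopology)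
  have cf: "continuous_map (subtopology X U) ?T ?\<phi>" and cb: "continuous_map ?T (subtopology X U) \<theta>"
    and inv1: "\<And>w. w \<in> U \<Longrightarrow> \<theta> (?\<phi> w) = w"
    and inv2: "\<And>s y. s \<in> J \<Longrightarrow> y \<in> B \<Longrightarrow> ?\<phi> (\<theta> (s, y)) = (s, y)"
    using \<theta> unfolding homeomorphic_maps_def tsU topspace_prod_topology tsB by auto
  have yB: "?y \<in> B"
  proof -
    have "?\<phi> z \<in> topspace ?T" using continuous_map_funspace[OF cf] z tsU by auto
    then show ?thesis by (simp add: tsB)
  qed
  have c1: "continuous_map (subtopology X ?P) (top_of_set J) (\<lambda>w. fst (\<phi> w) 0)"
  proof -
    have "continuous_map (subtopology X ?P) ?T ?\<phi>"
      by (rule continuous_map_from_subtopology_mono[OF cf]) auto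
    then have "continuous_map (subtopology X ?P) (top_of_set J) (fst \<circ> ?\<phi>)"
      by (rule continuous_map_compose[OF _ continuous_map_fst])
    then show ?thesis by (simp add: o_def)
  qed
  have "continuous_map (top_of_set J) ?T (\<lambda>s. (s, ?y))"
    by (rule continuous_map_pairedI) (use yB tsB in auto)
  then have "continuous_map (top_of_set J) (subtopology X U) (\<theta> \<circ> (\<lambda>s. (s, ?y)))"
    using cb continuous_map_compose by blast
  then have c2: "continuous_map (top_of_set J) (subtopology X U) (\<lambda>s. \<theta> (s, ?y))" by (simp add: o_def)
  then have "\<theta> (s, ?y) \<in> U" if "s \<in> J" for s
    using that tsU by (auto simp: continuous_map_def Pi_iff)
  then have in_P: "\<theta> (s, ?y) \<in> ?P" if "s \<in> J" for s
    using inv2[OF that yB] that by auto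
  have c3: "continuous_map (top_of_set J) (subtopology X ?P) (\<lambda>s. \<theta> (s, ?y))"
    using c2 in_P by (auto simp: continuous_map_in_subtopology)
  have "\<theta> (fst (\<phi> w) 0, ?y) = w" if "w \<in> ?P" for w using inv1[of w] that by simp
  then have "homeomorphic_maps (subtopology X ?P) (top_of_set J) (\<lambda>w. fst (\<phi> w) 0) (\<lambda>s. \<theta> (s, ?y))"
    using c1 c3 inv2[OF _ yB] unfolding homeomorphic_maps_def topspace_fiber[OF c] by auto
  then show ?thesis by blast
qed

lemma box_fiber_connected:
  assumes b: "box U \<phi> J B" and z: "z \<in> U"
  shows "connectedin X {w \<in> U. snd (\<phi> w) = snd (\<phi> z)}"
proof -
  let ?P = "{w \<in> U. snd (\<phi> w) = snd (\<phi> z)}"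
  have "connectedin euclidean J" using b by (simp add: box_def)
  then have J: "connected_space (top_of_set J)" by (rule connected_space_subtopology)
  have "subtopology X ?P homeomorphic_space top_of_set J"
    using box_fiber_homeo[OF assms] homeomorphic_space_def by blast
  then have "connected_space (subtopology X ?P)"
    using homeomorphic_connected_space J by blast
  moreover have "?P \<subseteq> topspace X" using chart_subset b by (auto simp: box_def)
  ultimately show ?thesis by (simp add: connectedin_def)
qed

text \<open>Induction over the generation of the topology, which needs only that plaques are a
  subbasis. For a plaque of another chart, a small box around \<open>z\<close> has a connected
  fibre; by compatibility it lies in one fibre of the other chart, hence in the component that
  contains \<open>z\<close>.\<close>

lemma leaf_open_local:
  assumes "openin \<Lambda> G" "z \<in> G" "(U, \<phi>) \<in> \<F>" "z \<in> U"
  shows "\<exists>W. openin X W \<and> z \<in> W \<and> {w \<in> U \<inter> W. snd (\<phi> w) = snd (\<phi> z)} \<subseteq> G"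
proof -
  have "generate_topology_on (plaques X \<F>) G"
    using assms(1) by (simp add: leaf_topology_def openin_topology_generated_by_iff)
  then show ?thesis using \<open>z \<in> G\<close>
  proof induction
    case (Int a b)
    then obtain W1 W2 where "openin X W1" "z \<in> W1" "{w \<in> U \<inter> W1. snd (\<phi> w) = snd (\<phi> z)} \<subseteq> a"
      "openin X W2" "z \<in> W2" "{w \<in> U \<inter> W2. snd (\<phi> w) = snd (\<phi> z)} \<subseteq> b" by auto
    then show ?case by (intro exI[of _ "W1 \<inter> W2"]) (auto intro: openin_Int)
  next
    case (UN K)
    then obtain k where "k \<in> K" "z \<in> k" by blast
    then obtain W where "openin X W" "z \<in> W" "{w \<in> U \<inter> W. snd (\<phi> w) = snd (\<phi> z)} \<subseteq> k"
      using UN.IH by blast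
    then show ?case using \<open>k \<in> K\<close> by (intro exI[of _ W]) auto
  next
    case (Basis Q)
    then obtain V \<psi> y where V: "(V, \<psi>) \<in> \<F>"
      and Q: "Q \<in> connected_components_of (subtopology X {w \<in> V. snd (\<psi> w) = y})"
      by (auto simp: plaques_def)
    let ?S = "{w \<in> V. snd (\<psi> w) = y}"
    have zS: "z \<in> ?S"
      using connected_components_of_subset[OF Q] Basis.prems topspace_fiber[OF V] by blast
    then have zV: "z \<in> V" by simp
    obtain U' J B where b: "box U' \<phi> J B" "z \<in> U'" "U' \<subseteq> U" "U' \<subseteq> V"
      by (rule box_ex[OF assms(3,4) chart_open[OF V] zV])
    let ?P = "{w \<in> U'. snd (\<phi> w) = snd (\<phi> z)}"
    have "?P \<subseteq> ?S"
    proof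
      fix w assume w: "w \<in> ?P"
      then have "snd (\<psi> w) = snd (\<psi> z)"
        using change_proj_constant[OF assms(3) V, of w z] b zV assms(4) by blast
      then show "w \<in> ?S" using w zS b(4) by auto
    qed
    then have "connectedin (subtopology X ?S) ?P"
      using box_fiber_connected[OF b(1,2)] by (simp add: connectedin_subtopology)
    moreover have "\<not> disjnt Q ?P" using Basis.prems b(2) by (auto simp: disjnt_iff)
    ultimately have "?P \<subseteq> Q" using connected_components_of_maximal[OF Q] by blast
    moreover have "openin X U'" using b(1) chart_open by (auto simp: box_def)
    moreover have "{w \<in> U \<inter> U'. snd (\<phi> w) = snd (\<phi> z)} \<subseteq> ?P" by blast
    ultimately show ?case using b(2) by (intro exI[of _ U']) blast
  qed auto
qed

text \<open>Through each point of \<open>G\<close> passes a fibre of the restricted chart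
  \<open>(U \<inter> G, \<phi>)\<close>, which is open in the leaf topology and contained in
  \<open>G\<close>.\<close>

lemma leaf_topology_finer:
  assumes "openin X G"
  shows "openin \<Lambda> G"
proof (subst openin_subopen, intro ballI)
  fix z assume z: "z \<in> G"
  then obtain U \<phi> where U: "(U, \<phi>) \<in> \<F>" "z \<in> U" using assms chart_ex openin_subset by blast
  have "openin \<Lambda> {w \<in> U \<inter> G. snd (\<phi> w) = snd (\<phi> z)}"
    by (rule fiber_leaf_open[OF restr[OF U(1) assms]])
  then show "\<exists>T. openin \<Lambda> T \<and> z \<in> T \<and> T \<subseteq> G"
    using z U(2) by (intro exI[of _ "{w \<in> U \<inter> G. snd (\<phi> w) = snd (\<phi> z)}"]) auto
qed

lemma leaf_topology_continuous_id: "continuous_map \<Lambda> X (\<lambda>z. z)"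
  unfolding continuous_map_def using leaf_topology_finer topspace_leaf_topology
  by (auto simp: Collect_conj_eq Collect_mem_eq openin_subset Int_absorb1)

text \<open>The two topologies agree on a single fibre, so the leafwise coordinate of a box, a
  homeomorphism for the topology of \<open>X\<close>, is also a chart of the leaf topology.\<close>

lemma leaf_topology_fiber:
  assumes c: "(U, \<phi>) \<in> \<F>"
  shows "subtopology \<Lambda> {w \<in> U. snd (\<phi> w) = y} = subtopology X {w \<in> U. snd (\<phi> w) = y}"
proof -
  let ?P = "{w \<in> U. snd (\<phi> w) = y}"
  have "openin (subtopology X ?P) T" if T: "openin (subtopology \<Lambda> ?P) T" for T
  proof (subst openin_subopen, intro ballI)
    fix z assume z: "z \<in> T"
    obtain G where G: "openin \<Lambda> G" "T = G \<inter> ?P" using T by (auto simp: openin_subtopology)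
    have zG: "z \<in> G" "z \<in> U" "snd (\<phi> z) = y" using z G(2) by auto
    obtain W where W: "openin X W" "z \<in> W" "{w \<in> U \<inter> W. snd (\<phi> w) = snd (\<phi> z)} \<subseteq> G"
      using leaf_open_local[OF G(1) zG(1) c zG(2)] by blast
    have "openin (subtopology X ?P) (W \<inter> ?P)" using W(1) by (auto simp: openin_subtopology)
    moreover have "z \<in> W \<inter> ?P" using W zG by auto
    moreover have "W \<inter> ?P \<subseteq> T" using W(3) zG(3) G(2) by auto
    ultimately show "\<exists>T'. openin (subtopology X ?P) T' \<and> z \<in> T' \<and> T' \<subseteq> T" by blast
  qed
  moreover have "openin (subtopology \<Lambda> ?P) T" if "openin (subtopology X ?P) T" for T
    using that leaf_topology_finer unfolding openin_subtopology by blast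
  ultimately show ?thesis unfolding topology_eq by blast
qed

lemma box_interval_chart:
  assumes b: "box U \<phi> J B" and z: "z \<in> U"
  shows "\<exists>\<psi>. interval_chart \<Lambda> {w \<in> U. snd (\<phi> w) = snd (\<phi> z)} (\<lambda>w. fst (\<phi> w) 0) \<psi> J"
proof -
  have c: "(U, \<phi>) \<in> \<F>" "open J" "connected J" using b by (auto simp: box_def)
  show ?thesis
    using box_fiber_homeo[OF assms] c fiber_leaf_open[OF c(1)]
    unfolding interval_chart_def leaf_topology_fiber[OF c(1)] by blast
qed

lemma leaf_charts:
  assumes "q \<in> topspace \<Lambda>"
  shows "\<exists>I \<tau> \<psi> J. interval_chart \<Lambda> I \<tau> \<psi> J \<and> q \<in> I"
proof -
  have "q \<in> topspace X" using assms topspace_leaf_topology by simp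
  then obtain U \<phi> where U: "(U, \<phi>) \<in> \<F>" "q \<in> U" using chart_ex by blast
  then obtain U' J B where b: "box U' \<phi> J B" "q \<in> U'"
    using box_ex[OF U chart_open[OF U(1)] U(2)] by metis
  then show ?thesis using box_interval_chart[OF b] by blast
qed

lemma leaf_topology_Hausdorff: "Hausdorff_space \<Lambda>"
  unfolding Hausdorff_space_def
proof (intro allI impI)
  fix x y assume "x \<in> topspace \<Lambda> \<and> y \<in> topspace \<Lambda> \<and> x \<noteq> y"
  then obtain U V where "openin X U" "openin X V" "x \<in> U" "y \<in> V" "disjnt U V"
    using haus unfolding Hausdorff_space_def topspace_leaf_topology by metis
  then show "\<exists>U V. openin \<Lambda> U \<and> openin \<Lambda> V \<and> x \<in> U \<and> y \<in> V \<and> disjnt U V"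
    using leaf_topology_finer by blast
qed

lemma leaf_topology_locally_path_connected: "locally_path_connected_space \<Lambda>"
  by (rule interval_charts_locally_path_connected[OF leaf_charts])

lemma leaf_open:
  assumes "L \<in> leaves X \<F>"
  shows "openin \<Lambda> L"
  using assms leaf_topology_locally_path_connected
  unfolding leaves_def by (rule openin_path_components_of_locally_path_connected_space[rotated])

lemma leaf_connected:
  assumes "L \<in> leaves X \<F>"
  shows "connectedin \<Lambda> L"
  using assms unfolding leaves_def
  by (intro path_connectedin_imp_connectedin path_connectedin_path_components_of)

lemma leaf_ex:
  assumes "z \<in> topspace X"
  shows "\<exists>L\<in>leaves X \<F>. z \<in> L"
  using assms Union_path_components_of[of \<Lambda>] topspace_leaf_topology unfolding leaves_def by blast

lemma leaf_contains_box_fiber: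
  assumes L: "L \<in> leaves X \<F>" and b: "box U \<phi> J B" and z: "z \<in> U" "z \<in> L"
    and w: "w \<in> U" "snd (\<phi> w) = snd (\<phi> z)"
  shows "w \<in> L"
proof -
  let ?P = "{w \<in> U. snd (\<phi> w) = snd (\<phi> z)}"
  have "path_connectedin \<Lambda> ?P"
    using box_interval_chart[OF b z(1)] interval_charts_path_connectedin by blast
  moreover have "\<not> disjnt L ?P" using z by (auto simp: disjnt_iff)
  ultimately have "?P \<subseteq> L" using path_components_of_maximal L unfolding leaves_def by blast
  then show ?thesis using w by blast
qed

lemma leaf_two_rays:
  assumes "L \<in> leaves X \<F>"
  obtains D1 F1 D2 F2 where "is_ray \<Lambda> D1 F1" "is_ray \<Lambda> D2 F2" "L = F1 ` D1 \<union> F2 ` D2"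
proof -
  let ?S = "subtopology \<Lambda> L"
  have sub: "L \<subseteq> topspace \<Lambda>" using leaf_open[OF assms] openin_subset by blast
  have ts: "topspace ?S = L" using sub by auto
  have ne: "topspace ?S \<noteq> {}"
    using assms nonempty_path_components_of unfolding ts leaves_def by blast
  have conn: "connected_space ?S" using leaf_connected[OF assms] by (simp add: connectedin_def)
  obtain D1 F1 D2 F2 where r: "is_ray ?S D1 F1" "is_ray ?S D2 F2" "topspace ?S = F1 ` D1 \<union> F2 ` D2"
    using one_manifold_two_rays[OF Hausdorff_space_subtopology[OF leaf_topology_Hausdorff] conn ne
        interval_charts_open_subset[OF leaf_charts leaf_open[OF assms]]] by metis
  have "is_ray \<Lambda> D F" if "is_ray ?S D F" for D F
    using that unfolding is_ray_def continuous_map_in_subtopology by blast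
  then show ?thesis using r that unfolding ts by blast
qed

lemma long_leaf_ray:
  assumes "long_leaf X \<F> L"
  obtains F where "is_ray \<Lambda> UNIV F" "range F \<subseteq> L"
proof -
  have L: "L \<in> leaves X \<F>" and nm: "\<not> metrizable_space (subtopology \<Lambda> L)"
    using assms by (auto simp: long_leaf_def)
  have conn: "connected_space (subtopology \<Lambda> L)" using leaf_connected[OF L] by (simp add: connectedin_def)
  obtain F where "is_ray (subtopology \<Lambda> L) UNIV F"
    using nonmetrizable_one_manifold_long_ray[OF Hausdorff_space_subtopology[OF leaf_topology_Hausdorff]
        conn nm interval_charts_open_subset[OF leaf_charts leaf_open[OF L]]] by metis
  then show ?thesis using that[of F] unfolding is_ray_def continuous_map_in_subtopology by auto
qed

end

section \<open>Foliations of the product with the long ray\<close>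

context one_dim_foliation
begin

text \<open>Inside a box, \<open>S\<close> is a union of fibres of the transverse projection. That
  projection is continuous and open, so closure and interior preserve unions of fibres. Concretely,
  the fibre saturation of the part of the set in \<open>U\<close> is open and lies in the closure,
  hence in the interior of the closure.\<close>

lemma interior_closure_saturated:
  assumes S: "S = \<Union>\<A>" "\<A> \<subseteq> leaves X \<F>" and b: "box U \<phi> J B"
    and z: "z \<in> U" "z \<in> X interior_of (X closure_of S)" and w: "w \<in> U" "snd (\<phi> w) = snd (\<phi> z)"
  shows "w \<in> X interior_of (X closure_of S)"
proof -
  let ?\<pi> = "\<lambda>z. snd (\<phi> z)" let ?O = "X interior_of (X closure_of S)"
  have c: "(U, \<phi>) \<in> \<F>" using b by (simp add: box_def)
  have pull: "openin X {u \<in> U. ?\<pi> u \<in> T}" if "openin Eucl T" for T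
  proof -
    have "openin (subtopology X U) {u \<in> topspace (subtopology X U). ?\<pi> u \<in> T}"
      by (rule openin_continuous_map_preimage[OF chart_proj_continuous[OF c] that])
    moreover have "topspace (subtopology X U) = U" using chart_subset[OF c] by auto
    ultimately show ?thesis using chart_open[OF c] openin_open_subtopology by metis
  qed
  let ?T = "?\<pi> ` (?O \<inter> U)"
  have T: "openin Eucl ?T"
    by (rule chart_proj_open[OF c]) (use chart_open[OF c] in auto)
  have "{u \<in> U. ?\<pi> u \<in> ?T} \<subseteq> X closure_of S"
  proof
    fix u assume u: "u \<in> {u \<in> U. ?\<pi> u \<in> ?T}"
    show "u \<in> X closure_of S"
      unfolding in_closure_of
    proof (intro conjI allI impI)
      show "u \<in> topspace X" using u chart_subset[OF c] by blast
      fix G assume G: "u \<in> G \<and> openin X G"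
      let ?G = "G \<inter> U"
      have opG: "openin Eucl (?\<pi> ` ?G)"
        by (rule chart_proj_open[OF c]) (use G chart_open[OF c] in auto)
      obtain v where v: "v \<in> ?O \<inter> U" "?\<pi> u = ?\<pi> v" using u by blast
      \<comment> \<open>\<open>?H\<close> consists of the points of \<open>U\<close> whose fibre
        meets \<open>G\<close>. It is an open neighbourhood of \<open>v\<close>, so it contains some
        \<open>s\<close> of \<open>S\<close>; moving along the fibre of \<open>s\<close>, within one
        leaf, leads to a point of \<open>S\<close> in \<open>G\<close>.\<close>
      let ?H = "{u \<in> U. ?\<pi> u \<in> ?\<pi> ` ?G}"
      have "u \<in> ?G" using G u by blast
      then have "?\<pi> v \<in> ?\<pi> ` ?G" using v(2) by (metis imageI)
      then have "v \<in> ?H" using v(1) by blast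
      moreover have "v \<in> X closure_of S" using v(1) interior_of_subset[of X "X closure_of S"] by blast
      ultimately obtain s where s: "s \<in> S" "s \<in> ?H" using pull[OF opG] unfolding in_closure_of by meson
      then obtain w' where w': "w' \<in> ?G" "?\<pi> w' = ?\<pi> s" by force
      obtain L where L: "L \<in> \<A>" "s \<in> L" using s(1) S(1) by blast
      have "w' \<in> L"
        by (rule leaf_contains_box_fiber[OF _ b]) (use L S(2) s w' in auto)
      then show "\<exists>y. y \<in> S \<and> y \<in> G" using L w' S(1) by blast
    qed
  qed
  then have "{u \<in> U. ?\<pi> u \<in> ?T} \<subseteq> ?O" using pull[OF T] by (simp add: interior_of_maximal)
  moreover have "w \<in> {u \<in> U. ?\<pi> u \<in> ?T}" using w z by force
  ultimately show ?thesis by blast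
qed

end

locale long_product_foliation = one_dim_foliation "prod_topology M long_ray" k \<F>
  for M :: "'a topology" and k and \<F> :: "('a \<times> closed_long_ray) chart set" +
  assumes squat: "squat M"
begin

abbreviation "XX \<equiv> prod_topology M long_ray"

lemma openin_long_ray: "openin long_ray R \<longleftrightarrow> open R \<and> bot \<notin> R"
  by (auto simp: openin_open_eq open_Compl)

lemma openin_product_greaterThan:
  assumes "openin M N"
  shows "openin XX (N \<times> {a<..})"
  using assms by (simp add: openin_prod_Times_iff openin_long_ray not_less)

lemma product_nbhd:
  assumes G: "openin XX G" "(x, r) \<in> G" "a < r"
  obtains N t t' where "openin M N" "x \<in> N" "a < t" "t < r" "r < t'" "N \<times> {t..t'} \<subseteq> G"
proof -
  obtain N R where NR: "openin M N" "openin long_ray R" "x \<in> N" "r \<in> R" "N \<times> R \<subseteq> G"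
    using G(1,2) unfolding openin_prod_topology_alt by metis
  have "open R" using NR(2) by (simp add: openin_long_ray)
  obtain c where "r < c" using gt_ex by blast
  then obtain t0 t1 where t01: "t0 < r" "{t0<..r} \<subseteq> R" "r < t1" "{r..<t1} \<subseteq> R"
    using open_left[OF \<open>open R\<close> NR(4) G(3)] open_right[OF \<open>open R\<close> NR(4)] by metis
  obtain t where t: "max a t0 < t" "t < r" using dense[of "max a t0" r] t01(1) G(3) by auto
  obtain t' where t': "r < t'" "t' < t1" using dense[OF t01(3)] by blast
  have "{t..t'} \<subseteq> R"
  proof
    fix s assume "s \<in> {t..t'}"
    then have "s \<in> {t0<..r} \<or> s \<in> {r..<t1}" using t t' by auto
    then show "s \<in> R" using t01 by blast
  qed
  then show ?thesis using that[of N t t'] NR t t' by auto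
qed

text \<open>Asking for a whole product \<open>N \<times> {t..t'}\<close> inside \<open>U\<close>, not only for \<open>{x} \<times> {t..t'}\<close>, makes
  this set closed without an appeal to the tube lemma.\<close>

definition vertical :: "closed_long_ray \<Rightarrow> 'a set"
  where "vertical a = {x \<in> topspace M. \<forall>U \<phi> N t t'. (U, \<phi>) \<in> \<F> \<longrightarrow> openin M N \<longrightarrow> x \<in> N \<longrightarrow> a < t \<longrightarrow> t \<le> t' \<longrightarrow>
    N \<times> {t..t'} \<subseteq> U \<longrightarrow> snd (\<phi> (x, t)) = snd (\<phi> (x, t'))}"

lemma verticalD:
  assumes "x \<in> vertical a" "(U, \<phi>) \<in> \<F>" "openin M N" "x \<in> N" "a < t" "N \<times> {t..t'} \<subseteq> U"
    "s \<in> {t..t'}" "s' \<in> {t..t'}"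
  shows "snd (\<phi> (x, s)) = snd (\<phi> (x, s'))"
proof -
  have *: "snd (\<phi> (x, p)) = snd (\<phi> (x, q))" if "p \<le> q" "t \<le> p" "q \<le> t'" for p q
  proof -
    have "N \<times> {p..q} \<subseteq> U" using assms(6) that by fastforce
    moreover have "a < p" using assms(5) that by simp
    ultimately show ?thesis using assms(1-4) that(1) unfolding vertical_def by blast
  qed
  show ?thesis
  proof (cases "s \<le> s'")
    case True
    then show ?thesis using *[OF True] assms(7,8) by simp
  next
    case False
    then have "s' \<le> s" by simp
    then show ?thesis using *[OF \<open>s' \<le> s\<close>] assms(7,8) by simp
  qed
qed

lemma vertical_mono: "a \<le> a' \<Longrightarrow> vertical a \<subseteq> vertical a'"
  unfolding vertical_def by (auto intro: le_less_trans)

text \<open>The data \<open>U\<close>, \<phi>, \<open>N\<close>, \<open>t\<close>, \<open>t'\<close>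
  that witness failure at \<open>x\<close> can be kept for nearby points of \<open>N\<close>, since
  the inequality of the two transverse coordinates is an open condition.\<close>

lemma vertical_closed: "closedin M (vertical a)"
proof -
  have sub: "vertical a \<subseteq> topspace M" by (auto simp: vertical_def)
  have "openin M (topspace M - vertical a)"
  proof (subst openin_subopen, intro ballI)
    fix x assume x: "x \<in> topspace M - vertical a"
    then obtain U \<phi> N t t' where U: "(U, \<phi>) \<in> \<F>" and N: "openin M N" "x \<in> N" and t: "a < t" "t \<le> t'"
      and sub: "N \<times> {t..t'} \<subseteq> U" and ne: "snd (\<phi> (x, t)) \<noteq> snd (\<phi> (x, t'))"
      unfolding vertical_def by blast
    have NM: "N \<subseteq> topspace M" using N(1) openin_subset by blast
    have cont: "continuous_map (subtopology M N) Eucl (\<lambda>x. snd (\<phi> (x, s)))" if s: "s \<in> {t..t'}" for s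
    proof -
      have "s \<noteq> bot" using s t(1) by (metis atLeastAtMost_iff bot.extremum_strict less_le_trans)
      then have "continuous_map (subtopology M N) XX (\<lambda>x. (x, s))"
        by (intro continuous_map_pairedI continuous_map_from_subtopology) auto
      then have "continuous_map (subtopology M N) (subtopology XX U) (\<lambda>x. (x, s))"
        using sub s by (auto simp: continuous_map_in_subtopology)
      then have "continuous_map (subtopology M N) Eucl ((\<lambda>z. snd (\<phi> z)) \<circ> (\<lambda>x. (x, s)))"
        using chart_proj_continuous[OF U] continuous_map_compose by blast
      then show ?thesis by (simp add: o_def)
    qed
    have tt: "t \<in> {t..t'}" "t' \<in> {t..t'}" using t by auto
    have "closedin (subtopology M N) {x \<in> topspace (subtopology M N). snd (\<phi> (x, t)) = snd (\<phi> (x, t'))}"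
      by (rule closedin_continuous_maps_eq[OF Hausdorff_Euclidean_space cont[OF tt(1)] cont[OF tt(2)]])
    moreover have "topspace (subtopology M N) -
        {x \<in> topspace (subtopology M N). snd (\<phi> (x, t)) = snd (\<phi> (x, t'))} =
        {y \<in> N. snd (\<phi> (y, t)) \<noteq> snd (\<phi> (y, t'))}" using NM by auto
    ultimately have "openin (subtopology M N) {y \<in> N. snd (\<phi> (y, t)) \<noteq> snd (\<phi> (y, t'))}"
      unfolding closedin_def by metis
    then have "openin M {y \<in> N. snd (\<phi> (y, t)) \<noteq> snd (\<phi> (y, t'))}"
      using N(1) openin_open_subtopology by blast
    moreover have "{y \<in> N. snd (\<phi> (y, t)) \<noteq> snd (\<phi> (y, t'))} \<subseteq> topspace M - vertical a"
      using verticalD[OF _ U N(1) _ t(1) sub tt] NM by auto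
    ultimately show "\<exists>T. openin M T \<and> x \<in> T \<and> T \<subseteq> topspace M - vertical a"
      using N(2) ne by (intro exI[of _ "{y \<in> N. snd (\<phi> (y, t)) \<noteq> snd (\<phi> (y, t'))}"]) auto
  qed
  then show ?thesis using sub by (simp add: closedin_def)
qed

lemma leaf_proj_continuous:
  assumes "continuous_map T \<Lambda> F"
  shows "continuous_map T M (\<lambda>t. fst (F t))" "continuous_map T long_ray (\<lambda>t. snd (F t))"
proof -
  have "continuous_map T XX ((\<lambda>z. z) \<circ> F)"
    by (rule continuous_map_compose[OF assms leaf_topology_continuous_id])
  then have "continuous_map T XX F" by (simp add: o_def)
  then show "continuous_map T M (\<lambda>t. fst (F t))" "continuous_map T long_ray (\<lambda>t. snd (F t))"
    using continuous_map_compose[OF _ continuous_map_fst] continuous_map_compose[OF _ continuous_map_snd]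
    by (force simp: o_def)+
qed

section \<open>Heights along rays and leaves\<close>

text \<open>Squatness fixes the \<open>M\<close>-coordinate from \<beta> on, so the height
  \<open>h\<close> is injective there. It is unbounded and increasing, hence sweeps out all large
  heights, and the line over \<open>x\<close> is traced inside the leaf topology, along which
  transverse coordinates are locally constant.\<close>

lemma long_ray_eventually_vertical:
  assumes ray: "is_ray \<Lambda> UNIV F"
  obtains x g where "x \<in> vertical g" "\<And>t. g < snd (F t) \<Longrightarrow> fst (F t) = x"
proof -
  have cF: "continuous_map euclidean \<Lambda> F" and inj: "inj F" using ray by (auto simp: is_ray_def)
  define h where "h t = snd (F t)" for t
  have hc: "continuous_on S h" for S
    using leaf_proj_continuous(2)[OF cF] continuous_on_subset
    unfolding h_def by (auto simp: continuous_map_in_subtopology)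
  have "continuous_map long_ray M (\<lambda>t. fst (F t))"
    by (rule continuous_map_from_subtopology[OF leaf_proj_continuous(1)[OF cF]])
  then obtain \<beta> x where \<beta>: "\<beta> \<in> long_ray_set" and x: "x \<in> topspace M"
    "\<And>\<alpha>. \<alpha> \<in> long_ray_set \<Longrightarrow> \<beta> \<le> \<alpha> \<Longrightarrow> fst (F \<alpha>) = x"
    using squat unfolding squat_def by metis
  have Fx: "F u = (x, h u)" if "\<beta> \<le> u" for u
  proof -
    have "u \<in> long_ray_set" using \<beta> that by (auto simp: bot_unique)
    then show ?thesis using x(2)[OF _ that] by (simp add: h_def prod_eq_iff)
  qed
  have hinj: "inj_on h {\<beta>..}"
  proof (rule inj_onI)
    fix u v assume uv: "u \<in> {\<beta>..}" "v \<in> {\<beta>..}" "h u = h v"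
    then have "F u = F v" using Fx[of u] Fx[of v] by simp
    then show "u = v" using inj by (simp add: inj_eq)
  qed
  have bound: "\<exists>c. \<forall>u\<le>v. h u \<le> c" for v
  proof -
    have "compact (h ` {..v})" using compact_ray_atMost hc compact_continuous_image by blast
    then show ?thesis using compact_attains_sup[of "h ` {..v}"] by blast
  qed
  \<comment> \<open>If \<open>h\<close> were bounded by \<open>c\<close>, its values would lie in a
    part of the ray with a countable order-dense set, into which no tail of the long ray maps
    continuously and injectively.\<close>
  have unbounded: "\<exists>w>\<beta>. c < h w" for c
  proof (rule ccontr)
    assume "\<not> ?thesis"
    then have le: "h w \<le> c" if "\<beta> < w" for w using that by (meson not_le_imp_less)
    show False
    proof (rule no_continuous_inj_from_ray[OF hc, of \<beta> "{z. ray_coord z \<in> \<rat> \<and> z \<le> c}"])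
      show "inj_on h {\<beta><..}" by (rule inj_on_subset[OF hinj]) auto
      show "countable {z. ray_coord z \<in> \<rat> \<and> z \<le> c}" by (rule countable_ray_rational_below)
      fix p q assume q: "q \<in> h ` {\<beta><..}" and pq: "p < q"
      obtain d where d: "p < d" "d < q" "ray_coord d \<in> \<rat>" using ray_rational_dense[OF pq] by blast
      moreover have "q \<le> c" using q le by auto
      ultimately show "\<exists>d\<in>{z. ray_coord z \<in> \<rat> \<and> z \<le> c}. p < d \<and> d < q"
        by (intro bexI[of _ d]) auto
    qed
  qed
  \<comment> \<open>An injective continuous function on \<open>{u..w}\<close> is strictly monotone.
    Choosing \<open>w\<close> higher than everything up to \<open>v\<close> excludes the decreasing
    case.\<close>
  have mono: "h u < h v" if uv: "\<beta> \<le> u" "u < v" for u v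
  proof -
    obtain c where c: "\<And>u. u \<le> v \<Longrightarrow> h u \<le> c" using bound by blast
    obtain w where w: "\<beta> < w" "c < h w" using unbounded by blast
    have "v < w" using c[of w] w(2) by (meson leD not_le_imp_less)
    have "inj_on h {u..w}" by (rule inj_on_subset[OF hinj]) (use uv in auto)
    then have "(h u < h v \<and> h v < h w) \<or> (h w < h v \<and> h v < h u)"
      by (rule continuous_inj_imp_mono[OF uv(2) \<open>v < w\<close> hc])
    moreover have "h u \<le> c" using c uv(2) by simp
    ultimately show ?thesis using w(2) by auto
  qed
  have mono_le: "h u \<le> h v" if "\<beta> \<le> u" "u \<le> v" for u v
    using mono[OF that(1), of v] that(2) by (cases "u = v") (auto dest: le_neq_trans)
  \<comment> \<open>Heights above \<open>g\<close> occur only after \<beta>, where the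
    \<open>M\<close>-coordinate is already \<open>x\<close>.\<close>
  obtain g where g: "\<And>u. u \<le> \<beta> \<Longrightarrow> h u \<le> g" using bound by blast
  have "x \<in> vertical g"
    unfolding vertical_def
  proof (intro CollectI conjI allI impI x(1))
    fix U \<phi> N r r'
    assume U: "(U, \<phi>) \<in> \<F>" and N: "openin M N" "x \<in> N" and r: "g < r" "r \<le> r'" and sub: "N \<times> {r..r'} \<subseteq> U"
    obtain w where w: "\<beta> < w" "r' < h w" using unbounded by blast
    have hb: "h \<beta> < r" using g[of \<beta>] r(1) by simp
    obtain u where u: "\<beta> \<le> u" "u \<le> w" "h u = r"
      using IVT'[OF less_imp_le[OF hb] less_imp_le[OF le_less_trans[OF r(2) w(2)]] less_imp_le[OF w(1)] hc]
      by blast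
    obtain u' where u': "\<beta> \<le> u'" "u' \<le> w" "h u' = r'"
      using IVT'[OF less_imp_le[OF less_le_trans[OF hb r(2)]] less_imp_le[OF w(2)] less_imp_le[OF w(1)] hc]
      by blast
    have uu': "u \<le> u'" using mono[OF u'(1), of u] u u' r(2) by (meson leD not_le_imp_less)
    have in_U: "F s \<in> U" if "s \<in> {u..u'}" for s
    proof -
      have "h u \<le> h s" "h s \<le> h u'"
        using mono_le[OF u(1), of s] mono_le[OF order.trans[OF u(1)], of s u'] that by auto
      then show ?thesis using sub N(2) Fx[of s] that u u' by auto
    qed
    \<comment> \<open>Fibres are open in the leaf topology and \<open>F\<close> is continuous into
      it, so the transverse coordinate along \<open>F\<close> is locally constant, hence constant on
      the connected \<open>{u..u'}\<close>.\<close>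
    have "snd (\<phi> (F u)) = snd (\<phi> (F u'))"
    proof (rule connected_local_const[of "{u..u'}"])
      show "\<forall>a\<in>{u..u'}. \<forall>\<^sub>F b in at a within {u..u'}. snd (\<phi> (F a)) = snd (\<phi> (F b))"
      proof
        fix a assume a: "a \<in> {u..u'}"
        let ?P = "{w \<in> U. snd (\<phi> w) = snd (\<phi> (F a))}"
        have "open {t \<in> UNIV. F t \<in> ?P}" by (rule is_ray_vimage_open[OF ray fiber_leaf_open[OF U]])
        moreover have "a \<in> {t \<in> UNIV. F t \<in> ?P}" using in_U[OF a] by simp
        ultimately show "\<forall>\<^sub>F b in at a within {u..u'}. snd (\<phi> (F a)) = snd (\<phi> (F b))"
          unfolding eventually_at_topological by (intro exI[of _ "{t \<in> UNIV. F t \<in> ?P}"]) auto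
      qed
    qed (use uu' in auto)
    then show "snd (\<phi> (x, r)) = snd (\<phi> (x, r'))" using Fx[OF u(1)] Fx[OF u'(1)] u(3) u'(3) by simp
  qed
  moreover have "fst (F t) = x" if "g < snd (F t)" for t
  proof -
    have "\<beta> \<le> t" using g[of t] that unfolding h_def by (meson leD le_cases)
    then show ?thesis using Fx by simp
  qed
  ultimately show ?thesis using that by blast
qed

text \<open>For a ray with bounded domain the premise \<open>g < snd (F t)\<close> never holds for
  suitable \<open>g\<close>: countably many compact pieces have bounded heights, and countably many
  bounds have a common one.\<close>

lemma ray_bound:
  assumes ray: "is_ray \<Lambda> D F"
  shows "\<exists>g. \<forall>t\<in>D. g < snd (F t) \<longrightarrow> fst (F t) \<in> vertical g"
proof -
  consider "D = UNIV" | b where "D = {..<b}" using is_ray_domain[OF ray] by blast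
  then show ?thesis
  proof cases
    case 1
    obtain x g where "x \<in> vertical g" "\<And>t. g < snd (F t) \<Longrightarrow> fst (F t) = x"
      using long_ray_eventually_vertical ray 1 by metis
    then show ?thesis by metis
  next
    case (2 b)
    obtain \<K> where K: "countable \<K>" "\<And>K. K \<in> \<K> \<Longrightarrow> compactin \<Lambda> K" "F ` D \<subseteq> \<Union>\<K>"
      using is_ray_sigma_compact ray 2 by metis
    have "\<exists>c. \<forall>z\<in>K. snd z \<le> c" if "K \<in> \<K>" for K
    proof (cases "K = {}")
      case False
      have "continuous_map \<Lambda> long_ray (\<lambda>z. snd z)" by (rule leaf_proj_continuous(2)) simp
      then have "compactin long_ray (snd ` K)" using image_compactin[OF K(2)[OF that]] by blast
      then have "compact (snd ` K)" by (simp add: compactin_subtopology)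
      then show ?thesis using compact_attains_sup[of "snd ` K"] False by auto
    qed simp
    then obtain c where c: "\<And>K z. K \<in> \<K> \<Longrightarrow> z \<in> K \<Longrightarrow> snd z \<le> c K" by metis
    obtain g where g: "\<forall>a\<in>c ` \<K>. a < g" using ray_bounded_countable[of "c ` \<K>"] K(1) by auto
    have "\<not> g < snd (F t)" if t: "t \<in> D" for t
    proof -
      obtain K where "K \<in> \<K>" "F t \<in> K" using subsetD[OF K(3) imageI[OF t]] by blast
      then have "snd (F t) \<le> c K" "c K < g" using c g by auto
      then show ?thesis by simp
    qed
    then show ?thesis by blast
  qed
qed

lemma leaf_bound:
  assumes "L \<in> leaves XX \<F>"
  shows "\<exists>g. \<forall>z\<in>L. g < snd z \<longrightarrow> fst z \<in> vertical g"
proof -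
  obtain D1 F1 D2 F2 where r: "is_ray \<Lambda> D1 F1" "is_ray \<Lambda> D2 F2" "L = F1 ` D1 \<union> F2 ` D2"
    by (rule leaf_two_rays[OF assms])
  obtain g1 g2 where g: "\<forall>t\<in>D1. g1 < snd (F1 t) \<longrightarrow> fst (F1 t) \<in> vertical g1"
    "\<forall>t\<in>D2. g2 < snd (F2 t) \<longrightarrow> fst (F2 t) \<in> vertical g2"
    using ray_bound[OF r(1)] ray_bound[OF r(2)] by blast
  have "vertical g1 \<subseteq> vertical (max g1 g2)" "vertical g2 \<subseteq> vertical (max g1 g2)"
    by (simp_all add: vertical_mono)
  then show ?thesis using g r(3) by (intro exI[of _ "max g1 g2"]) auto
qed

section \<open>Verticality spreads to a neighbourhood and then to all of \<open>M\<close>\<close>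

lemma vertical_local:
  assumes x: "x \<in> vertical a" and r: "a < r" and c: "(U, \<phi>) \<in> \<F>" "(x, r) \<in> U"
  obtains t t' where "a < t" "t < r" "r < t'"
    "\<forall>s\<in>{t..t'}. (x, s) \<in> U \<and> snd (\<phi> (x, s)) = snd (\<phi> (x, r))"
proof -
  obtain N t t' where N: "openin M N" "x \<in> N" "a < t" "t < r" "r < t'" "N \<times> {t..t'} \<subseteq> U"
    by (rule product_nbhd[OF chart_open[OF c(1)] c(2) r])
  have "(x, s) \<in> U \<and> snd (\<phi> (x, s)) = snd (\<phi> (x, r))" if "s \<in> {t..t'}" for s
    using verticalD[OF x c(1) N(1,2,3,6) that, of r] N that less_imp_le[OF N(4)] less_imp_le[OF N(5)] by auto
  then show ?thesis using that N by blast
qed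

text \<open>Near each height the line over \<open>x\<close> runs in one fibre of a box, and a fibre
  lies entirely inside or outside the set. Membership is therefore locally constant on the connected
  \<open>{a<..}\<close>.\<close>

lemma vertical_saturated:
  assumes S: "S = \<Union>\<A>" "\<A> \<subseteq> leaves XX \<F>" and x: "x \<in> vertical a"
    and r0: "a < r0" "(x, r0) \<in> XX interior_of (XX closure_of S)" and r: "a < r"
  shows "(x, r) \<in> XX interior_of (XX closure_of S)"
proof -
  let ?O = "XX interior_of (XX closure_of S)"
  have "((x, r0) \<in> ?O) = ((x, r) \<in> ?O)"
  proof (rule connected_local_const[of "{a<..}"])
    show "\<forall>p\<in>{a<..}. \<forall>\<^sub>F q in at p within {a<..}. ((x, p) \<in> ?O) = ((x, q) \<in> ?O)"
    proof
      fix p assume "p \<in> {a<..}"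
      then have p: "a < p" by simp
      have "p \<noteq> bot" using p by (metis bot.extremum_strict)
      then have "(x, p) \<in> topspace XX" using x by (auto simp: vertical_def)
      then obtain U0 \<phi> where U0: "(U0, \<phi>) \<in> \<F>" "(x, p) \<in> U0" using chart_ex by blast
      \<comment> \<open>The open set handed to \<open>box_ex\<close> is the chart domain
        \<open>U0\<close> itself, whence the repeated inclusion.\<close>
      obtain U J B where b: "box U \<phi> J B" "(x, p) \<in> U" "U \<subseteq> U0" "U \<subseteq> U0"
        by (rule box_ex[OF U0 chart_open[OF U0(1)] U0(2)])
      have U: "(U, \<phi>) \<in> \<F>" using b(1) by (simp add: box_def)
      obtain t t' where t: "a < t" "t < p" "p < t'"
        "\<forall>s\<in>{t..t'}. (x, s) \<in> U \<and> snd (\<phi> (x, s)) = snd (\<phi> (x, p))"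
        by (rule vertical_local[OF x p U b(2)])
      have "((x, p) \<in> ?O) = ((x, q) \<in> ?O)" if "q \<in> {t<..<t'}" for q
      proof -
        have q: "(x, q) \<in> U" "snd (\<phi> (x, q)) = snd (\<phi> (x, p))" using bspec[OF t(4), of q] that by (simp_all add: less_imp_le)
        show ?thesis
          using interior_closure_saturated[OF S b(1) b(2) _ q]
            interior_closure_saturated[OF S b(1) q(1) _ b(2) q(2)[symmetric]] by blast
      qed
      then show "\<forall>\<^sub>F q in at p within {a<..}. ((x, p) \<in> ?O) = ((x, q) \<in> ?O)"
        unfolding eventually_at_topological using t by (intro exI[of _ "{t<..<t'}"]) auto
    qed
  qed (use r0 r in auto)
  then show ?thesis using r0 by simp
qed

text \<open>A product neighbourhood of \<open>(x, r)\<close> in the interior of the closure of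
  \<open>S\<close>, at a height \<open>r\<close> beyond the bounds of all the leaves in
  \<open>S\<close>, projects to the desired neighbourhood of \<open>x\<close>.\<close>

lemma vertical_neighbourhood:
  assumes sep: "separable_space M" and x: "x \<in> vertical a"
  shows "\<exists>g N. openin M N \<and> x \<in> N \<and> N \<subseteq> vertical g"
proof -
  obtain D where D: "countable D" "D \<subseteq> topspace M" "M closure_of D = topspace M"
    using sep by (auto simp: separable_space_def)
  obtain b where ab: "a < b" using gt_ex by blast
  \<comment> \<open>A countable dense set of heights in the slab; it exists because the slab is
    bounded by \<open>b\<close>.\<close>
  define Q where "Q = {z. ray_coord z \<in> \<rat> \<and> z \<le> b} \<inter> {a<..<b}"
  have "countable Q" unfolding Q_def using countable_ray_rational_below by (rule countable_Int1)
  have DQ: "D \<times> Q \<subseteq> topspace XX" using D(2) by (auto simp: Q_def)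
  define lf where "lf z = (SOME L. L \<in> leaves XX \<F> \<and> z \<in> L)" for z
  have lf: "lf z \<in> leaves XX \<F>" "z \<in> lf z" if "z \<in> D \<times> Q" for z
  proof -
    have "\<exists>L. L \<in> leaves XX \<F> \<and> z \<in> L" using leaf_ex[OF subsetD[OF DQ that]] by blast
    then have "lf z \<in> leaves XX \<F> \<and> z \<in> lf z" unfolding lf_def by (rule someI_ex)
    then show "lf z \<in> leaves XX \<F>" "z \<in> lf z" by auto
  qed
  define \<A> where "\<A> = lf ` (D \<times> Q)"
  define S where "S = \<Union>\<A>"
  have A: "countable \<A>" "\<A> \<subseteq> leaves XX \<F>" using D(1) \<open>countable Q\<close> lf by (auto simp: \<A>_def)
  have DQS: "D \<times> Q \<subseteq> S" using lf(2) unfolding S_def \<A>_def by blast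
  let ?O = "XX interior_of (XX closure_of S)"
  let ?B = "topspace M \<times> {a<..<b}"
  have Bop: "openin XX ?B" by (simp add: openin_prod_Times_iff openin_long_ray)
  have "?B \<subseteq> XX closure_of S"
  proof
    fix z assume z: "z \<in> ?B"
    show "z \<in> XX closure_of S"
      unfolding in_closure_of
    proof (intro conjI allI impI)
      show "z \<in> topspace XX" using z openin_subset[OF Bop] by blast
      fix G assume G: "z \<in> G \<and> openin XX G"
      obtain y r where yr: "z = (y, r)" by (cases z)
      have opGB: "openin XX (G \<inter> ?B)" using G Bop by blast
      have inGB: "(y, r) \<in> G \<inter> ?B" using G z yr by blast
      have "a < r" using z yr by simp
      obtain N t t' where N: "openin M N" "y \<in> N" "a < t" "t < r" "r < t'" "N \<times> {t..t'} \<subseteq> G \<inter> ?B"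
        by (rule product_nbhd[OF opGB inGB \<open>a < r\<close>])
      have "y \<in> M closure_of D" using D(3) z yr by simp
      then obtain d where d: "d \<in> D" "d \<in> N" using N(1,2) unfolding in_closure_of by blast
      obtain q where q: "t < q" "q < r" "ray_coord q \<in> \<rat>" using ray_rational_dense[OF N(4)] by blast
      have "q \<in> {t..t'}" using q N by auto
      then have dq: "(d, q) \<in> G \<inter> ?B" using d N(6) by blast
      then have "q \<in> Q" using q by (auto simp: Q_def)
      then show "\<exists>w. w \<in> S \<and> w \<in> G" using dq d DQS by blast
    qed
  qed
  then have BO: "?B \<subseteq> ?O" using Bop by (simp add: interior_of_maximal)
  have "\<forall>L\<in>\<A>. \<exists>g. \<forall>z\<in>L. g < snd z \<longrightarrow> fst z \<in> vertical g" using leaf_bound A(2) by blast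
  then obtain gl where gl: "\<And>L z. L \<in> \<A> \<Longrightarrow> z \<in> L \<Longrightarrow> gl L < snd z \<Longrightarrow> fst z \<in> vertical (gl L)" by metis
  \<comment> \<open>One height above the bounds of all countably many leaves. Including
    \<open>a\<close> ensures \<open>a < r\<close> for every \<open>r > g\<close>, as
    \<open>vertical_saturated\<close> demands.\<close>
  obtain g where g: "\<forall>c\<in>insert a (gl ` \<A>). c < g"
    using ray_bounded_countable[of "insert a (gl ` \<A>)"] A(1) by auto
  obtain r where gr: "g < r" using gt_ex by blast
  obtain r0 where r0: "a < r0" "r0 < b" using dense[OF ab] by blast
  have xM: "x \<in> topspace M" using x by (simp add: vertical_def)
  have "(x, r) \<in> ?O"
    by (rule vertical_saturated[OF S_def A(2) x r0(1)]) (use BO r0 xM g gr in auto)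
  then obtain N t t' where N: "openin M N" "x \<in> N" "g < t" "t < r" "r < t'" "N \<times> {t..t'} \<subseteq> ?O"
    using product_nbhd[OF openin_interior_of _ gr] by metis
  \<comment> \<open>Otherwise the product of the open complement of \<open>vertical g\<close> with
    \<open>{g<..}\<close> would be a neighbourhood of \<open>(y, r)\<close>, so it would meet
    \<open>S\<close>, although \<open>S\<close> lies over \<open>vertical g\<close> at these
    heights.\<close>
  have "N \<subseteq> vertical g"
  proof (rule subsetI, rule ccontr)
    fix y assume y: "y \<in> N" "y \<notin> vertical g"
    have op: "openin XX ((topspace M - vertical g) \<times> {g<..})"
      by (rule openin_product_greaterThan) (use vertical_closed in blast)
    have "(y, r) \<in> XX closure_of S" using N y interior_of_subset by fastforce
    moreover have "(y, r) \<in> (topspace M - vertical g) \<times> {g<..}"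
      using y gr openin_subset[OF N(1)] by auto
    ultimately obtain w where w: "w \<in> S" "w \<in> (topspace M - vertical g) \<times> {g<..}"
      using op unfolding in_closure_of by meson
    obtain L where L: "L \<in> \<A>" "w \<in> L" using w(1) S_def by blast
    have "gl L < g" using g L(1) by blast
    moreover have "g < snd w" using w(2) by auto
    ultimately have "fst w \<in> vertical (gl L)" using gl[OF L] by simp
    then have "fst w \<in> vertical g" using subsetD[OF vertical_mono[OF less_imp_le[OF \<open>gl L < g\<close>]]] by blast
    then show False using w(2) by auto
  qed
  then show ?thesis using N by blast
qed

text \<open>Each point of \<open>D\<close> in the open set \<open>V\<close> has its own height, and
  these countably many heights have a common bound \<open>b\<close>. Since
  \<open>D \<inter> V\<close> is dense in \<open>V\<close> and \<open>vertical b\<close> is closed,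
  \<open>V\<close> equals \<open>vertical b\<close>; it is then clopen and nonempty.\<close>

lemma vertical_everything:
  assumes sep: "separable_space M" and conn: "connected_space M" and ne: "vertical a \<noteq> {}"
  obtains b where "b \<noteq> bot" "vertical b = topspace M"
proof -
  obtain D where D: "countable D" "D \<subseteq> topspace M" "M closure_of D = topspace M"
    using sep by (auto simp: separable_space_def)
  define V where "V = (\<Union>g. vertical g)"
  have op: "openin M V"
  proof (subst openin_subopen, intro ballI)
    fix x assume "x \<in> V"
    then obtain g where "x \<in> vertical g" by (auto simp: V_def)
    then obtain g' N where "openin M N" "x \<in> N" "N \<subseteq> vertical g'" using vertical_neighbourhood[OF sep] by blast
    then show "\<exists>T. openin M T \<and> x \<in> T \<and> T \<subseteq> V" unfolding V_def by blast
  qed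
  obtain c where c: "\<And>d. d \<in> D \<inter> V \<Longrightarrow> d \<in> vertical (c d)" unfolding V_def by (metis IntE UN_E)
  \<comment> \<open>Inserting \<open>bot\<close> forces \<open>b\<close> to differ from
    \<open>bot\<close>, so \<open>b\<close> is a point of the open long ray.\<close>
  obtain b where b: "\<forall>e\<in>insert bot (c ` (D \<inter> V)). e < b"
    using ray_bounded_countable[of "insert bot (c ` (D \<inter> V))"] D(1) by auto
  have "D \<inter> V \<subseteq> vertical b"
  proof
    fix d assume d: "d \<in> D \<inter> V"
    then have "c d < b" using b by blast
    then show "d \<in> vertical b" using subsetD[OF vertical_mono[OF less_imp_le] c[OF d]] by blast
  qed
  then have "M closure_of (D \<inter> V) \<subseteq> vertical b" using vertical_closed by (simp add: closure_of_minimal)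
  moreover have "V \<subseteq> M closure_of (D \<inter> V)"
  proof
    fix x assume x: "x \<in> V"
    then have xM: "x \<in> M closure_of D" using op openin_subset D(3) by blast
    show "x \<in> M closure_of (D \<inter> V)"
      unfolding in_closure_of
    proof (intro conjI allI impI)
      show "x \<in> topspace M" using x op openin_subset by blast
      fix T assume T: "x \<in> T \<and> openin M T"
      then have "openin M (T \<inter> V)" "x \<in> T \<inter> V" using op x by auto
      then show "\<exists>y. y \<in> D \<inter> V \<and> y \<in> T" using xM unfolding in_closure_of by blast
    qed
  qed
  ultimately have "V = vertical b" unfolding V_def by blast
  moreover have "V \<noteq> {}" using ne unfolding V_def by blast
  ultimately have "vertical b = topspace M"
    using conn op vertical_closed[of b] by (metis connected_space_clopen_in)
  moreover have "b \<noteq> bot" using b by auto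
  ultimately show ?thesis using that by blast
qed

end

section \<open>The leaves above a height where every line is vertical\<close>

context long_product_foliation
begin

text \<open>In the restricted leaf topology every line is connected and open. The lines partition
  the space, so each is also closed and thus a connected component.\<close>

lemma leaves_above_vertical:
  assumes V: "vertical a = topspace M"
  shows "leaves (subtopology XX (topspace M \<times> {a<..})) (restrict_foliation \<F> (topspace M \<times> {a<..})) =
    {{x} \<times> {a<..} | x. x \<in> topspace M}"
proof -
  define W where "W = topspace M \<times> {a<..}"
  have opW: "openin XX W" unfolding W_def by (rule openin_product_greaterThan) simp
  let ?F = "restrict_foliation \<F> W" and ?Y = "subtopology XX W"
  interpret R: one_dim_foliation ?Y k ?F by (rule restrict_one_dim_foliation[OF opW])
  let ?L = "leaf_topology ?Y ?F"
  have tsY: "topspace ?Y = W" using openin_subset[OF opW] by (metis inf.absorb_iff2 topspace_subtopology)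
  have tsL: "topspace ?L = W" using R.topspace_leaf_topology tsY by simp
  note tsM = trans[OF tsL W_def]
  have FF: "?F \<subseteq> \<F>" using restr[OF _ opW] by (auto simp: restrict_foliation_def)
  have opY: "openin XX G" if "openin ?Y G" for G using that opW openin_open_subtopology by blast
  \<comment> \<open>\<open>G\<close> is open in the subspace above \<open>a\<close> and thus in the
    whole product, so \<open>(U \<inter> G, \<phi>)\<close> is a chart of \<F> and
    \<open>vertical_local\<close> keeps the nearby piece of the line inside \<open>G\<close> as
    well.\<close>
  have local: "\<exists>t t'. a < t \<and> t < r \<and> r < t' \<and>
      (\<forall>s\<in>{t..t'}. (x, s) \<in> U \<inter> G \<and> snd (\<phi> (x, s)) = snd (\<phi> (x, r)))"
    if x: "x \<in> topspace M" and r: "a < r" and U: "(U, \<phi>) \<in> ?F" "(x, r) \<in> U"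
      and G: "openin ?Y G" "(x, r) \<in> G" for x r U \<phi> G
  proof -
    have c: "(U \<inter> G, \<phi>) \<in> \<F>" by (rule restr[OF _ opY[OF G(1)]]) (use FF U(1) in blast)
    have xr: "(x, r) \<in> U \<inter> G" using U G by blast
    have "x \<in> vertical a" using x V by simp
    then show ?thesis using vertical_local[OF _ r c xr] by metis
  qed
  have cont: "continuous_map (top_of_set {a<..}) ?L (\<lambda>s. (x, s))" if x: "x \<in> topspace M" for x
    unfolding continuous_map_def
  proof (intro conjI allI impI)
    show "(\<lambda>s. (x, s)) \<in> topspace (top_of_set {a<..}) \<rightarrow> topspace ?L"
      using x unfolding tsM by auto
    fix G assume G: "openin ?L G"
    show "openin (top_of_set {a<..}) {s \<in> topspace (top_of_set {a<..}). (x, s) \<in> G}"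
    proof (subst openin_subopen, intro ballI)
      fix r assume r: "r \<in> {s \<in> topspace (top_of_set {a<..}). (x, s) \<in> G}"
      then have ar: "a < r" and rG: "(x, r) \<in> G" by auto
      have "(x, r) \<in> topspace ?Y" using x ar tsY by (simp add: W_def)
      then obtain U \<phi> where U: "(U, \<phi>) \<in> ?F" "(x, r) \<in> U" using R.chart_ex by blast
      obtain G' where G': "openin ?Y G'" "(x, r) \<in> G'" "{w \<in> U \<inter> G'. snd (\<phi> w) = snd (\<phi> (x, r))} \<subseteq> G"
        using R.leaf_open_local[OF G rG U] by blast
      obtain t t' where t: "a < t" "t < r" "r < t'"
        "\<forall>s\<in>{t..t'}. (x, s) \<in> U \<inter> G' \<and> snd (\<phi> (x, s)) = snd (\<phi> (x, r))"
        using local[OF x ar U G'(1,2)] by blast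
      have "(x, s) \<in> G" if "s \<in> {t<..<t'}" for s
        using bspec[OF t(4), of s] that G'(3) by (auto simp: less_imp_le)
      moreover have "{t<..<t'} \<subseteq> {a<..}" using t(1) by auto
      ultimately show "\<exists>T. openin (top_of_set {a<..}) T \<and> r \<in> T \<and>
          T \<subseteq> {s \<in> topspace (top_of_set {a<..}). (x, s) \<in> G}"
        using t(2,3) by (intro exI[of _ "{t<..<t'}"]) (auto simp: openin_open_eq)
    qed
  qed
  have conn: "connectedin ?L ({x} \<times> {a<..})" if "x \<in> topspace M" for x
  proof -
    have "connectedin (top_of_set {a<..}) {a<..}" by (simp add: connectedin_subtopology)
    then have "connectedin ?L ((\<lambda>s. (x, s)) ` {a<..})"
      using connectedin_continuous_map_image[OF cont[OF that]] by blast
    moreover have "(\<lambda>s. (x, s)) ` {a<..} = {x} \<times> {a<..}" by auto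
    ultimately show ?thesis by simp
  qed
  \<comment> \<open>In a leaf chart around \<open>(x, r)\<close> the line runs injectively and
    continuously through an interval, so by strict monotonicity it fills an open interval around the
    coordinate of \<open>(x, r)\<close>.\<close>
  have op: "openin ?L ({x} \<times> {a<..})" if x: "x \<in> topspace M" for x
  proof (subst openin_subopen, intro ballI)
    fix z assume "z \<in> {x} \<times> {a<..}"
    then obtain r where z: "z = (x, r)" and ar: "a < r" by auto
    have "(x, r) \<in> topspace ?Y" using x ar tsY by (simp add: W_def)
    then obtain U0 \<phi> where U0: "(U0, \<phi>) \<in> ?F" "(x, r) \<in> U0" using R.chart_ex by blast
    obtain U J B where b: "R.box U \<phi> J B" "(x, r) \<in> U" "U \<subseteq> U0" "U \<subseteq> U0"
      by (rule R.box_ex[OF U0 R.chart_open[OF U0(1)] U0(2)])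
    have U: "(U, \<phi>) \<in> ?F" using b(1) by (simp add: R.box_def)
    define P where "P = {w \<in> U. snd (\<phi> w) = snd (\<phi> (x, r))}"
    obtain \<psi> where c: "interval_chart ?L P (\<lambda>w. fst (\<phi> w) 0) \<psi> J"
      using R.box_interval_chart[OF b(1,2)] unfolding P_def by blast
    let ?\<tau> = "\<lambda>w. fst (\<phi> w) 0"
    obtain t t' where t: "a < t" "t < r" "r < t'"
      "\<forall>s\<in>{t..t'}. (x, s) \<in> U \<inter> U \<and> snd (\<phi> (x, s)) = snd (\<phi> (x, r))"
      using local[OF x ar U b(2) R.chart_open[OF U] b(2)] by blast
    have inP: "(x, s) \<in> P" if "s \<in> {t..t'}" for s using bspec[OF t(4) that] by (simp add: P_def)
    let ?h = "\<lambda>s. ?\<tau> (x, s)"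
    have sub: "{t..t'} \<subseteq> {a<..}" using t(1) by auto
    have hc: "continuous_on {t..t'} ?h"
    proof -
      have "continuous_map (top_of_set {t..t'}) ?L (\<lambda>s. (x, s))"
        by (rule continuous_map_from_subtopology_mono[OF cont[OF x] sub])
      then have "continuous_map (top_of_set {t..t'}) (subtopology ?L P) (\<lambda>s. (x, s))"
        using inP by (auto simp: continuous_map_in_subtopology)
      then have "continuous_map (top_of_set {t..t'}) euclideanreal (?\<tau> \<circ> (\<lambda>s. (x, s)))"
        using interval_chartD(5)[OF c] continuous_map_compose by blast
      then show ?thesis by (simp add: o_def)
    qed
    have tau_inj: "u = v" if "u \<in> P" "v \<in> P" "?\<tau> u = ?\<tau> v" for u v
      using interval_chartD(9)[OF c that(1)] interval_chartD(9)[OF c that(2)] that(3) by metis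
    have hinj: "inj_on ?h {t..t'}" using tau_inj inP by (blast intro: inj_onI)
    define l u where "l = min (?h t) (?h t')" and "u = max (?h t) (?h t')"
    have mid: "l < ?h r" "?h r < u"
      using continuous_inj_imp_mono[OF t(2,3) hc hinj] by (auto simp: l_def u_def)
    have hconn: "connected (?h ` {t..t'})" by (intro connected_continuous_image hc) simp
    have tt': "t \<le> t'" using t(2,3) by simp
    have "?h t \<in> ?h ` {t..t'}" "?h t' \<in> ?h ` {t..t'}" using tt' by auto
    then have "l \<in> ?h ` {t..t'}" "u \<in> ?h ` {t..t'}" by (auto simp: l_def u_def min_def max_def)
    then have lu: "{l<..<u} \<subseteq> ?h ` {t..t'}" using connected_contains_Ioo[OF hconn] by blast
    let ?T = "{w \<in> P. ?\<tau> w \<in> {l<..<u}}"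
    have "?T \<subseteq> {x} \<times> {a<..}"
    proof
      fix w assume w: "w \<in> ?T"
      then have "?\<tau> w \<in> ?h ` {t..t'}" using lu by blast
      then obtain s where s: "s \<in> {t..t'}" "?\<tau> w = ?\<tau> (x, s)" by blast
      then have "w = (x, s)" using tau_inj[OF _ inP[OF s(1)] s(2)] w by blast
      then show "w \<in> {x} \<times> {a<..}" using s(1) sub by blast
    qed
    moreover have "openin ?L ?T" by (rule interval_chart_vimage_open[OF c open_greaterThanLessThan])
    moreover have "z \<in> ?T" using inP[of r] t(2,3) mid z by (simp add: less_imp_le)
    ultimately show "\<exists>T. openin ?L T \<and> z \<in> T \<and> T \<subseteq> {x} \<times> {a<..}" by blast
  qed
  \<comment> \<open>The complement is the union of the lines over the other points of
    \<open>M\<close>, all of them open.\<close>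
  have cl: "closedin ?L ({x} \<times> {a<..})" if x: "x \<in> topspace M" for x
  proof -
    have eq: "topspace ?L - {x} \<times> {a<..} = (\<Union>y\<in>topspace M - {x}. {y} \<times> {a<..})"
      unfolding tsM by auto
    have "openin ?L (topspace ?L - {x} \<times> {a<..})"
      unfolding eq by (rule openin_Union) (use op in auto)
    moreover have "{x} \<times> {a<..} \<subseteq> topspace ?L" using x unfolding tsM by auto
    ultimately show ?thesis by (simp add: closedin_def)
  qed
  have comp: "K = {x} \<times> {a<..}"
    if K: "K \<in> connected_components_of ?L" and x: "x \<in> topspace M" "(x, r) \<in> K" "a < r" for K x r
  proof
    have nd: "\<not> disjnt K ({x} \<times> {a<..})" using x by (auto simp: disjnt_iff)
    show "{x} \<times> {a<..} \<subseteq> K" using connected_components_of_maximal[OF K conn[OF x(1)] nd] .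
    have "connectedin ?L K" using K by (rule connectedin_connected_components_of)
    then show "K \<subseteq> {x} \<times> {a<..}"
      using connectedin_clopen_cases[OF _ cl[OF x(1)] op[OF x(1)]] nd by blast
  qed
  have Un: "\<Union>(connected_components_of ?L) = W" by (simp add: Union_connected_components_of tsL)
  have "connected_components_of ?L = {{x} \<times> {a<..} | x. x \<in> topspace M}"
  proof (intro equalityI subsetI)
    fix K assume K: "K \<in> connected_components_of ?L"
    then obtain z where z: "z \<in> K" using nonempty_connected_components_of by blast
    then have "z \<in> W" using K Un by blast
    then show "K \<in> {{x} \<times> {a<..} | x. x \<in> topspace M}"
      using comp[OF K, of "fst z" "snd z"] z unfolding W_def by (force simp: mem_Times_iff)
  next
    fix C assume "C \<in> {{x} \<times> {a<..} | x. x \<in> topspace M}"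
    then obtain x where x: "C = {x} \<times> {a<..}" "x \<in> topspace M" by blast
    obtain r where r: "a < r" using gt_ex by blast
    have "(x, r) \<in> \<Union>(connected_components_of ?L)" unfolding trans[OF Un W_def] using x r by simp
    then obtain K where "K \<in> connected_components_of ?L" "(x, r) \<in> K" by blast
    then show "C \<in> connected_components_of ?L" using comp[of K x r] x r by simp
  qed
  moreover have "path_components_of ?L = connected_components_of ?L"
    by (rule path_components_eq_connected_components_of[OF R.leaf_topology_locally_path_connected])
  ultimately show ?thesis unfolding leaves_def W_def[symmetric] by simp
qed

end

theorem theorem5p2:
  fixes M :: "'a topology" and n :: nat and \<F> :: "('a \<times> closed_long_ray) chart set"
  assumes "manifold n M" and "squat M" and "separable_space M"
    and "foliation (n + 1) 1 (prod_topology M long_ray) \<F>"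
    and "\<exists>L. long_leaf (prod_topology M long_ray) \<F> L"
  shows "\<exists>\<alpha> \<in> long_ray_set.
    leaves (subtopology (prod_topology M long_ray) (topspace M \<times> {\<alpha><..}))
      (restrict_foliation \<F> (topspace M \<times> {\<alpha><..})) =
    {{x} \<times> {\<alpha><..} | x. x \<in> topspace M}"
proof -
  interpret long_product_foliation M n \<F>
    using foliation_imp_one_dim_foliation[OF assms(4)] assms(2)
    by (simp add: long_product_foliation_def long_product_foliation_axioms_def)
  obtain L where "long_leaf (prod_topology M long_ray) \<F> L" using assms(5) by blast
  then obtain F where F: "is_ray (leaf_topology (prod_topology M long_ray) \<F>) UNIV F"
    using long_leaf_ray by metis
  obtain x g where x: "x \<in> vertical g" using long_ray_eventually_vertical[OF F] by metis
  have conn: "connected_space M" using assms(1) by (simp add: manifold_def)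
  have ne: "vertical g \<noteq> {}" using x by blast
  obtain \<alpha> where \<alpha>: "\<alpha> \<noteq> bot" "vertical \<alpha> = topspace M"
    by (rule vertical_everything[OF assms(3) conn ne])
  then show ?thesis using leaves_above_vertical[OF \<alpha>(2)] by (intro bexI[of _ \<alpha>]) auto
qed

end
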